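(* Let $Q$ be a Lie group of dimension $n$, let $\overline{TQ}=TQ\times[a,b]$ be its extended tangent bundle, equipped with the frame $(E_{q^1},\dots,E_{q^n},E_{\xi^1},\dots,E_{\xi^n},E_s)$ and dual coframe $(\theta^1,\dots,\theta^n,d\xi^1,\dots,d\xi^n,ds)$ induced by a left-invariant frame of $Q$ (see context). Let $\mathcal L$ be a smooth function on $\overline{TQ}$ such that the $n\times n$ matrix with entries $P_{ij}=E_{\xi^i}E_{\xi^j}\mathcal L$ is invertible (at every point). Let $p_1,\dots,p_n$ be smooth functions on $\overline{TQ}$ and define the 1-form $$\Theta=\mathcal L\,ds+\sum_{i=1}^n p_i\,(\theta^i-\xi^i\,ds).$$ Then the 2-form $d\Theta$ is nonsingular and the vortex lines of $\Theta$ are holonomic if and only if $$p_i=E_{\xi^i}\mathcal L\qquad\text{for all } i\in\{1,\dots,n\}.$$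
   Context: Framing of $\overline{TQ}$. $Q$ is a Lie group of dimension $n$ and $[a,b]\subset\mathbb R$. Points of $\overline{TQ}=TQ\times[a,b]$ are written $(q,X,s)$ with $q\in Q$, $X\in T_qQ$, $s\in[a,b]$; let $\sigma:\overline{TQ}\to Q$, $(q,X,s)\mapsto q$. Fix a basis of $T_eQ$, extend it to left-invariant vector fields $B_1,\dots,B_n$ on $Q$, and let $\beta^1,\dots,\beta^n$ be the dual left-invariant 1-forms. Set $\theta^i=\sigma^\star\beta^i$ (1-forms on $\overline{TQ}$) and $\xi^i(q,X,s)=\beta^i|_q(X)$ (functions on $\overline{TQ}$). Then $(\theta^1,\dots,\theta^n,d\xi^1,\dots,d\xi^n,ds)$ is a global coframe of the $(2n+1)$-dimensional manifold $\overline{TQ}$, and $(E_{q^1},\dots,E_{q^n},E_{\xi^1},\dots,E_{\xi^n},E_s)$ denotes its dual frame of vector fields. Nonsingular 2-forms and vortex lines. A 2-form $\omega$ on an odd-dimensional manifold $M$ is nonsingular if for every $m\in M$ the space $\{X\in T_mM:\omega(X,W)=0\ \forall W\in T_mM\}$ of null vectors has dimension exactly 1. If $\Theta$ is a 1-form with $d\Theta$ nonsingular, the vortex lines of $\Theta$ are the integral curves of the (nowhere vanishing) null direction field of $d\Theta$. Holonomic. A smooth curve $C$ in $\overline{TQ}$ is holonomic if, up to a smooth strictly monotonic reparametrization $s(t)$ (with nonvanishing derivative), it is the lift $s\mapsto(c(s),c'(s),s)$ of a smooth curve $c$ in $Q$; equivalently its tangent vector $C'$ satisfies $ds(C')\neq0$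 and $(\theta^i-\xi^i\,ds)(C')=0$ for all $i$ at every point. *)

theory Defs
  imports "HOL-Analysis.Analysis" "HOL-Library.Function_Algebras" "HOL-Algebra.Group"
begin

instantiation "fun" :: (type, real_vector) real_vector
begin

definition scaleR_fun :: "real \<Rightarrow> ('a \<Rightarrow> 'b) \<Rightarrow> 'a \<Rightarrow> 'b"
  where "scaleR_fun r f = (\<lambda>x. r *\<^sub>R f x)"

instance
  by standard (auto simp: scaleR_fun_def fun_eq_iff scaleR_add_right scaleR_add_left)

end

text \<open>\<open>Ck_on k f U\<close> is meant for open \<open>U\<close> in a finite-dimensional domain.\<close>

primrec Ck_on :: "nat \<Rightarrow> ('e::euclidean_space \<Rightarrow> 'f::real_normed_vector) \<Rightarrow> 'e set \<Rightarrow> bool" where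
  "Ck_on 0 f U \<longleftrightarrow> continuous_on U f"
| "Ck_on (Suc k) f U \<longleftrightarrow>
     (\<forall>x\<in>U. f differentiable (at x)) \<and>
     (\<forall>v. Ck_on k (\<lambda>x. frechet_derivative f (at x) v) U)"

text \<open>On a set that need not be open, smooth means locally extensible to a smooth function
  on an open set.\<close>

definition smooth_on :: "'e::euclidean_space set \<Rightarrow> ('e \<Rightarrow> 'f::real_normed_vector) \<Rightarrow> bool" where
  "smooth_on S f \<longleftrightarrow>
     (\<forall>x\<in>S. \<exists>U g. open U \<and> x \<in> U \<and> (\<forall>k. Ck_on k g U) \<and> (\<forall>y\<in>S \<inter> U. g y = f y))"

text \<open>A chart is a pair of its domain and its coordinate map.  An atlas has a model set \<open>H\<close>, a
  convex subset of a Euclidean space with nonempty interior, and the images of its charts are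
  relatively open in \<open>H\<close>.  Manifolds without boundary have \<open>H = UNIV\<close>; a product with a compact
  interval has \<open>H = UNIV \<times> {a..b}\<close>.  The topology of a manifold is the one induced by its atlas.\<close>

type_synonym ('p, 'e) chart = "'p set \<times> ('p \<Rightarrow> 'e)"

definition points :: "('p, 'e) chart set \<Rightarrow> 'p set" where
  "points A = \<Union> (fst ` A)"

definition charts_at :: "('p, 'e) chart set \<Rightarrow> 'p \<Rightarrow> ('p, 'e) chart set" where
  "charts_at A p = {c \<in> A. p \<in> fst c}"

definition chart_inv :: "('p, 'e) chart \<Rightarrow> 'e \<Rightarrow> 'p" where
  "chart_inv c = inv_into (fst c) (snd c)"

definition smooth_atlas :: "'e::euclidean_space set \<Rightarrow> ('p, 'e) chart set \<Rightarrow> bool" where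
  "smooth_atlas H A \<longleftrightarrow>
     (\<forall>c\<in>A. inj_on (snd c) (fst c)) \<and>
     (\<forall>c\<in>A. \<forall>d\<in>A. openin (top_of_set H) (snd c ` (fst c \<inter> fst d)) \<and>
        smooth_on (snd c ` (fst c \<inter> fst d)) (snd d \<circ> chart_inv c))"

definition atlas_topology :: "'e::euclidean_space set \<Rightarrow> ('p, 'e) chart set \<Rightarrow> 'p topology" where
  "atlas_topology H A = topology (\<lambda>W. W \<subseteq> points A \<and>
     (\<forall>c\<in>A. openin (top_of_set H) (snd c ` (fst c \<inter> W))))"

definition smooth_manifold :: "'e::euclidean_space set \<Rightarrow> ('p, 'e) chart set \<Rightarrow> bool" where
  "smooth_manifold H A \<longleftrightarrow> smooth_atlas H A \<and>
     Hausdorff_space (atlas_topology H A) \<and> second_countable (atlas_topology H A)"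

definition prod_atlas :: "('p, 'e) chart set \<Rightarrow> ('q, 'f) chart set \<Rightarrow> ('p \<times> 'q, 'e \<times> 'f) chart set"
  where "prod_atlas A B = (\<lambda>(c, d). (fst c \<times> fst d, map_prod (snd c) (snd d))) ` (A \<times> B)"

definition id_atlas :: "'e set \<Rightarrow> ('e, 'e) chart set" where
  "id_atlas S = {(S, id)}"

text \<open>The openness requirement expresses continuity.  \<open>H\<close> is the model set of \<open>A\<close>.\<close>

definition smooth_map ::
  "'e::euclidean_space set \<Rightarrow> ('p, 'e) chart set \<Rightarrow> ('q, 'f::euclidean_space) chart set \<Rightarrow>
    ('p \<Rightarrow> 'q) \<Rightarrow> bool" where
  "smooth_map H A B F \<longleftrightarrow> F ` points A \<subseteq> points B \<and>
     (\<forall>c\<in>A. \<forall>d\<in>B. openin (top_of_set H) (snd c ` (fst c \<inter> F -` fst d)) \<and>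
        smooth_on (snd c ` (fst c \<inter> F -` fst d)) (snd d \<circ> F \<circ> chart_inv c))"

definition smooth_function :: "'e::euclidean_space set \<Rightarrow> ('p, 'e) chart set \<Rightarrow> ('p \<Rightarrow> real) \<Rightarrow> bool"
  where "smooth_function H A = smooth_map H A (id_atlas UNIV)"

text \<open>The derivative is taken within the image of the chart, so it is one-sided at boundary points.
  It is unique because these images have enough interior.\<close>

definition chart_derivative ::
  "('p, 'e::euclidean_space) chart \<Rightarrow> ('p \<Rightarrow> 'f::real_normed_vector) \<Rightarrow> 'p \<Rightarrow> 'e \<Rightarrow> 'f" where
  "chart_derivative c F p v = frechet_derivative (F \<circ> chart_inv c) (at (snd c p) within snd c ` fst c) v"

text \<open>A tangent vector at \<open>p\<close> assigns to every chart around \<open>p\<close> a coordinate vector such that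
  these transform by the derivatives of the chart changes.\<close>

type_synonym ('p, 'e) tvec = "('p, 'e) chart \<Rightarrow> 'e"

definition tangent_space :: "('p, 'e::euclidean_space) chart set \<Rightarrow> 'p \<Rightarrow> ('p, 'e) tvec set" where
  "tangent_space A p = {X.
     (\<forall>c. c \<notin> charts_at A p \<longrightarrow> X c = 0) \<and>
     (\<forall>c\<in>charts_at A p. \<forall>d\<in>charts_at A p. X d = chart_derivative c (snd d) p (X c))}"

text \<open>By the transformation rule and the chain rule, the choice of the chart is irrelevant for a
  tangent vector \<open>X\<close> and a smooth \<open>F\<close>.\<close>

definition differential ::
  "('p, 'e::euclidean_space) chart set \<Rightarrow> ('p \<Rightarrow> 'f::real_normed_vector) \<Rightarrow> 'p \<Rightarrow> ('p, 'e) tvec \<Rightarrow> 'f"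
  where
  "differential A F p X = (let c = (SOME c. c \<in> charts_at A p) in chart_derivative c F p (X c))"

definition tangent_map ::
  "('p, 'e::euclidean_space) chart set \<Rightarrow> ('q, 'f::euclidean_space) chart set \<Rightarrow> ('p \<Rightarrow> 'q) \<Rightarrow>
    'p \<Rightarrow> ('p, 'e) tvec \<Rightarrow> ('q, 'f) tvec" where
  "tangent_map A B F p X =
     (\<lambda>d. if d \<in> charts_at B (F p) then differential A (snd d \<circ> F) p X else 0)"

definition velocity ::
  "('p, 'e::euclidean_space) chart set \<Rightarrow> real set \<Rightarrow> (real \<Rightarrow> 'p) \<Rightarrow> real \<Rightarrow> ('p, 'e) tvec" where
  "velocity A I C t =
     (\<lambda>d. if d \<in> charts_at A (C t) then vector_derivative (snd d \<circ> C) (at t within I) else 0)"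

definition deriv_along ::
  "('p, 'e::euclidean_space) chart set \<Rightarrow> ('p \<Rightarrow> ('p, 'e) tvec) \<Rightarrow> ('p \<Rightarrow> real) \<Rightarrow> 'p \<Rightarrow> real" where
  "deriv_along A E f p = differential A f p (E p)"

text \<open>The tangent vector at \<open>p\<close> whose coordinates in the chart \<open>c\<close> are \<open>v\<close>.\<close>

definition coord_vector ::
  "('p, 'e::euclidean_space) chart set \<Rightarrow> ('p, 'e) chart \<Rightarrow> 'e \<Rightarrow> 'p \<Rightarrow> ('p, 'e) tvec" where
  "coord_vector A c v p = (\<lambda>d. if d \<in> charts_at A p then chart_derivative c (snd d) p v else 0)"

text \<open>The exterior derivative of a 1-form is defined by its coordinate expression
  \<open>d\<alpha>(V, W) = \<Sum>i j. (\<partial>\<^sub>i \<alpha>\<^sub>j - \<partial>\<^sub>j \<alpha>\<^sub>i) V\<^sup>i W\<^sup>j\<close> in a chart around \<open>p\<close>, which for a smooth form does not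
  depend on the chart.\<close>

type_synonym ('p, 'e) form1 = "'p \<Rightarrow> ('p, 'e) tvec \<Rightarrow> real"
type_synonym ('p, 'e) form2 = "'p \<Rightarrow> ('p, 'e) tvec \<Rightarrow> ('p, 'e) tvec \<Rightarrow> real"

definition ext_deriv ::
  "('p, 'e::euclidean_space) chart set \<Rightarrow> ('p, 'e) form1 \<Rightarrow> ('p, 'e) form2" where
  "ext_deriv A \<alpha> p V W =
     (let c = (SOME c. c \<in> charts_at A p) in
        chart_derivative c (\<lambda>x. \<alpha> x (coord_vector A c (W c) x)) p (V c)
      - chart_derivative c (\<lambda>x. \<alpha> x (coord_vector A c (V c) x)) p (W c))"

definition null_space ::
  "('p, 'e::euclidean_space) chart set \<Rightarrow> ('p, 'e) form2 \<Rightarrow> 'p \<Rightarrow> ('p, 'e) tvec set" where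
  "null_space A \<omega> p = {X \<in> tangent_space A p. \<forall>W\<in>tangent_space A p. \<omega> p X W = 0}"

definition nonsingular_form :: "('p, 'e::euclidean_space) chart set \<Rightarrow> ('p, 'e) form2 \<Rightarrow> bool" where
  "nonsingular_form A \<omega> \<longleftrightarrow> (\<forall>p\<in>points A. dim (null_space A \<omega> p) = 1)"

definition smooth_curve ::
  "('p, 'e::euclidean_space) chart set \<Rightarrow> real set \<Rightarrow> (real \<Rightarrow> 'p) \<Rightarrow> bool" where
  "smooth_curve A I C \<longleftrightarrow>
     is_interval I \<and> interior I \<noteq> {} \<and> smooth_map I (id_atlas I) A C"

text \<open>A vortex line is an integral curve of a direction field, so its parametrization is arbitrary
  but regular.\<close>

definition vortex_line ::
  "('p, 'e::euclidean_space) chart set \<Rightarrow> ('p, 'e) form1 \<Rightarrow> real set \<Rightarrow> (real \<Rightarrow> 'p) \<Rightarrow> bool" where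
  "vortex_line A \<Theta> I C \<longleftrightarrow> smooth_curve A I C \<and>
     (\<forall>t\<in>I. velocity A I C t \<noteq> 0 \<and> velocity A I C t \<in> null_space A (ext_deriv A \<Theta>) (C t))"

definition tangent_bundle :: "('q, 'e::euclidean_space) chart set \<Rightarrow> ('q \<times> ('q, 'e) tvec) set" where
  "tangent_bundle A = (SIGMA q:points A. tangent_space A q)"

definition tangent_atlas ::
  "('q, 'e::euclidean_space) chart set \<Rightarrow> ('q \<times> ('q, 'e) tvec, 'e \<times> 'e) chart set" where
  "tangent_atlas A =
     (\<lambda>c. (SIGMA q:fst c. tangent_space A q, \<lambda>(q, X). (snd c q, X c))) ` A"

type_synonym ('q, 'e) ext_point = "('q \<times> ('q, 'e) tvec) \<times> real"

definition ext_tangent_atlas ::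
  "('q, 'e::euclidean_space) chart set \<Rightarrow> real \<Rightarrow> real \<Rightarrow>
    (('q, 'e) ext_point, ('e \<times> 'e) \<times> real) chart set" where
  "ext_tangent_atlas A a b = prod_atlas (tangent_atlas A) (id_atlas {a..b})"

definition ext_model :: "real \<Rightarrow> real \<Rightarrow> (('e \<times> 'e) \<times> real) set" where
  "ext_model a b = UNIV \<times> {a..b}"

lemma points_ext_tangent_atlas:
  "points (ext_tangent_atlas A a b) = tangent_bundle A \<times> {a..b}"
  by (auto simp: points_def ext_tangent_atlas_def prod_atlas_def tangent_atlas_def
      id_atlas_def tangent_bundle_def image_iff split: prod.splits) (metis fst_conv)+

definition base_point :: "('q, 'e) ext_point \<Rightarrow> 'q" where
  "base_point m = fst (fst m)"

definition fibre_vector :: "('q, 'e) ext_point \<Rightarrow> ('q, 'e) tvec" where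
  "fibre_vector m = snd (fst m)"

definition time_coord :: "('q, 'e) ext_point \<Rightarrow> real" where
  "time_coord m = snd m"

definition lift_curve ::
  "('q, 'e::euclidean_space) chart set \<Rightarrow> real set \<Rightarrow> (real \<Rightarrow> 'q) \<Rightarrow> real \<Rightarrow> ('q, 'e) ext_point" where
  "lift_curve A J c s = ((c s, velocity A J c s), s)"

definition holonomic ::
  "('q, 'e::euclidean_space) chart set \<Rightarrow> real set \<Rightarrow> (real \<Rightarrow> ('q, 'e) ext_point) \<Rightarrow> bool" where
  "holonomic A I C \<longleftrightarrow>
     (\<exists>\<tau> c. smooth_on I \<tau> \<and> (strict_mono_on I \<tau> \<or> strict_antimono_on I \<tau>) \<and>
        (\<forall>t\<in>I. vector_derivative \<tau> (at t within I) \<noteq> 0) \<and>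
        smooth_curve A (\<tau> ` I) c \<and>
        (\<forall>t\<in>I. C t = lift_curve A (\<tau> ` I) c (\<tau> t)))"

locale lie_group = group G for G :: "('q, 'x) monoid_scheme" (structure) +
  fixes A :: "('q, 'e::euclidean_space) chart set"
  assumes manifold: "smooth_manifold UNIV A"
    and points_carrier: "points A = carrier G"
    and smooth_mult: "smooth_map UNIV (prod_atlas A A) A (\<lambda>(x, y). x \<otimes> y)"
    and smooth_inv: "smooth_map UNIV A A (m_inv G)"

definition tangent_basis ::
  "('q, 'e::euclidean_space) chart set \<Rightarrow> 'q \<Rightarrow> ('n \<Rightarrow> ('q, 'e) tvec) \<Rightarrow> bool" where
  "tangent_basis A p \<epsilon> \<longleftrightarrow>
     inj \<epsilon> \<and> independent (range \<epsilon>) \<and> span (range \<epsilon>) = tangent_space A p"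

definition left_frame ::
  "('q, 'x) monoid_scheme \<Rightarrow> ('q, 'e::euclidean_space) chart set \<Rightarrow> ('n \<Rightarrow> ('q, 'e) tvec) \<Rightarrow>
    'n \<Rightarrow> 'q \<Rightarrow> ('q, 'e) tvec" where
  "left_frame G A \<epsilon> i q = tangent_map A A (\<lambda>x. q \<otimes>\<^bsub>G\<^esub> x) \<one>\<^bsub>G\<^esub> (\<epsilon> i)"

definition left_coframe ::
  "('q, 'x) monoid_scheme \<Rightarrow> ('q, 'e::euclidean_space) chart set \<Rightarrow> ('n \<Rightarrow> ('q, 'e) tvec) \<Rightarrow>
    'n \<Rightarrow> ('q, 'e) form1" where
  "left_coframe G A \<epsilon> i q X =
     representation (range (\<lambda>j. left_frame G A \<epsilon> j q)) X (left_frame G A \<epsilon> i q)"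

definition theta_form ::
  "('q, 'x) monoid_scheme \<Rightarrow> ('q, 'e::euclidean_space) chart set \<Rightarrow> real \<Rightarrow> real \<Rightarrow>
    ('n \<Rightarrow> ('q, 'e) tvec) \<Rightarrow> 'n \<Rightarrow> (('q, 'e) ext_point, ('e \<times> 'e) \<times> real) form1" where
  "theta_form G A a b \<epsilon> i m V =
     left_coframe G A \<epsilon> i (base_point m) (tangent_map (ext_tangent_atlas A a b) A base_point m V)"

definition xi_fun ::
  "('q, 'x) monoid_scheme \<Rightarrow> ('q, 'e::euclidean_space) chart set \<Rightarrow>
    ('n \<Rightarrow> ('q, 'e) tvec) \<Rightarrow> 'n \<Rightarrow> ('q, 'e) ext_point \<Rightarrow> real" where
  "xi_fun G A \<epsilon> i m = left_coframe G A \<epsilon> i (base_point m) (fibre_vector m)"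

definition ds_form ::
  "('q, 'e::euclidean_space) chart set \<Rightarrow> real \<Rightarrow> real \<Rightarrow>
    (('q, 'e) ext_point, ('e \<times> 'e) \<times> real) form1" where
  "ds_form A a b = differential (ext_tangent_atlas A a b) time_coord"

datatype 'n frame_index = Pos 'n | Vel 'n | Time

primrec ext_coframe ::
  "('q, 'x) monoid_scheme \<Rightarrow> ('q, 'e::euclidean_space) chart set \<Rightarrow> real \<Rightarrow> real \<Rightarrow>
    ('n \<Rightarrow> ('q, 'e) tvec) \<Rightarrow> 'n frame_index \<Rightarrow> (('q, 'e) ext_point, ('e \<times> 'e) \<times> real) form1" where
  "ext_coframe G A a b \<epsilon> (Pos i) = theta_form G A a b \<epsilon> i"
| "ext_coframe G A a b \<epsilon> (Vel i) = differential (ext_tangent_atlas A a b) (xi_fun G A \<epsilon> i)"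
| "ext_coframe G A a b \<epsilon> Time = ds_form A a b"

text \<open>In the usual notation, \<open>ext_frame G A a b \<epsilon> (Pos i)\<close>, \<open>ext_frame G A a b \<epsilon> (Vel i)\<close> and
  \<open>ext_frame G A a b \<epsilon> Time\<close> are \<open>E\<close> with index \<open>q\<^sup>i\<close>, \<open>\<xi>\<^sup>i\<close> and \<open>s\<close>.\<close>

definition ext_frame ::
  "('q, 'x) monoid_scheme \<Rightarrow> ('q, 'e::euclidean_space) chart set \<Rightarrow> real \<Rightarrow> real \<Rightarrow>
    ('n \<Rightarrow> ('q, 'e) tvec) \<Rightarrow> 'n frame_index \<Rightarrow> ('q, 'e) ext_point \<Rightarrow>
    (('q, 'e) ext_point, ('e \<times> 'e) \<times> real) tvec" where
  "ext_frame G A a b \<epsilon> k m =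
     (THE V. V \<in> tangent_space (ext_tangent_atlas A a b) m \<and>
        (\<forall>l. ext_coframe G A a b \<epsilon> l m V = (if l = k then 1 else 0)))"

abbreviation deriv_xi ::
  "('q, 'x) monoid_scheme \<Rightarrow> ('q, 'e::euclidean_space) chart set \<Rightarrow> real \<Rightarrow> real \<Rightarrow>
    ('n \<Rightarrow> ('q, 'e) tvec) \<Rightarrow> 'n \<Rightarrow> (('q, 'e) ext_point \<Rightarrow> real) \<Rightarrow> ('q, 'e) ext_point \<Rightarrow> real" where
  "deriv_xi G A a b \<epsilon> i \<equiv> deriv_along (ext_tangent_atlas A a b) (ext_frame G A a b \<epsilon> (Vel i))"

definition lagrange_form ::
  "('q, 'x) monoid_scheme \<Rightarrow> ('q, 'e::euclidean_space) chart set \<Rightarrow> real \<Rightarrow> real \<Rightarrow>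
    ('n::finite \<Rightarrow> ('q, 'e) tvec) \<Rightarrow> (('q, 'e) ext_point \<Rightarrow> real) \<Rightarrow>
    ('n \<Rightarrow> ('q, 'e) ext_point \<Rightarrow> real) \<Rightarrow> (('q, 'e) ext_point, ('e \<times> 'e) \<times> real) form1" where
  "lagrange_form G A a b \<epsilon> L p m V =
     L m * ds_form A a b m V +
     (\<Sum>i\<in>UNIV. p i m * (theta_form G A a b \<epsilon> i m V - xi_fun G A \<epsilon> i m * ds_form A a b m V))"

end

theory Submission
  imports Defs
begin

text \<open>
  In the coframe \<open>(\<theta>\<^sup>i, d\<xi>\<^sup>i, ds)\<close> put \<open>\<eta>\<^sup>i = \<theta>\<^sup>i - \<xi>\<^sup>i ds\<close>.  The 2-form \<open>d\<theta>\<^sup>i\<close> only sees the horizontal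
  parts of its arguments, so that
  \<open>d\<Theta>(V, E\<^sub>\<xi>\<^sub>j) = (p\<^sub>j - E\<^sub>\<xi>\<^sub>j L) ds(V) - (\<Sum>i. (E\<^sub>\<xi>\<^sub>j p\<^sub>i) \<eta>\<^sup>i(V))\<close>.
  If \<open>p\<^sub>i = E\<^sub>\<xi>\<^sub>i L\<close>, then a null vector \<open>V\<close> satisfies \<open>P \<eta>(V) = 0\<close>, hence \<open>\<eta>(V) = 0\<close>, and the same
  identity with the arguments exchanged shows that \<open>ds(V)\<close> determines \<open>V\<close> and is arbitrary.
  Conversely, the null direction field is smooth, so that a vortex line passes through every
  point with \<open>a < s < b\<close>.  It is holonomic, hence \<open>\<eta>(V) = 0\<close> and \<open>ds(V) \<noteq> 0\<close>, and the identity yields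
  \<open>p\<^sub>j = E\<^sub>\<xi>\<^sub>j L\<close>.  The points with \<open>s = a\<close> or \<open>s = b\<close> follow by continuity.
\<close>

section \<open>Smooth functions on open sets\<close>

text \<open>The group supplies one thing: a smooth frame that is independent at every point. It is
  smooth because left translations are partial maps of the jointly smooth multiplication, and
  independent because they are inverted by left translations. Structure constants are never
  computed: apart from pairings with vertical vectors, the values of d\<Theta> occur only as the
  right-hand side of a linear system that has to be solvable.

  Two obstacles shape the rest. \<open>ext_deriv\<close> evaluates in an unspecified chart, so its
  value must first be carried to any prescribed chart; every term of d\<Theta> is intrinsic at once
  except the coordinate expression of d\<beta>, whose invariance rests on Schwarz's theorem. And the
  manifold has a boundary, the points with s = a or s = b. Derivatives are one-sided there,
  smoothness means local extension, and a null vector may fail to be the velocity of a curve that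
  stays in the manifold. Hence curves are constructed only through points with a < s < b, in the
  open part of a chart image, where ordinary calculus applies.\<close>

lemma frechet_derivative_cong_open:
  assumes "open U" "x \<in> U" "\<And>y. y \<in> U \<Longrightarrow> f y = g y"
  shows "frechet_derivative f (at x) = frechet_derivative g (at x)"
proof -
  have "(f has_derivative f') (at x) \<longleftrightarrow> (g has_derivative f') (at x)" for f'
    using has_derivative_transform_within_open[OF _ assms(1,2)] assms(3) by metis
  then show ?thesis
    unfolding frechet_derivative_def by simp
qed

lemma Ck_on_subset: "Ck_on k f U \<Longrightarrow> V \<subseteq> U \<Longrightarrow> Ck_on k f V"
  by (induction k arbitrary: f) (auto intro: continuous_on_subset)

lemma Ck_on_Suc_imp: "Ck_on (Suc k) f U \<Longrightarrow> Ck_on k f U"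
proof (induction k arbitrary: f)
  case 0
  then show ?case
    by (auto intro!: continuous_at_imp_continuous_on differentiable_imp_continuous_within)
qed auto

lemma Ck_on_cong:
  "open U \<Longrightarrow> (\<And>x. x \<in> U \<Longrightarrow> f x = g x) \<Longrightarrow> Ck_on k f U \<Longrightarrow> Ck_on k g U"
proof (induction k arbitrary: f g)
  case 0
  then show ?case by (simp cong: continuous_on_cong)
next
  case (Suc k)
  have "g differentiable (at x)" if x: "x \<in> U" for x
  proof -
    obtain D where "(f has_derivative D) (at x)"
      using Suc.prems(3) x by (auto simp: differentiable_def)
    then have "(g has_derivative D) (at x)"
      using Suc.prems(2) by (rule has_derivative_transform_within_open[OF _ Suc.prems(1) x])
    then show ?thesis by (auto simp: differentiable_def)
  qed
  moreover have "Ck_on k (\<lambda>x. frechet_derivative g (at x) v) U" for v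
  proof (rule Suc.IH[OF Suc.prems(1)])
    show "Ck_on k (\<lambda>x. frechet_derivative f (at x) v) U"
      using Suc.prems(3) by simp
    show "frechet_derivative f (at x) v = frechet_derivative g (at x) v" if "x \<in> U" for x
      using frechet_derivative_cong_open[OF Suc.prems(1) that Suc.prems(2)] by simp
  qed
  ultimately show ?case by simp
qed

lemma Ck_on_SucI:
  assumes "open U" "\<And>x. x \<in> U \<Longrightarrow> (f has_derivative f' x) (at x)"
    and "\<And>v. Ck_on k (\<lambda>x. f' x v) U"
  shows "Ck_on (Suc k) f U"
proof -
  have "f' x = frechet_derivative f (at x)" if "x \<in> U" for x
    using assms(2)[OF that] by (rule frechet_derivative_at)
  then have "Ck_on k (\<lambda>x. frechet_derivative f (at x) v) U" for v
    using Ck_on_cong[OF assms(1) _ assms(3)] by simp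
  moreover have "f differentiable (at x)" if "x \<in> U" for x
    using assms(2)[OF that] by (auto simp: differentiable_def)
  ultimately show ?thesis by simp
qed

lemma Ck_on_SucD:
  "Ck_on (Suc k) f U \<Longrightarrow> x \<in> U \<Longrightarrow> (f has_derivative frechet_derivative f (at x)) (at x)"
  by (simp add: frechet_derivative_works)

lemma Ck_on_local:
  assumes "\<And>x. x \<in> U \<Longrightarrow> \<exists>V. open V \<and> x \<in> V \<and> Ck_on k f V"
  shows "Ck_on k f U"
  using assms
proof (induction k arbitrary: f)
  case 0
  then show ?case
    by (metis Ck_on.simps(1) continuous_at_imp_continuous_on continuous_on_eq_continuous_at)
next
  case (Suc k)
  have "f differentiable (at x)" if "x \<in> U" for x
    using Suc.prems[OF that] by auto
  moreover have "Ck_on k (\<lambda>x. frechet_derivative f (at x) v) U" for v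
    using Suc.prems by (intro Suc.IH) force
  ultimately show ?case by simp
qed

lemma Ck_on_const: "Ck_on k (\<lambda>x. c) U"
  by (induction k arbitrary: c) (auto simp: frechet_derivative_const)

lemma Ck_on_bounded_linear_compose:
  assumes "open U" "bounded_linear h" "Ck_on k f U"
  shows "Ck_on k (\<lambda>x. h (f x)) U"
  using assms(3)
proof (induction k arbitrary: f)
  case 0
  then show ?case
    using bounded_linear.continuous_on[OF assms(2)] by simp
next
  case (Suc k)
  show ?case
  proof (rule Ck_on_SucI[OF assms(1)])
    show "((\<lambda>x. h (f x)) has_derivative (\<lambda>v. h (frechet_derivative f (at x) v))) (at x)"
      if "x \<in> U" for x
      by (rule bounded_linear.has_derivative[OF assms(2) Ck_on_SucD[OF Suc.prems that]])
    show "Ck_on k (\<lambda>x. h (frechet_derivative f (at x) v)) U" for v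
      using Suc.prems by (intro Suc.IH) simp
  qed
qed

lemma Ck_on_id: "open U \<Longrightarrow> Ck_on k (\<lambda>x. x) U"
proof (cases k)
  case (Suc j)
  assume "open U"
  then show ?thesis
    unfolding Suc by (rule Ck_on_SucI[where f' = "\<lambda>x v. v"]) (auto intro: Ck_on_const)
qed simp

lemma Ck_on_add:
  assumes "open U" "Ck_on k f U" "Ck_on k g U"
  shows "Ck_on k (\<lambda>x. f x + g x) U"
  using assms(2,3)
proof (induction k arbitrary: f g)
  case 0
  then show ?case by (auto intro: continuous_on_add)
next
  case (Suc k)
  show ?case
  proof (rule Ck_on_SucI[OF assms(1)])
    show "((\<lambda>x. f x + g x) has_derivative
        (\<lambda>v. frechet_derivative f (at x) v + frechet_derivative g (at x) v)) (at x)"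
      if "x \<in> U" for x
      by (rule has_derivative_add[OF Ck_on_SucD[OF Suc.prems(1) that] Ck_on_SucD[OF Suc.prems(2) that]])
    show "Ck_on k (\<lambda>x. frechet_derivative f (at x) v + frechet_derivative g (at x) v) U" for v
      using Suc.prems by (intro Suc.IH) simp_all
  qed
qed

text \<open>The product rule pairs each function with the derivative of the other. The induction
  therefore runs over all pairs, and \<open>Ck_on_Suc_imp\<close> lowers the order of the factor
  that is not differentiated.\<close>

lemma Ck_on_bilinear:
  assumes "open U" "bounded_bilinear h" "Ck_on k f U" "Ck_on k g U"
  shows "Ck_on k (\<lambda>x. h (f x) (g x)) U"
  using assms(3,4)
proof (induction k arbitrary: f g)
  case 0
  then show ?case
    using bounded_bilinear.continuous_on[OF assms(2)] by simp
next
  case (Suc k)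
  show ?case
  proof (rule Ck_on_SucI[OF assms(1)])
    show "((\<lambda>x. h (f x) (g x)) has_derivative
        (\<lambda>v. h (f x) (frechet_derivative g (at x) v) + h (frechet_derivative f (at x) v) (g x))) (at x)"
      if "x \<in> U" for x
      by (rule bounded_bilinear.FDERIV[OF assms(2) Ck_on_SucD[OF Suc.prems(1) that]
            Ck_on_SucD[OF Suc.prems(2) that]])
    show "Ck_on k (\<lambda>x. h (f x) (frechet_derivative g (at x) v) + h (frechet_derivative f (at x) v) (g x)) U"
      for v
      using Suc.prems Suc.prems[THEN Ck_on_Suc_imp]
      by (intro Ck_on_add assms(1) Suc.IH) simp_all
  qed
qed

lemma Ck_on_sum:
  assumes "open U" "\<And>i. i \<in> I \<Longrightarrow> Ck_on k (f i) U"
  shows "Ck_on k (\<lambda>x. \<Sum>i\<in>I. f i x) U"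
  using assms(2)
  by (induction I rule: infinite_finite_induct)
    (auto intro!: Ck_on_const Ck_on_add assms(1))

lemma Ck_on_prod:
  fixes f :: "'i \<Rightarrow> 'e::euclidean_space \<Rightarrow> real"
  assumes "open U" "\<And>i. i \<in> I \<Longrightarrow> Ck_on k (f i) U"
  shows "Ck_on k (\<lambda>x. \<Prod>i\<in>I. f i x) U"
  using assms(2)
  by (induction I rule: infinite_finite_induct)
    (auto intro!: Ck_on_const Ck_on_bilinear[OF assms(1) bounded_bilinear_mult])

lemma linear_sum_Basis:
  assumes "linear (f :: 'a::euclidean_space \<Rightarrow> 'b::real_vector)"
  shows "f v = (\<Sum>b\<in>Basis. (v \<bullet> b) *\<^sub>R f b)"
proof -
  have "f v = f (\<Sum>b\<in>Basis. (v \<bullet> b) *\<^sub>R b)"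
    by (simp add: euclidean_representation)
  then show ?thesis
    using assms by (simp add: linear_sum linear_scale)
qed

text \<open>\<open>Ck_on\<close> controls derivatives in constant directions only. Linearity reduces
  a moving direction to the finitely many basis directions with smooth coefficients.\<close>

lemma Ck_on_frechet_derivative_dir:
  assumes "open U" "Ck_on (Suc k) f U" "Ck_on k v U"
  shows "Ck_on k (\<lambda>x. frechet_derivative f (at x) (v x)) U"
proof (rule Ck_on_cong[OF assms(1)])
  show "(\<Sum>b\<in>Basis. (v x \<bullet> b) *\<^sub>R frechet_derivative f (at x) b) = frechet_derivative f (at x) (v x)"
    if "x \<in> U" for x
    by (rule linear_sum_Basis[OF has_derivative_linear[OF Ck_on_SucD[OF assms(2) that]], symmetric])
  show "Ck_on k (\<lambda>x. \<Sum>b\<in>Basis. (v x \<bullet> b) *\<^sub>R frechet_derivative f (at x) b) U"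
    using assms by (intro Ck_on_sum Ck_on_bilinear[OF _ bounded_bilinear_scaleR]
        Ck_on_bounded_linear_compose[OF _ bounded_linear_inner_left]) simp_all
qed

text \<open>In the chain rule the direction in which \<open>f\<close> is differentiated moves with
  the point. Expanding it in the basis leaves derivatives of \<open>f\<close> in fixed directions,
  composed with \<open>g\<close>, and these are covered by the induction hypothesis.\<close>

lemma Ck_on_compose:
  assumes "open U" "open V" "g ` U \<subseteq> V" "Ck_on k f V" "Ck_on k g U"
  shows "Ck_on k (\<lambda>x. f (g x)) U"
  using assms(4,5)
proof (induction k arbitrary: f)
  case 0
  then show ?case
    using continuous_on_compose2[of V f U g] assms(3) by simp
next
  case (Suc k)
  have gV: "g x \<in> V" if "x \<in> U" for x
    using assms(3) that by auto
  show ?case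
  proof (rule Ck_on_SucI[OF assms(1)])
    show "((\<lambda>x. f (g x)) has_derivative
        (\<lambda>v. frechet_derivative f (at (g x)) (frechet_derivative g (at x) v))) (at x)"
      if "x \<in> U" for x
      using has_derivative_compose[OF Ck_on_SucD[OF Suc.prems(2) that]
        Ck_on_SucD[OF Suc.prems(1) gV[OF that]]] .
    show "Ck_on k (\<lambda>x. frechet_derivative f (at (g x)) (frechet_derivative g (at x) v)) U" for v
    proof (rule Ck_on_cong[OF assms(1)])
      show "(\<Sum>b\<in>Basis. (frechet_derivative g (at x) v \<bullet> b) *\<^sub>R frechet_derivative f (at (g x)) b)
          = frechet_derivative f (at (g x)) (frechet_derivative g (at x) v)" if "x \<in> U" for x
        by (rule linear_sum_Basis[OF has_derivative_linear[OF Ck_on_SucD[OF Suc.prems(1) gV[OF that]]], symmetric])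
      show "Ck_on k (\<lambda>x. \<Sum>b\<in>Basis. (frechet_derivative g (at x) v \<bullet> b) *\<^sub>R
          frechet_derivative f (at (g x)) b) U"
        using Suc.prems Ck_on_Suc_imp[OF Suc.prems(2)]
        by (intro Ck_on_sum Ck_on_bilinear[OF _ bounded_bilinear_scaleR] assms(1) Suc.IH
            Ck_on_bounded_linear_compose[OF _ bounded_linear_inner_left]) simp_all
    qed
  qed
qed

text \<open>The derivative of 1/f is a product of factors 1/f and a derivative of f, so each order
  of differentiability of 1/f yields the next.\<close>

lemma Ck_on_inverse:
  fixes f :: "'e::euclidean_space \<Rightarrow> real"
  assumes "open U" "Ck_on k f U" "\<And>x. x \<in> U \<Longrightarrow> f x \<noteq> 0"
  shows "Ck_on k (\<lambda>x. inverse (f x)) U"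
  using assms(2)
proof (induction k)
  case 0
  then show ?case
    using assms(3) by (auto intro: continuous_on_inverse)
next
  case (Suc k)
  show ?case
  proof (rule Ck_on_SucI[OF assms(1)])
    show "((\<lambda>x. inverse (f x)) has_derivative
        (\<lambda>v. - (inverse (f x) * frechet_derivative f (at x) v * inverse (f x)))) (at x)"
      if "x \<in> U" for x
      by (rule Deriv.has_derivative_inverse[OF assms(3)[OF that] Ck_on_SucD[OF Suc.prems that]])
    show "Ck_on k (\<lambda>x. - (inverse (f x) * frechet_derivative f (at x) v * inverse (f x))) U" for v
      using Suc.prems Suc.IH[OF Ck_on_Suc_imp[OF Suc.prems]]
      by (intro Ck_on_bounded_linear_compose[OF _ bounded_linear_minus[OF bounded_linear_ident]]
          Ck_on_bilinear[OF _ bounded_bilinear_mult] assms(1)) simp_all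
  qed
qed

section \<open>Functions of class C-infinity: differentiation loses no order\<close>

definition Cinf_on :: "('e::euclidean_space \<Rightarrow> 'f::real_normed_vector) \<Rightarrow> 'e set \<Rightarrow> bool" where
  "Cinf_on f U \<longleftrightarrow> (\<forall>k. Ck_on k f U)"

lemma Cinf_onD: "Cinf_on f U \<Longrightarrow> Ck_on k f U"
  by (simp add: Cinf_on_def)

lemma Cinf_on_subset: "Cinf_on f U \<Longrightarrow> V \<subseteq> U \<Longrightarrow> Cinf_on f V"
  unfolding Cinf_on_def using Ck_on_subset by blast

lemma Cinf_on_cong: "Cinf_on f U \<Longrightarrow> open U \<Longrightarrow> (\<And>x. x \<in> U \<Longrightarrow> f x = g x) \<Longrightarrow> Cinf_on g U"
  unfolding Cinf_on_def using Ck_on_cong by blast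

lemma Cinf_on_has_derivative:
  "Cinf_on f U \<Longrightarrow> x \<in> U \<Longrightarrow> (f has_derivative frechet_derivative f (at x)) (at x)"
  unfolding Cinf_on_def using Ck_on_SucD by blast

lemma Cinf_on_continuous: "Cinf_on f U \<Longrightarrow> continuous_on U f"
  unfolding Cinf_on_def using Ck_on.simps(1) by blast

lemma Cinf_on_const: "Cinf_on (\<lambda>x. c) U"
  by (simp add: Cinf_on_def Ck_on_const)

lemma Cinf_on_id: "open U \<Longrightarrow> Cinf_on (\<lambda>x. x) U"
  by (simp add: Cinf_on_def Ck_on_id)

lemma Cinf_on_bounded_linear:
  "bounded_linear h \<Longrightarrow> open U \<Longrightarrow> Cinf_on f U \<Longrightarrow> Cinf_on (\<lambda>x. h (f x)) U"
  by (auto simp: Cinf_on_def simp del: Ck_on.simps intro: Ck_on_bounded_linear_compose[of U h])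

lemma Cinf_on_add:
  "open U \<Longrightarrow> Cinf_on f U \<Longrightarrow> Cinf_on g U \<Longrightarrow> Cinf_on (\<lambda>x. f x + g x) U"
  by (simp add: Cinf_on_def Ck_on_add)

lemma Cinf_on_sum:
  "open U \<Longrightarrow> (\<And>i. i \<in> I \<Longrightarrow> Cinf_on (f i) U) \<Longrightarrow> Cinf_on (\<lambda>x. \<Sum>i\<in>I. f i x) U"
  by (simp add: Cinf_on_def Ck_on_sum)

lemma Cinf_on_prod:
  fixes f :: "'i \<Rightarrow> 'e::euclidean_space \<Rightarrow> real"
  shows "open U \<Longrightarrow> (\<And>i. i \<in> I \<Longrightarrow> Cinf_on (f i) U) \<Longrightarrow> Cinf_on (\<lambda>x. \<Prod>i\<in>I. f i x) U"
  by (simp add: Cinf_on_def Ck_on_prod)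

lemma Cinf_on_scaleR:
  "open U \<Longrightarrow> Cinf_on f U \<Longrightarrow> Cinf_on g U \<Longrightarrow> Cinf_on (\<lambda>x. f x *\<^sub>R g x) U"
  by (simp add: Cinf_on_def Ck_on_bilinear[OF _ bounded_bilinear_scaleR])

lemma Cinf_on_mult:
  fixes f g :: "'e::euclidean_space \<Rightarrow> real"
  shows "open U \<Longrightarrow> Cinf_on f U \<Longrightarrow> Cinf_on g U \<Longrightarrow> Cinf_on (\<lambda>x. f x * g x) U"
  by (simp add: Cinf_on_def Ck_on_bilinear[OF _ bounded_bilinear_mult])

lemma Cinf_on_minus:
  "open U \<Longrightarrow> Cinf_on f U \<Longrightarrow> Cinf_on (\<lambda>x. - f x) U"
  by (rule Cinf_on_bounded_linear[OF bounded_linear_minus[OF bounded_linear_ident]])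

lemma Cinf_on_diff:
  "open U \<Longrightarrow> Cinf_on f U \<Longrightarrow> Cinf_on g U \<Longrightarrow> Cinf_on (\<lambda>x. f x - g x) U"
  using Cinf_on_add[OF _ _ Cinf_on_minus, of U f g] by simp

lemma Cinf_on_inverse:
  fixes f :: "'e::euclidean_space \<Rightarrow> real"
  shows "open U \<Longrightarrow> Cinf_on f U \<Longrightarrow> (\<And>x. x \<in> U \<Longrightarrow> f x \<noteq> 0) \<Longrightarrow> Cinf_on (\<lambda>x. inverse (f x)) U"
  by (simp add: Cinf_on_def Ck_on_inverse)

lemma Cinf_on_divide:
  fixes f g :: "'e::euclidean_space \<Rightarrow> real"
  shows "open U \<Longrightarrow> Cinf_on f U \<Longrightarrow> Cinf_on g U \<Longrightarrow> (\<And>x. x \<in> U \<Longrightarrow> g x \<noteq> 0) \<Longrightarrow>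
    Cinf_on (\<lambda>x. f x / g x) U"
  by (simp add: divide_inverse Cinf_on_mult Cinf_on_inverse)

lemmas Cinf_on_fst = Cinf_on_bounded_linear[OF bounded_linear_fst]
lemmas Cinf_on_snd = Cinf_on_bounded_linear[OF bounded_linear_snd]
lemmas Cinf_on_inner = Cinf_on_bounded_linear[OF bounded_linear_inner_left]
lemmas Cinf_on_nth = Cinf_on_bounded_linear[OF bounded_linear_vec_nth]

lemma Cinf_on_Pair:
  assumes "open U" "Cinf_on f U" "Cinf_on g U"
  shows "Cinf_on (\<lambda>x. (f x, g x)) U"
proof -
  have "Cinf_on (\<lambda>x. (f x, 0) + (0, g x)) U"
    using assms by (intro Cinf_on_add Cinf_on_bounded_linear[of "\<lambda>y. (y, 0)"]
        Cinf_on_bounded_linear[of "\<lambda>y. (0, y)"] bounded_linear_Pair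
        bounded_linear_zero bounded_linear_ident)
  then show ?thesis by simp
qed

lemma Cinf_on_vec_lambda:
  fixes f :: "'i::finite \<Rightarrow> 'e::euclidean_space \<Rightarrow> real"
  assumes "open U" "\<And>i. Cinf_on (f i) U"
  shows "Cinf_on (\<lambda>x. \<chi> i. f i x) U"
proof -
  have "Cinf_on (\<lambda>x. \<Sum>i\<in>UNIV. f i x *\<^sub>R (axis i 1 :: real ^ 'i)) U"
    using assms by (intro Cinf_on_sum Cinf_on_scaleR Cinf_on_const)
  moreover have "(\<Sum>i\<in>UNIV. f i x *\<^sub>R (axis i 1 :: real ^ 'i)) = (\<chi> i. f i x)" for x
    using basis_expansion[of "\<chi> i. f i x"] by (simp only: vec_lambda_beta scalar_mult_eq_scaleR)
  ultimately show ?thesis by (simp only:)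
qed

lemma Cinf_on_det:
  fixes f :: "'i::finite \<Rightarrow> 'i \<Rightarrow> 'e::euclidean_space \<Rightarrow> real"
  assumes "open U" "\<And>i j. Cinf_on (f i j) U"
  shows "Cinf_on (\<lambda>x. det (\<chi> i j. f i j x)) U"
  unfolding det_def using assms
  by (simp only: vec_lambda_beta) (intro Cinf_on_sum Cinf_on_mult Cinf_on_prod Cinf_on_const)

lemma Cinf_on_compose:
  "open U \<Longrightarrow> open V \<Longrightarrow> g ` U \<subseteq> V \<Longrightarrow> Cinf_on f V \<Longrightarrow> Cinf_on g U \<Longrightarrow> Cinf_on (\<lambda>x. f (g x)) U"
  using Ck_on_compose[of U V g _ f] by (simp add: Cinf_on_def)

lemma Cinf_on_frechet_derivative:
  "open U \<Longrightarrow> Cinf_on f U \<Longrightarrow> Cinf_on v U \<Longrightarrow>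
    Cinf_on (\<lambda>x. frechet_derivative f (at x) (v x)) U"
  by (simp add: Cinf_on_def Ck_on_frechet_derivative_dir del: Ck_on.simps)

lemma Cinf_on_local:
  "(\<And>x. x \<in> U \<Longrightarrow> \<exists>V. open V \<and> x \<in> V \<and> Cinf_on f V) \<Longrightarrow> Cinf_on f U"
  by (simp add: Cinf_on_def) (metis Ck_on_local)

text \<open>By Cramer's rule.\<close>

lemma Cinf_on_linear_solution:
  fixes M :: "'i::finite \<Rightarrow> 'i \<Rightarrow> 'e::euclidean_space \<Rightarrow> real" and u :: "'e \<Rightarrow> real ^ 'i"
  assumes "open U" "\<And>i j. Cinf_on (M i j) U" "\<And>i. Cinf_on (r i) U"
    and det: "\<And>x. x \<in> U \<Longrightarrow> det (\<chi> i j. M i j x) \<noteq> 0"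
    and sol: "\<And>x. x \<in> U \<Longrightarrow> (\<chi> i j. M i j x) *v u x = (\<chi> i. r i x)"
  shows "Cinf_on u U"
proof (rule Cinf_on_cong[OF _ assms(1)])
  let ?u = "\<lambda>x. \<chi> k. det (\<chi> i j. if j = k then r i x else M i j x) / det (\<chi> i j. M i j x)"
  have "Cinf_on (\<lambda>x. if j = k then r i x else M i j x) U" for i j k
    by (cases "j = k") (simp_all add: assms)
  then have D: "Cinf_on (\<lambda>x. det (\<chi> i j. if j = k then r i x else M i j x)) U" for k
    by (intro Cinf_on_det assms)
  show "Cinf_on ?u U"
    by (intro Cinf_on_vec_lambda Cinf_on_divide D Cinf_on_det[OF assms(1,2)] assms)
  show "?u x = u x" if "x \<in> U" for x
    using sol[OF that] cramer[OF det[OF that], of "u x" "\<chi> i. r i x"] by (simp only: vec_lambda_beta)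
qed

section \<open>Symmetry of second derivatives\<close>

lemma DERIV_along_line:
  fixes f :: "'e::real_normed_vector \<Rightarrow> real"
  assumes "(f has_derivative f') (at (a + s *\<^sub>R v))"
  shows "((\<lambda>s. f (a + s *\<^sub>R v)) has_real_derivative f' v) (at s)"
proof -
  have "((\<lambda>s. a + s *\<^sub>R v) has_derivative (\<lambda>h. h *\<^sub>R v)) (at s)"
    by (auto intro!: derivative_eq_intros)
  from has_derivative_compose[OF this assms]
  have "((\<lambda>s. f (a + s *\<^sub>R v)) has_derivative (\<lambda>h. f' (h *\<^sub>R v))) (at s)" .
  moreover have "f' (h *\<^sub>R v) = f' v * h" for h
    using linear_scale[OF has_derivative_linear[OF assms], of h v] by (simp only: real_scaleR_def mult.commute)
  ultimately show ?thesis
    unfolding has_field_derivative_def by (simp only: )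
qed

text \<open>The mean value theorem is applied twice, along \<open>v\<close> and then along
  \<open>w\<close>. The left-hand side is symmetric in \<open>v\<close> and \<open>w\<close> while
  the right-hand side is not, which is what makes it useful for Schwarz's theorem.\<close>

lemma second_difference:
  fixes f :: "'e::euclidean_space \<Rightarrow> real"
  assumes f: "Cinf_on f U" and "open U" "h > 0"
    and U: "\<And>s t. 0 \<le> s \<Longrightarrow> s \<le> h \<Longrightarrow> 0 \<le> t \<Longrightarrow> t \<le> h \<Longrightarrow> x + s *\<^sub>R v + t *\<^sub>R w \<in> U"
  obtains s t where "0 < s" "s < h" "0 < t" "t < h"
    "f (x + h *\<^sub>R v + h *\<^sub>R w) - f (x + h *\<^sub>R v) - f (x + h *\<^sub>R w) + f x =
      h * h * frechet_derivative (\<lambda>y. frechet_derivative f (at y) v) (at (x + s *\<^sub>R v + t *\<^sub>R w)) w"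
proof -
  let ?Dv = "\<lambda>y. frechet_derivative f (at y) v"
  have Dv: "Cinf_on ?Dv U"
    by (intro Cinf_on_frechet_derivative f \<open>open U\<close> Cinf_on_const)
  \<comment> \<open>The increment in direction \<open>w\<close>, as a function of the position along
    \<open>v\<close>.\<close>
  let ?g = "\<lambda>s. f (x + h *\<^sub>R w + s *\<^sub>R v) - f (x + s *\<^sub>R v)"
  have "(?g has_real_derivative ?Dv (x + h *\<^sub>R w + s *\<^sub>R v) - ?Dv (x + s *\<^sub>R v)) (at s)"
    if "0 \<le> s" "s \<le> h" for s
    using U[OF that, of h] U[OF that, of 0] \<open>h > 0\<close>
    by (intro DERIV_diff DERIV_along_line Cinf_on_has_derivative[OF f]) (simp_all add: algebra_simps)
  from MVT2[OF \<open>h > 0\<close> this]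
  obtain s where s: "0 < s" "s < h"
    and g: "?g h - ?g 0 = h * (?Dv (x + h *\<^sub>R w + s *\<^sub>R v) - ?Dv (x + s *\<^sub>R v))"
    by auto
  have "((\<lambda>t. ?Dv (x + s *\<^sub>R v + t *\<^sub>R w)) has_real_derivative
      frechet_derivative ?Dv (at (x + s *\<^sub>R v + t *\<^sub>R w)) w) (at t)" if "0 \<le> t" "t \<le> h" for t
    using U[OF _ _ that, of s] s
    by (intro DERIV_along_line Cinf_on_has_derivative[OF Dv]) simp
  from MVT2[OF \<open>h > 0\<close> this]
  obtain t where t: "0 < t" "t < h"
    and "?Dv (x + s *\<^sub>R v + h *\<^sub>R w) - ?Dv (x + s *\<^sub>R v) =
      h * frechet_derivative ?Dv (at (x + s *\<^sub>R v + t *\<^sub>R w)) w"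
    by auto
  with g have "?g h - ?g 0 = h * h * frechet_derivative ?Dv (at (x + s *\<^sub>R v + t *\<^sub>R w)) w"
    by (simp add: algebra_simps)
  then show ?thesis
    by (intro that[OF s t]) (simp add: algebra_simps)
qed

text \<open>Both mixed derivatives, taken at suitable points close to \<open>x\<close>, equal the
  same second difference divided by \<open>h * h\<close>; continuity transfers the equality to
  \<open>x\<close>.\<close>

lemma symmetric_second_derivative_real:
  fixes f :: "'e::euclidean_space \<Rightarrow> real"
  assumes f: "Cinf_on f U" and "open U" "x \<in> U"
  shows "frechet_derivative (\<lambda>y. frechet_derivative f (at y) v) (at x) w =
    frechet_derivative (\<lambda>y. frechet_derivative f (at y) w) (at x) v" (is "?A v w x = ?A w v x")
proof (rule ccontr)
  assume ne: "?A v w x \<noteq> ?A w v x"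
  \<comment> \<open>Half the supposed gap: two values within \<open>e\<close> of the two sides
    cannot coincide.\<close>
  define e where "e = \<bar>?A v w x - ?A w v x\<bar> / 2"
  have "e > 0" using ne by (simp add: e_def)
  have cont: "continuous_on U (?A v w)" for v w
    by (intro Cinf_on_continuous Cinf_on_frechet_derivative f \<open>open U\<close> Cinf_on_const)
  have "\<exists>d>0. \<forall>y. dist y x < d \<longrightarrow> y \<in> U \<and> \<bar>?A v w y - ?A v w x\<bar> < e" for v w
  proof -
    have "isCont (?A v w) x"
      using cont \<open>open U\<close> \<open>x \<in> U\<close> continuous_on_eq_continuous_at by blast
    then obtain d1 where "d1 > 0" "\<forall>y. dist y x < d1 \<longrightarrow> \<bar>?A v w y - ?A v w x\<bar> < e"
      using \<open>e > 0\<close> unfolding continuous_at_eps_delta by (auto simp: dist_real_def)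
    moreover obtain d2 where "d2 > 0" "\<forall>y. dist y x < d2 \<longrightarrow> y \<in> U"
      using \<open>open U\<close> \<open>x \<in> U\<close> unfolding open_dist by blast
    ultimately show ?thesis
      by (intro exI[of _ "min d1 d2"]) auto
  qed
  then obtain d1 d2 where "d1 > 0" "d2 > 0"
    and d1: "\<And>y. dist y x < d1 \<Longrightarrow> y \<in> U \<and> \<bar>?A v w y - ?A v w x\<bar> < e"
    and d2: "\<And>y. dist y x < d2 \<Longrightarrow> \<bar>?A w v y - ?A w v x\<bar> < e"
    by meson
  \<comment> \<open>Keeps the whole parallelogram of side \<open>h\<close> within the distance min
    d1 d2 of \<open>x\<close>; the summand 1 keeps the denominator positive when both directions
    vanish.\<close>
  define h where "h = min d1 d2 / (2 * (norm v + norm w + 1))"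
  have "norm v + norm w + 1 > 0"
    using norm_ge_zero[of v] norm_ge_zero[of w] by linarith
  then have "h > 0" and h: "h * (norm v + norm w) < min d1 d2"
    using \<open>d1 > 0\<close> \<open>d2 > 0\<close> by (auto simp: h_def field_simps min_def add_pos_nonneg add_strict_increasing)
  have near: "dist (x + s *\<^sub>R v + t *\<^sub>R w) x < min d1 d2" if "0 \<le> s" "s \<le> h" "0 \<le> t" "t \<le> h" for s t
  proof -
    have "dist (x + s *\<^sub>R v + t *\<^sub>R w) x \<le> s * norm v + t * norm w"
      using norm_triangle_ineq[of "s *\<^sub>R v" "t *\<^sub>R w"] that by (simp add: dist_norm add.assoc)
    also have "\<dots> \<le> h * norm v + h * norm w"
      using that by (intro add_mono mult_right_mono) auto
    finally show ?thesis using h by (simp add: distrib_left)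
  qed
  have nearU: "x + s *\<^sub>R v + t *\<^sub>R w \<in> U" if "0 \<le> s" "s \<le> h" "0 \<le> t" "t \<le> h" for s t
    using near[OF that] d1 by simp
  then have nearU': "x + s *\<^sub>R w + t *\<^sub>R v \<in> U" if "0 \<le> s" "s \<le> h" "0 \<le> t" "t \<le> h" for s t
    using nearU[of t s] that by (simp add: add.assoc add.commute[of "s *\<^sub>R w"])
  obtain s t where st: "0 < s" "s < h" "0 < t" "t < h" and
    A: "f (x + h *\<^sub>R v + h *\<^sub>R w) - f (x + h *\<^sub>R v) - f (x + h *\<^sub>R w) + f x =
      h * h * ?A v w (x + s *\<^sub>R v + t *\<^sub>R w)"
    by (rule second_difference[OF f \<open>open U\<close> \<open>h > 0\<close>, of x v w]) (rule nearU)
  obtain s' t' where st': "0 < s'" "s' < h" "0 < t'" "t' < h" and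
    B: "f (x + h *\<^sub>R w + h *\<^sub>R v) - f (x + h *\<^sub>R w) - f (x + h *\<^sub>R v) + f x =
      h * h * ?A w v (x + s' *\<^sub>R w + t' *\<^sub>R v)"
    by (rule second_difference[OF f \<open>open U\<close> \<open>h > 0\<close>, of x w v]) (rule nearU')
  have "h * h * ?A v w (x + s *\<^sub>R v + t *\<^sub>R w) = h * h * ?A w v (x + t' *\<^sub>R v + s' *\<^sub>R w)"
    using A B by (simp add: algebra_simps)
  then have "?A v w (x + s *\<^sub>R v + t *\<^sub>R w) = ?A w v (x + t' *\<^sub>R v + s' *\<^sub>R w)"
    using \<open>h > 0\<close> by simp
  moreover have "\<bar>?A v w (x + s *\<^sub>R v + t *\<^sub>R w) - ?A v w x\<bar> < e"
    using d1 near[of s t] st by simp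
  moreover have "\<bar>?A w v (x + t' *\<^sub>R v + s' *\<^sub>R w) - ?A w v x\<bar> < e"
    using d2 near[of t' s'] st' by simp
  ultimately show False by (simp add: e_def abs_if split: if_splits)
qed

lemma frechet_derivative_inner_left:
  "f differentiable (at x) \<Longrightarrow>
    frechet_derivative (\<lambda>y. f y \<bullet> b) (at x) v = frechet_derivative f (at x) v \<bullet> b"
  by (metis frechet_derivative_at frechet_derivative_works has_derivative_inner_left)

lemma symmetric_second_derivative:
  fixes f :: "'e::euclidean_space \<Rightarrow> 'f::euclidean_space"
  assumes f: "Cinf_on f U" and "open U" "x \<in> U"
  shows "frechet_derivative (\<lambda>y. frechet_derivative f (at y) v) (at x) w =
    frechet_derivative (\<lambda>y. frechet_derivative f (at y) w) (at x) v" (is "?A v w = ?A w v")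
proof (rule euclidean_eqI)
  fix b :: 'f
  let ?fb = "\<lambda>y. f y \<bullet> b"
  have "frechet_derivative (\<lambda>y. frechet_derivative ?fb (at y) v) (at x) w = ?A v w \<bullet> b" for v w
  proof -
    have "frechet_derivative (\<lambda>y. frechet_derivative ?fb (at y) v) (at x) =
        frechet_derivative (\<lambda>y. frechet_derivative f (at y) v \<bullet> b) (at x)"
      using Cinf_on_has_derivative[OF f]
      by (intro frechet_derivative_cong_open[OF \<open>open U\<close> \<open>x \<in> U\<close>] frechet_derivative_inner_left)
        (auto simp: differentiable_def)
    moreover have "(\<lambda>y. frechet_derivative f (at y) v) differentiable (at x)"
      using Cinf_on_has_derivative[OF Cinf_on_frechet_derivative[OF \<open>open U\<close> f Cinf_on_const] \<open>x \<in> U\<close>]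
      by (auto simp: differentiable_def)
    ultimately show ?thesis
      by (simp add: frechet_derivative_inner_left)
  qed
  then show "?A v w \<bullet> b = ?A w v \<bullet> b"
    using symmetric_second_derivative_real[OF Cinf_on_inner[OF \<open>open U\<close> f] \<open>open U\<close> \<open>x \<in> U\<close>] by metis
qed

section \<open>Inverse functions in one variable\<close>

text \<open>Bootstrapping from continuity: h' = 1 / (g' o h), so \<open>h\<close> is one order
  smoother than the right-hand side shows it to be.\<close>

lemma Cinf_on_inverse_function:
  fixes g h :: "real \<Rightarrow> real"
  assumes "open U" "open V" and g: "Cinf_on g U"
    and hU: "\<And>s. s \<in> V \<Longrightarrow> h s \<in> U" and gh: "\<And>s. s \<in> V \<Longrightarrow> g (h s) = s"
    and cont: "continuous_on V h"
    and nz: "\<And>s. s \<in> V \<Longrightarrow> frechet_derivative g (at (h s)) 1 \<noteq> 0"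
  shows "Cinf_on h V"
proof -
  let ?g' = "\<lambda>t. frechet_derivative g (at t) 1"
  have g': "Cinf_on ?g' U"
    by (intro Cinf_on_frechet_derivative assms Cinf_on_const)
  have g_der: "(g has_real_derivative ?g' t) (at t)" if "t \<in> U" for t
    using DERIV_along_line[of g _ 0 t 1] Cinf_on_has_derivative[OF g that] by simp
  have h_der: "(h has_derivative (\<lambda>v. inverse (?g' (h s)) * v)) (at s)" if s: "s \<in> V" for s
  proof -
    obtain e where "e > 0" and e: "ball s e \<subseteq> V"
      using \<open>open V\<close> s open_contains_ball by blast
    have "(h has_real_derivative inverse (?g' (h s))) (at s)"
    proof (rule DERIV_inverse_function[where f = g and a = "s - e" and b = "s + e"])
      show "(g has_real_derivative ?g' (h s)) (at (h s))"
        by (rule g_der[OF hU[OF s]])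
      show "g (h y) = y" if "s - e < y" "y < s + e" for y
        using that e by (intro gh) (auto simp: dist_real_def subset_eq)
      show "isCont h s"
        using cont \<open>open V\<close> s continuous_on_eq_continuous_at by blast
    qed (use \<open>e > 0\<close> nz[OF s] in auto)
    then show ?thesis
      by (simp only: has_field_derivative_def)
  qed
  have "Ck_on k h V" for k
  proof (induction k)
    case 0
    then show ?case using cont by simp
  next
    case (Suc k)
    show ?case
    proof (rule Ck_on_SucI[OF \<open>open V\<close> h_der])
      show "Ck_on k (\<lambda>s. inverse (?g' (h s)) * v) V" for v
        using nz hU
        by (intro Ck_on_bilinear[OF \<open>open V\<close> bounded_bilinear_mult] Ck_on_const
            Ck_on_inverse[OF \<open>open V\<close>] Ck_on_compose[OF \<open>open V\<close> \<open>open U\<close> _ Cinf_onD[OF g'] Suc.IH]) auto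
    qed
  qed
  then show ?thesis by (simp add: Cinf_on_def)
qed

text \<open>On a ball where the derivative has no zero, the mean value theorem gives injectivity.
  Injective continuous maps between subsets of the line are open, so the inverse is continuous and
  the bootstrapping applies.\<close>

lemma local_inverse_real:
  fixes g :: "real \<Rightarrow> real"
  assumes "open U" and g: "Cinf_on g U" and "t0 \<in> U" and nz: "frechet_derivative g (at t0) 1 \<noteq> 0"
  obtains W V h where "open W" "t0 \<in> W" "W \<subseteq> U" "open V" "g ` W = V" "Cinf_on h V"
    "\<And>t. t \<in> W \<Longrightarrow> h (g t) = t"
proof -
  let ?g' = "\<lambda>t. frechet_derivative g (at t) 1"
  have "continuous_on U ?g'"
    by (intro Cinf_on_continuous Cinf_on_frechet_derivative assms Cinf_on_const)
  then have "open (U \<inter> ?g' -` (- {0}))"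
    using \<open>open U\<close> by (intro continuous_open_preimage) auto
  then obtain e where "e > 0" and e: "ball t0 e \<subseteq> U \<inter> ?g' -` (- {0})"
    using \<open>t0 \<in> U\<close> nz by (force simp: open_contains_ball)
  let ?W = "ball t0 e"
  have W: "?g' t \<noteq> 0" if "t \<in> ?W" for t
    using e that by auto
  have WU: "?W \<subseteq> U" using e by auto
  have g_der: "(g has_real_derivative ?g' t) (at t)" if "t \<in> ?W" for t
    using DERIV_along_line[of g _ 0 t 1] Cinf_on_has_derivative[OF g] that WU by auto
  have gW: "continuous_on ?W g"
    using Cinf_on_continuous[OF g] WU continuous_on_subset by blast
  have inj: "inj_on g ?W"
  proof (rule linorder_inj_onI')
    fix s t assume st: "s \<in> ?W" "t \<in> ?W" "s < t"
    have W': "r \<in> ?W" if "s \<le> r" "r \<le> t" for r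
      using st that by (auto simp: dist_real_def)
    obtain z where "s < z" "z < t" "g t - g s = (t - s) * ?g' z"
      using MVT2[OF \<open>s < t\<close>, of g ?g'] g_der W' by blast
    then show "g s \<noteq> g t" using W[of z] W'[of z] \<open>s < t\<close> by auto
  qed
  have op: "open (g ` T)" if "open T" "T \<subseteq> ?W" for T
    using injective_into_1d_imp_open_map_UNIV[OF that(1) gW inj that(2)] .
  let ?h = "inv_into ?W g"
  have h: "?h (g t) = t" if "t \<in> ?W" for t
    using inj that by simp
  have "continuous_on (g ` ?W) ?h"
  proof (rule continuous_on_inverse_open_map[OF gW refl])
    show "?h (g t) = t" if "t \<in> ?W" for t using h[OF that] .
    show "openin (top_of_set (g ` ?W)) (g ` T)" if "openin (top_of_set ?W) T" for T
      using that op by (metis image_mono open_ball openin_open_eq open_subset)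
  qed
  then have "Cinf_on ?h (g ` ?W)"
    using h W WU
    by (intro Cinf_on_inverse_function[OF \<open>open U\<close> op g]) auto
  then show ?thesis
    using that[of ?W "g ` ?W" ?h] WU h op \<open>e > 0\<close> by auto
qed

section \<open>Integral curves\<close>

text \<open>The velocity is X o \<gamma>, so every order of smoothness of \<gamma> passes to its
  derivative.\<close>

lemma Cinf_on_integral_curve:
  fixes \<gamma> :: "real \<Rightarrow> 'e::euclidean_space"
  assumes "open I" "open U" "Cinf_on X U" "\<And>t. t \<in> I \<Longrightarrow> \<gamma> t \<in> U"
    and der: "\<And>t. t \<in> I \<Longrightarrow> (\<gamma> has_vector_derivative X (\<gamma> t)) (at t)"
  shows "Cinf_on \<gamma> I"
proof -
  have "Ck_on k \<gamma> I" for k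
  proof (induction k)
    case 0
    have "isCont \<gamma> t" if "t \<in> I" for t
      using der[OF that] has_vector_derivative_continuous by blast
    then show ?case by (simp add: continuous_at_imp_continuous_on)
  next
    case (Suc k)
    show ?case
    proof (rule Ck_on_SucI[OF \<open>open I\<close>])
      show "(\<gamma> has_derivative (\<lambda>v. v *\<^sub>R X (\<gamma> t))) (at t)" if "t \<in> I" for t
        using der[OF that] by (simp add: has_vector_derivative_def)
      show "Ck_on k (\<lambda>t. v *\<^sub>R X (\<gamma> t)) I" for v
        using assms(4)
        by (intro Ck_on_bilinear[OF \<open>open I\<close> bounded_bilinear_scaleR] Ck_on_const
            Ck_on_compose[OF \<open>open I\<close> \<open>open U\<close> _ Cinf_onD[OF assms(3)] Suc.IH]) auto
    qed
  qed
  then show ?thesis by (simp add: Cinf_on_def)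
qed

text \<open>The norms of the partial derivatives are bounded on the compact ball, their sum bounds
  the operator norm, and the ball is convex, so that the mean value inequality applies.\<close>

lemma Cinf_on_lipschitz_cball:
  fixes X :: "'e::euclidean_space \<Rightarrow> 'f::real_normed_vector"
  assumes "open U" "Cinf_on X U" "cball x0 r \<subseteq> U"
  obtains C where "C \<ge> 0"
    "\<And>x y. x \<in> cball x0 r \<Longrightarrow> y \<in> cball x0 r \<Longrightarrow> norm (X x - X y) \<le> C * norm (x - y)"
proof -
  let ?b = "\<lambda>x. \<Sum>b\<in>Basis. norm (frechet_derivative X (at x) b)"
  have "continuous_on U (\<lambda>x. frechet_derivative X (at x) b)" for b
    by (intro Cinf_on_continuous Cinf_on_frechet_derivative assms Cinf_on_const)
  then have "continuous_on (cball x0 r) ?b"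
    using assms(3) by (intro continuous_on_sum continuous_on_norm) (blast intro: continuous_on_subset)
  then have "bounded (?b ` cball x0 r)"
    by (intro compact_imp_bounded compact_continuous_image compact_cball)
  then obtain C where C: "C > 0" "\<And>x. x \<in> cball x0 r \<Longrightarrow> ?b x \<le> C"
    unfolding bounded_pos by (auto simp: sum_nonneg)
  have der: "(X has_derivative frechet_derivative X (at x)) (at x)" if "x \<in> cball x0 r" for x
    using Cinf_on_has_derivative[OF assms(2)] assms(3) that by blast
  have on: "onorm (frechet_derivative X (at x)) \<le> C" if x: "x \<in> cball x0 r" for x
  proof (rule onorm_le)
    fix v
    have "norm (frechet_derivative X (at x) v) \<le> (\<Sum>b\<in>Basis. norm ((v \<bullet> b) *\<^sub>R frechet_derivative X (at x) b))"
      by (subst linear_sum_Basis[OF has_derivative_linear[OF der[OF x]]]) (rule norm_sum)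
    also have "\<dots> \<le> (\<Sum>b\<in>Basis. norm v * norm (frechet_derivative X (at x) b))"
      by (intro sum_mono) (simp add: Basis_le_norm mult_right_mono)
    also have "\<dots> = norm v * ?b x" by (simp add: sum_distrib_left)
    also have "\<dots> \<le> norm v * C" using C(2)[OF x] by (intro mult_left_mono) auto
    finally show "norm (frechet_derivative X (at x) v) \<le> C * norm v" by (simp add: mult.commute)
  qed
  show ?thesis
  proof (rule that)
    show "C \<ge> 0" using C by simp
    show "norm (X x - X y) \<le> C * norm (x - y)" if "x \<in> cball x0 r" "y \<in> cball x0 r" for x y
      using der has_derivative_at_withinI that
      by (intro differentiable_bound[OF convex_cball _ on]) blast+
  qed
qed

text \<open>Picard iteration for the field composed with the projection onto a closed ball, which is
  globally Lipschitz and bounded.\<close>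

lemma local_integral_curve:
  fixes X :: "'e::euclidean_space \<Rightarrow> 'e"
  assumes "open U" "x0 \<in> U" "Cinf_on X U"
  obtains h \<gamma> where "h > 0" "\<gamma> 0 = x0"
    "\<And>t. \<bar>t\<bar> < h \<Longrightarrow> \<gamma> t \<in> U \<and> (\<gamma> has_vector_derivative X (\<gamma> t)) (at t)"
proof -
  obtain r where "r > 0" and r: "cball x0 r \<subseteq> U"
    using assms open_contains_cball by blast
  obtain C where "C \<ge> 0" and
    C: "\<And>x y. x \<in> cball x0 r \<Longrightarrow> y \<in> cball x0 r \<Longrightarrow> norm (X x - X y) \<le> C * norm (x - y)"
    using Cinf_on_lipschitz_cball[OF assms(1,3) r] by blast
  define P where "P = closest_point (cball x0 r)"
  have P: "P x \<in> cball x0 r" for x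
    unfolding P_def using \<open>r > 0\<close> by (intro closest_point_in_set) auto
  have P_id: "P x = x" if "x \<in> cball x0 r" for x
    unfolding P_def using that by (rule closest_point_self)
  define F where "F = (\<lambda>x. X (P x))"
  have F_lip: "norm (F x - F y) \<le> C * norm (x - y)" for x y
  proof -
    have "norm (P x - P y) \<le> norm (x - y)"
      unfolding P_def dist_norm[symmetric] using \<open>r > 0\<close> by (intro closest_point_lipschitz) auto
    then show ?thesis
      unfolding F_def using C[OF P P, of x y] \<open>C \<ge> 0\<close> by (meson mult_left_mono order_trans)
  qed
  have "C-lipschitz_on UNIV F"
    using F_lip \<open>C \<ge> 0\<close> by (intro lipschitz_onI) (auto simp: dist_norm)
  then have F_cont: "continuous_on UNIV F"
    by (rule lipschitz_on_continuous_on)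
  \<comment> \<open>A global bound for \<open>F\<close>, from the value at the centre and the
    Lipschitz constant on the ball.\<close>
  define M where "M = norm (X x0) + C * r"
  have M: "norm (F x) \<le> M" for x
  proof -
    have "norm (X (P x) - X x0) \<le> C * norm (P x - x0)"
      using P \<open>r > 0\<close> by (intro C) auto
    also have "\<dots> \<le> C * r"
      using P[of x] \<open>C \<ge> 0\<close> by (intro mult_left_mono) (auto simp: dist_norm norm_minus_commute)
    finally show ?thesis
      unfolding F_def M_def using norm_triangle_sub[of "X (P x)" "X x0"] by simp
  qed
  have "M \<ge> 0" using M norm_ge_zero order_trans by blast
  \<comment> \<open>The first entry makes the Picard map contract by 1/2, the second keeps the
    solution within distance \<open>r\<close> of \<open>x0\<close>. The factor 3 in the estimates is
    the sum of the lengths 2h and h of the two intervals over which \<open>J\<close> integrates; the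
    summands 1 cover C = 0 and M = 0.\<close>
  define h where "h = min (1 / (6 * (C + 1))) (r / (3 * (M + 1)))"
  have "h > 0" using \<open>C \<ge> 0\<close> \<open>M \<ge> 0\<close> \<open>r > 0\<close> by (simp add: h_def)
  have hC: "3 * h * C \<le> 1 / 2"
  proof -
    have "h \<le> 1 / (6 * (C + 1))" by (simp add: h_def)
    then have "h * (6 * (C + 1)) \<le> 1"
      using \<open>C \<ge> 0\<close> by (simp add: pos_le_divide_eq)
    then show ?thesis using \<open>h > 0\<close> by (simp add: algebra_simps)
  qed
  have hM: "3 * h * M \<le> r"
  proof -
    have "h \<le> r / (3 * (M + 1))" by (simp add: h_def)
    then have "h * (3 * (M + 1)) \<le> r"
      using \<open>M \<ge> 0\<close> by (simp add: pos_le_divide_eq)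
    then show ?thesis using \<open>h > 0\<close> by (simp add: algebra_simps)
  qed
  \<comment> \<open>Clamping the time to [-h, h] lets the iteration act on bounded continuous
    functions on the whole line, a complete metric space that is available as a type.\<close>
  define cl where "cl = (\<lambda>t. max (- h) (min h t))"
  have cl: "- h \<le> cl t" "cl t \<le> h" for t using \<open>h > 0\<close> by (auto simp: cl_def)
  have cl_id: "cl t = t" if "\<bar>t\<bar> \<le> h" for t using that by (auto simp: cl_def)
  \<comment> \<open>The oriented integral from 0 to t for either sign of t, written with integrals
    that start at -h.\<close>
  define J where "J = (\<lambda>f :: real \<Rightarrow> 'e. \<lambda>t. integral {- h..t} f - integral {- h..0} f)"
  have J_bound: "norm (J f t) \<le> 3 * h * B"
    if "continuous_on {- h..h} f" "\<And>s. norm (f s) \<le> B" "- h \<le> t" "t \<le> h" for f t B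
  proof -
    have f: "continuous_on {- h..s} f" if "s \<le> h" for s
      by (rule continuous_on_subset[OF \<open>continuous_on {- h..h} f\<close>]) (use that in auto)
    have "norm (integral {- h..t} f) \<le> B * (t - - h)"
      using that f by (intro integral_bound) auto
    moreover have "norm (integral {- h..0} f) \<le> B * (0 - - h)"
      using that f \<open>h > 0\<close> by (intro integral_bound) auto
    moreover have "B \<ge> 0" using that(2) norm_ge_zero order_trans by blast
    then have "B * (t - - h) \<le> B * (2 * h)" using that by (intro mult_left_mono) auto
    ultimately show ?thesis
      unfolding J_def using norm_triangle_ineq4[of "integral {- h..t} f" "integral {- h..0} f"]
      by (simp add: algebra_simps)
  qed
  have Fu: "continuous_on S (\<lambda>s. F (apply_bcontfun u s))" for S u
    by (rule continuous_on_compose2[OF F_cont]) auto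
  have J_cont: "continuous_on {- h..h} (J f)" if "continuous_on {- h..h} f" for f
    unfolding J_def
    by (intro continuous_on_diff indefinite_integral_continuous_1 integrable_continuous_real
        continuous_on_const that)
  have in_bc: "(\<lambda>t. x0 + J (\<lambda>s. F (apply_bcontfun u s)) (cl t)) \<in> bcontfun" for u
  proof (rule bcontfun_normI)
    show "continuous_on UNIV (\<lambda>t. x0 + J (\<lambda>s. F (apply_bcontfun u s)) (cl t))"
      by (intro continuous_on_add continuous_on_const continuous_on_compose2[OF J_cont[OF Fu]])
        (use cl in \<open>auto simp: cl_def intro!: continuous_intros\<close>)
    show "norm (x0 + J (\<lambda>s. F (apply_bcontfun u s)) (cl t)) \<le> norm x0 + 3 * h * M" for t
      using J_bound[where f = "\<lambda>s. F (apply_bcontfun u s)" and B = M and t = "cl t", OF Fu M cl]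
        norm_triangle_ineq[of x0 "J (\<lambda>s. F (apply_bcontfun u s)) (cl t)"] by linarith
  qed
  define G where "G = (\<lambda>u. Bcontfun (\<lambda>t. x0 + J (\<lambda>s. F (apply_bcontfun u s)) (cl t)))"
  have G: "apply_bcontfun (G u) t = x0 + J (\<lambda>s. F (apply_bcontfun u s)) (cl t)" for u t
    unfolding G_def using Bcontfun_inverse[OF in_bc] by simp
  have "dist (G u) (G v) \<le> 1 / 2 * dist u v" for u v
  proof (rule dist_bound)
    fix t
    let ?Fu = "\<lambda>s. F (apply_bcontfun u s)" and ?Fv = "\<lambda>s. F (apply_bcontfun v s)"
    have int: "(\<lambda>s. F (apply_bcontfun w s)) integrable_on {- h..s}" for s w
      by (intro integrable_continuous_real Fu)
    have "J ?Fu (cl t) - J ?Fv (cl t) = J (\<lambda>s. ?Fu s - ?Fv s) (cl t)"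
      unfolding J_def by (simp add: integral_diff int)
    moreover have "norm (J (\<lambda>s. ?Fu s - ?Fv s) (cl t)) \<le> 3 * h * (C * dist u v)"
    proof (rule J_bound[OF _ _ cl])
      show "continuous_on {- h..h} (\<lambda>s. ?Fu s - ?Fv s)"
        by (intro continuous_on_diff Fu)
      show "norm (?Fu s - ?Fv s) \<le> C * dist u v" for s
        using F_lip[of "apply_bcontfun u s" "apply_bcontfun v s"] dist_bounded[of u s v] \<open>C \<ge> 0\<close>
        by (metis dist_norm mult_left_mono order_trans)
    qed
    moreover have "3 * h * C * dist u v \<le> 1 / 2 * dist u v"
      using hC by (intro mult_right_mono) auto
    ultimately show "dist (apply_bcontfun (G u) t) (apply_bcontfun (G v) t) \<le> 1 / 2 * dist u v"
      by (simp add: G dist_norm mult.assoc)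
  qed
  then obtain u where u: "G u = u"
    using banach_fix_type[of "1 / 2" G] by auto
  let ?\<gamma> = "apply_bcontfun u"
  have eq: "?\<gamma> t = x0 + J (\<lambda>s. F (?\<gamma> s)) (cl t)" for t
    using G[of u t] u by simp
  show ?thesis
  proof (rule that[OF \<open>h > 0\<close>, of ?\<gamma>])
    show "?\<gamma> 0 = x0"
      using eq[of 0] \<open>h > 0\<close> by (simp add: cl_id J_def)
    fix t :: real assume t: "\<bar>t\<bar> < h"
    \<comment> \<open>The fixed point stays in the ball, where the projection is the identity and
      \<open>F\<close> is the given field.\<close>
    have "norm (J (\<lambda>s. F (?\<gamma> s)) (cl t)) \<le> r"
      using J_bound[where f = "\<lambda>s. F (apply_bcontfun u s)" and B = M and t = "cl t", OF Fu M cl] hM by linarith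
    then have ball: "?\<gamma> t \<in> cball x0 r"
      by (subst eq) (simp add: dist_norm)
    have "((\<lambda>t. integral {- h..t} (\<lambda>s. F (?\<gamma> s))) has_vector_derivative F (?\<gamma> t)) (at t within {- h..h})"
      using t by (intro integral_has_vector_derivative Fu) auto
    then have "((\<lambda>t. integral {- h..t} (\<lambda>s. F (?\<gamma> s))) has_vector_derivative F (?\<gamma> t)) (at t)"
      using t at_within_Icc_at[of "- h" t h] by simp
    then have "((\<lambda>t. x0 + J (\<lambda>s. F (?\<gamma> s)) t) has_vector_derivative F (?\<gamma> t)) (at t)"
      unfolding J_def by (auto intro!: derivative_eq_intros)
    then have "(?\<gamma> has_vector_derivative F (?\<gamma> t)) (at t)"
    proof (rule has_vector_derivative_transform_within_open[of _ _ _ "{- h<..<h}"])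
      show "x0 + J (\<lambda>s. F (?\<gamma> s)) s = ?\<gamma> s" if "s \<in> {- h<..<h}" for s
      proof -
        have "cl s = s" using that by (intro cl_id) auto
        then show ?thesis using eq[of s] by (simp only:)
      qed
    qed (use t in auto)
    then show "?\<gamma> t \<in> U \<and> (?\<gamma> has_vector_derivative X (?\<gamma> t)) (at t)"
      using ball r by (auto simp: F_def P_id)
  qed
qed

section \<open>Derivatives within sets that are not open\<close>

definition unique_derivatives :: "'e::euclidean_space set \<Rightarrow> bool" where
  "unique_derivatives S \<longleftrightarrow>
     (\<forall>x\<in>S. \<forall>i\<in>Basis. \<forall>e>0. \<exists>d. 0 < \<bar>d\<bar> \<and> \<bar>d\<bar> < e \<and> x + d *\<^sub>R i \<in> S)"

lemma frechet_derivative_within_eq: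
  assumes "unique_derivatives S" "x \<in> S" "(f has_derivative f') (at x within S)"
  shows "frechet_derivative f (at x within S) = f'"
proof (rule frechet_derivative_unique_within[OF _ assms(3)])
  show "(f has_derivative frechet_derivative f (at x within S)) (at x within S)"
    using assms(3) frechet_derivative_works by (auto simp: differentiable_def)
  show "\<exists>d. 0 < \<bar>d\<bar> \<and> \<bar>d\<bar> < e \<and> x + d *\<^sub>R i \<in> S" if "i \<in> Basis" "e > 0" for i e
    using assms(1,2) that by (auto simp: unique_derivatives_def)
qed

lemma unique_derivatives_openin:
  fixes H :: "'e::euclidean_space set"
  assumes "unique_derivatives H" "openin (top_of_set H) S"
  shows "unique_derivatives S"
  unfolding unique_derivatives_def
proof (intro ballI allI impI)
  fix x i :: 'e and e :: real assume x: "x \<in> S" and i: "i \<in> Basis" and "e > 0"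
  obtain U where "open U" and U: "S = H \<inter> U"
    using assms(2) by (auto simp: openin_open)
  then obtain r where "r > 0" and r: "ball x r \<subseteq> U"
    using x by (auto simp: open_contains_ball)
  then obtain d where d: "0 < \<bar>d\<bar>" "\<bar>d\<bar> < min e r" "x + d *\<^sub>R i \<in> H"
    using assms(1) x U i \<open>e > 0\<close> unfolding unique_derivatives_def
    by (metis IntE min_less_iff_conj)
  then have "x + d *\<^sub>R i \<in> ball x r"
    using i by (simp add: dist_norm)
  then show "\<exists>d. 0 < \<bar>d\<bar> \<and> \<bar>d\<bar> < e \<and> x + d *\<^sub>R i \<in> S"
    using d r U by auto
qed

lemma unique_derivatives_UNIV: "unique_derivatives UNIV"
  unfolding unique_derivatives_def
proof (intro ballI allI impI)
  fix e :: real assume "e > 0"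
  then show "\<exists>d. 0 < \<bar>d\<bar> \<and> \<bar>d\<bar> < e \<and> x + d *\<^sub>R i \<in> UNIV" for x i :: 'a
    by (intro exI[of _ "e / 2"]) simp
qed

lemma unique_derivatives_ext_model:
  assumes "a < b"
  shows "unique_derivatives (ext_model a b :: (('e::euclidean_space \<times> 'e) \<times> real) set)"
  unfolding unique_derivatives_def
proof (intro ballI allI impI)
  fix x i :: "('e \<times> 'e) \<times> real" and e :: real
  assume x: "x \<in> ext_model a b" and i: "i \<in> Basis" and "e > 0"
  \<comment> \<open>A step forward in time, except at the final time \<open>b\<close>, where only a
    step backward stays in the interval. A basis vector has time component 0 or 1, so one choice
    serves all of them.\<close>
  define d where "d = (if snd x < b then min (e / 2) (b - snd x) else - min (e / 2) (b - a))"
  have "0 < \<bar>d\<bar>" "\<bar>d\<bar> < e"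
    using \<open>e > 0\<close> \<open>a < b\<close> x by (auto simp: d_def ext_model_def)
  moreover have "snd i = 0 \<or> snd i = 1"
    using i by (auto simp: Basis_prod_def)
  then have "x + d *\<^sub>R i \<in> ext_model a b"
    using x \<open>e > 0\<close> \<open>a < b\<close> by (auto simp: ext_model_def mem_Times_iff d_def min_def)
  ultimately show "\<exists>d. 0 < \<bar>d\<bar> \<and> \<bar>d\<bar> < e \<and> x + d *\<^sub>R i \<in> ext_model a b"
    by blast
qed

text \<open>A relatively open subset contains all points of the larger set near \<open>x\<close>.
  Derivatives on a chart overlap are therefore the same as derivatives on the whole chart image,
  also at the boundary.\<close>

lemma at_within_openin_superset:
  assumes "openin (top_of_set H) S" "x \<in> S" "S \<subseteq> T" "T \<subseteq> H"
  shows "at x within S = at x within T"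
proof -
  obtain U where "open U" "S = H \<inter> U"
    using assms(1) by (auto simp: openin_open)
  then show ?thesis
    using assms by (intro at_within_nhd[of x U]) auto
qed

section \<open>Functions with local smooth extensions\<close>

lemma smooth_on_local_extension:
  assumes "smooth_on S f" "x \<in> S"
  obtains U g where "open U" "x \<in> U" "Cinf_on g U" "\<And>y. y \<in> S \<Longrightarrow> y \<in> U \<Longrightarrow> g y = f y"
proof -
  obtain U g where "open U" "x \<in> U" "\<forall>k. Ck_on k g U" "\<forall>y\<in>S \<inter> U. g y = f y"
    using assms unfolding smooth_on_def by blast
  then show ?thesis by (intro that[of U g]) (auto simp: Cinf_on_def)
qed

lemma smooth_onI:
  assumes "\<And>x. x \<in> S \<Longrightarrow> \<exists>U g. open U \<and> x \<in> U \<and> Cinf_on g U \<and> (\<forall>y\<in>S \<inter> U. g y = f y)"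
  shows "smooth_on S f"
  using assms unfolding smooth_on_def Cinf_on_def by simp

lemma smooth_on_cong:
  assumes "smooth_on S f" "\<And>x. x \<in> S \<Longrightarrow> f x = g x"
  shows "smooth_on S g"
proof (rule smooth_onI)
  fix x assume "x \<in> S"
  obtain U h where "open U" "x \<in> U" "Cinf_on h U" "\<And>y. y \<in> S \<Longrightarrow> y \<in> U \<Longrightarrow> h y = f y"
    using smooth_on_local_extension[OF assms(1) \<open>x \<in> S\<close>] by blast
  then show "\<exists>U h. open U \<and> x \<in> U \<and> Cinf_on h U \<and> (\<forall>y\<in>S \<inter> U. h y = g y)"
    using assms(2) by (intro exI[of _ U] exI[of _ h]) auto
qed

lemma smooth_on_subset:
  assumes "smooth_on S f" "T \<subseteq> S"
  shows "smooth_on T f"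
proof (rule smooth_onI)
  fix x assume "x \<in> T"
  then have "x \<in> S" using assms(2) by blast
  obtain U h where "open U" "x \<in> U" "Cinf_on h U" "\<And>y. y \<in> S \<Longrightarrow> y \<in> U \<Longrightarrow> h y = f y"
    using smooth_on_local_extension[OF assms(1) \<open>x \<in> S\<close>] by blast
  then show "\<exists>U h. open U \<and> x \<in> U \<and> Cinf_on h U \<and> (\<forall>y\<in>T \<inter> U. h y = f y)"
    using assms(2) by (intro exI[of _ U] exI[of _ h]) auto
qed

lemma Cinf_on_imp_smooth_on: "Cinf_on f U \<Longrightarrow> open U \<Longrightarrow> S \<subseteq> U \<Longrightarrow> smooth_on S f"
  by (rule smooth_onI) blast

lemma smooth_on_imp_Cinf_on:
  assumes "smooth_on S f" "open S"
  shows "Cinf_on f S"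
proof (rule Cinf_on_local)
  fix x assume "x \<in> S"
  then obtain U g where U: "open U" "x \<in> U" "Cinf_on g U" "\<And>y. y \<in> S \<Longrightarrow> y \<in> U \<Longrightarrow> g y = f y"
    using smooth_on_local_extension[OF assms(1)] by blast
  have "Cinf_on f (S \<inter> U)"
    by (rule Cinf_on_cong[OF Cinf_on_subset[OF U(3)]]) (use U assms(2) in auto)
  then show "\<exists>V. open V \<and> x \<in> V \<and> Cinf_on f V"
    using U \<open>x \<in> S\<close> assms(2) by (intro exI[of _ "S \<inter> U"]) auto
qed

lemma smooth_on_has_derivative:
  assumes "smooth_on S f" "x \<in> S"
  obtains f' where "(f has_derivative f') (at x within S)"
proof -
  obtain U g where U: "open U" "x \<in> U" "Cinf_on g U" "\<And>y. y \<in> S \<Longrightarrow> y \<in> U \<Longrightarrow> g y = f y"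
    using smooth_on_local_extension[OF assms] by blast
  from U obtain e where e: "e > 0" "ball x e \<subseteq> U" by (auto simp: open_contains_ball)
  have "(f has_derivative frechet_derivative g (at x)) (at x within S)"
    by (rule has_derivative_transform_within[OF has_derivative_at_withinI[OF Cinf_on_has_derivative[OF U(3,2)]] e(1)])
      (use U e assms in \<open>auto simp: subset_eq dist_commute\<close>)
  then show ?thesis by (rule that)
qed

text \<open>Uniqueness of the one-sided derivative forces it to agree with that of every smooth
  extension. Differentiating the extension thus extends the derivative, and smoothness is
  inherited.\<close>

lemma smooth_on_extension_derivative:
  assumes "unique_derivatives S" "x \<in> S" "x \<in> U" "open U" "Cinf_on g U"
    "\<And>y. y \<in> S \<Longrightarrow> y \<in> U \<Longrightarrow> g y = f y"
  shows "frechet_derivative f (at x within S) = frechet_derivative g (at x)"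
proof (rule frechet_derivative_within_eq[OF assms(1,2)])
  from assms obtain e where e: "e > 0" "ball x e \<subseteq> U" by (auto simp: open_contains_ball)
  show "(f has_derivative frechet_derivative g (at x)) (at x within S)"
    by (rule has_derivative_transform_within[OF has_derivative_at_withinI[OF Cinf_on_has_derivative[OF assms(5,3)]] e(1)])
      (use assms e in \<open>auto simp: subset_eq dist_commute\<close>)
qed

lemma smooth_on_frechet_derivative:
  assumes "unique_derivatives S" "smooth_on S f"
  shows "smooth_on S (\<lambda>x. frechet_derivative f (at x within S) v)"
proof (rule smooth_onI)
  fix x assume "x \<in> S"
  then obtain U g where U: "open U" "x \<in> U" "Cinf_on g U" "\<And>y. y \<in> S \<Longrightarrow> y \<in> U \<Longrightarrow> g y = f y"
    using smooth_on_local_extension[OF assms(2)] by blast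
  show "\<exists>U g. open U \<and> x \<in> U \<and> Cinf_on g U \<and>
      (\<forall>y\<in>S \<inter> U. g y = frechet_derivative f (at y within S) v)"
    using U smooth_on_extension_derivative[OF assms(1) _ _ U(1,3,4)]
    by (intro exI[of _ U] exI[of _ "\<lambda>y. frechet_derivative g (at y) v"])
      (auto intro!: Cinf_on_frechet_derivative Cinf_on_const)
qed

lemma smooth_on_continuous:
  assumes "smooth_on S f"
  shows "continuous_on S f"
  unfolding continuous_on_eq_continuous_within
  using smooth_on_has_derivative[OF assms] has_derivative_continuous by blast

lemma smooth_on_bounded_linear:
  assumes "bounded_linear h" "smooth_on S f"
  shows "smooth_on S (\<lambda>x. h (f x))"
proof (rule smooth_onI)
  fix x assume "x \<in> S"
  then obtain U g where U: "open U" "x \<in> U" "Cinf_on g U" "\<And>y. y \<in> S \<Longrightarrow> y \<in> U \<Longrightarrow> g y = f y"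
    using smooth_on_local_extension[OF assms(2)] by blast
  then show "\<exists>U g. open U \<and> x \<in> U \<and> Cinf_on g U \<and> (\<forall>y\<in>S \<inter> U. g y = h (f y))"
    using Cinf_on_bounded_linear[OF assms(1)] by (intro exI[of _ U] exI[of _ "\<lambda>y. h (g y)"]) auto
qed

lemma smooth_on_openin_local:
  assumes "\<And>x. x \<in> S \<Longrightarrow> \<exists>N. openin (top_of_set S) N \<and> x \<in> N \<and> smooth_on N f"
  shows "smooth_on S f"
proof (rule smooth_onI)
  fix x assume "x \<in> S"
  then obtain N where N: "openin (top_of_set S) N" "x \<in> N" "smooth_on N f"
    using assms by blast
  then obtain V where V: "open V" "N = S \<inter> V" by (auto simp: openin_open)
  obtain U g where U: "open U" "x \<in> U" "Cinf_on g U" "\<And>y. y \<in> N \<Longrightarrow> y \<in> U \<Longrightarrow> g y = f y"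
    using smooth_on_local_extension[OF N(3,2)] by blast
  then show "\<exists>U g. open U \<and> x \<in> U \<and> Cinf_on g U \<and> (\<forall>y\<in>S \<inter> U. g y = f y)"
    using V N(2) by (intro exI[of _ "U \<inter> V"] exI[of _ g]) (auto intro: Cinf_on_subset)
qed

lemma at_within_interval_nontrivial:
  fixes I :: "real set"
  assumes "is_interval I" "interior I \<noteq> {}" "t \<in> I"
  shows "at t within I \<noteq> bot"
proof -
  have "\<nexists>u. I = {u}"
    using assms(2) by auto
  then have "t islimpt I"
    using assms connected_imp_perfect[of I t] is_interval_connected_1 by blast
  then show ?thesis by (simp add: trivial_limit_within)
qed

section \<open>Tangent vectors in charts\<close>

lemma charts_atD: "c \<in> charts_at A p \<Longrightarrow> c \<in> A" "c \<in> charts_at A p \<Longrightarrow> p \<in> fst c"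
  by (auto simp: charts_at_def)

lemma some_chart: "p \<in> points A \<Longrightarrow> (SOME c. c \<in> charts_at A p) \<in> charts_at A p"
  by (rule someI_ex) (auto simp: points_def charts_at_def)

definition chart_differentiable ::
  "('p, 'e::euclidean_space) chart \<Rightarrow> ('p \<Rightarrow> 'f::real_normed_vector) \<Rightarrow> 'p \<Rightarrow> bool" where
  "chart_differentiable c F p \<longleftrightarrow>
     (F \<circ> chart_inv c) differentiable (at (snd c p) within snd c ` fst c)"

lemma chart_has_derivative:
  "chart_differentiable c F p \<Longrightarrow>
    ((F \<circ> chart_inv c) has_derivative chart_derivative c F p) (at (snd c p) within snd c ` fst c)"
  unfolding chart_differentiable_def chart_derivative_def[abs_def] frechet_derivative_works .

lemma chart_derivative_linear:
  "chart_differentiable c F p \<Longrightarrow> linear (chart_derivative c F p)"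
  by (rule has_derivative_linear[OF chart_has_derivative])

text \<open>What the calculus of tangent vectors requires, with differentiable transitions only. It
  serves both the group, whose model is the full space, and the extended tangent bundle, whose model
  has a boundary.\<close>

locale diff_atlas =
  fixes H :: "'e::euclidean_space set" and A :: "('p, 'e) chart set"
  assumes unique_derivatives_model: "unique_derivatives H"
    and inj_chart: "c \<in> A \<Longrightarrow> inj_on (snd c) (fst c)"
    and openin_overlap: "c \<in> A \<Longrightarrow> d \<in> A \<Longrightarrow> openin (top_of_set H) (snd c ` (fst c \<inter> fst d))"
    and differentiable_transition: "c \<in> A \<Longrightarrow> d \<in> A \<Longrightarrow> p \<in> fst c \<Longrightarrow> p \<in> fst d \<Longrightarrow>
      (snd d \<circ> chart_inv c) differentiable (at (snd c p) within snd c ` (fst c \<inter> fst d))"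
begin

lemma chart_inv_chart: "c \<in> A \<Longrightarrow> p \<in> fst c \<Longrightarrow> chart_inv c (snd c p) = p"
  by (simp add: chart_inv_def inj_chart)

lemma openin_chart_image: "c \<in> A \<Longrightarrow> openin (top_of_set H) (snd c ` fst c)"
  using openin_overlap[of c c] by simp

lemma unique_derivatives_chart: "c \<in> A \<Longrightarrow> unique_derivatives (snd c ` fst c)"
  using unique_derivatives_openin unique_derivatives_model openin_chart_image by blast

lemma chart_derivative_eq:
  assumes "c \<in> charts_at A p"
    "((F \<circ> chart_inv c) has_derivative F') (at (snd c p) within snd c ` fst c)"
  shows "chart_derivative c F p = F'"
  unfolding chart_derivative_def[abs_def]
  by (rule frechet_derivative_within_eq[OF unique_derivatives_chart _ assms(2)])
    (use charts_atD[OF assms(1)] in auto)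

lemma at_within_overlap:
  assumes "c \<in> charts_at A p" "d \<in> charts_at A p"
  shows "at (snd c p) within snd c ` (fst c \<inter> fst d) = at (snd c p) within snd c ` fst c"
  by (rule at_within_openin_superset[OF openin_overlap[of c d]])
    (use assms openin_chart_image[THEN openin_imp_subset] in \<open>auto simp: charts_at_def\<close>)

lemma chart_differentiable_chart:
  "c \<in> charts_at A p \<Longrightarrow> d \<in> charts_at A p \<Longrightarrow> chart_differentiable c (snd d) p"
  unfolding chart_differentiable_def
  using at_within_overlap differentiable_transition by (metis charts_atD)

lemma chart_derivative_local:
  assumes "c \<in> charts_at A p" "openin (top_of_set H) T" "snd c p \<in> T" "T \<subseteq> snd c ` fst c"
    and F: "chart_differentiable c F p"
    and eq: "\<And>x. x \<in> T \<Longrightarrow> F (chart_inv c x) = G (chart_inv c x)"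
  shows "chart_differentiable c G p" "chart_derivative c G p = chart_derivative c F p"
proof -
  have at: "at (snd c p) within T = at (snd c p) within snd c ` fst c"
    using assms(2,3,4) openin_chart_image[THEN openin_imp_subset, OF charts_atD(1)[OF assms(1)]]
    by (rule at_within_openin_superset)
  have "((G \<circ> chart_inv c) has_derivative chart_derivative c F p) (at (snd c p) within snd c ` fst c)"
    using chart_has_derivative[OF F] unfolding at[symmetric]
    by (rule has_derivative_transform[OF assms(3), rotated]) (simp add: eq)
  then show "chart_differentiable c G p" "chart_derivative c G p = chart_derivative c F p"
    using chart_derivative_eq[OF assms(1)] by (auto simp: chart_differentiable_def differentiable_def)
qed

lemma chart_derivative_cong:
  assumes "c \<in> charts_at A p" "chart_differentiable c F p" "\<And>x. x \<in> fst c \<Longrightarrow> F x = G x"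
  shows "chart_differentiable c G p" "chart_derivative c G p = chart_derivative c F p"
proof -
  have eq: "F (chart_inv c x) = G (chart_inv c x)" if x: "x \<in> snd c ` fst c" for x
  proof -
    obtain q where "q \<in> fst c" "x = snd c q" using x by blast
    then show ?thesis using chart_inv_chart[OF charts_atD(1)[OF assms(1)]] assms(3) by simp
  qed
  have "snd c p \<in> snd c ` fst c" using charts_atD[OF assms(1)] by simp
  note * = chart_derivative_local[OF assms(1) openin_chart_image[OF charts_atD(1)[OF assms(1)]]
      this order_refl assms(2) eq]
  show "chart_differentiable c G p" "chart_derivative c G p = chart_derivative c F p"
    by (rule *; assumption)+
qed

text \<open>The chain rule through the transition map on the overlap. It matches the transformation
  rule of tangent vectors, so that derivatives along a tangent vector do not depend on the
  chart.\<close>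

lemma chart_change:
  assumes c: "c \<in> charts_at A p" and d: "d \<in> charts_at A p" and F: "chart_differentiable c F p"
  shows "chart_differentiable d F p"
    and "chart_derivative d F p = chart_derivative c F p \<circ> chart_derivative d (snd c) p"
proof -
  let ?T = "snd d ` (fst d \<inter> fst c)"
  have at: "at (snd d p) within ?T = at (snd d p) within snd d ` fst d"
    using at_within_overlap[OF d c] .
  have tr: "((snd c \<circ> chart_inv d) has_derivative chart_derivative d (snd c) p) (at (snd d p) within ?T)"
    unfolding at by (intro chart_has_derivative chart_differentiable_chart c d)
  have inv: "chart_inv d (snd d q) = q" if "q \<in> fst d" for q
    using chart_inv_chart[OF charts_atD(1)[OF d] that] .
  have invc: "chart_inv c (snd c q) = q" if "q \<in> fst c" for q
    using chart_inv_chart[OF charts_atD(1)[OF c] that] .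
  have "((F \<circ> chart_inv c) has_derivative chart_derivative c F p)
      (at ((snd c \<circ> chart_inv d) (snd d p)) within (snd c \<circ> chart_inv d) ` ?T)"
  proof -
    have "(snd c \<circ> chart_inv d) ` ?T \<subseteq> snd c ` fst c"
      by (auto simp: inv)
    moreover have "(snd c \<circ> chart_inv d) (snd d p) = snd c p"
      by (simp add: inv charts_atD[OF d])
    ultimately show ?thesis
      using has_derivative_subset[OF chart_has_derivative[OF F]] by simp
  qed
  from diff_chain_within[OF tr this]
  have "((F \<circ> chart_inv d) has_derivative chart_derivative c F p \<circ> chart_derivative d (snd c) p)
      (at (snd d p) within ?T)"
    by (rule has_derivative_transform[rotated 2]) (use charts_atD[OF c] charts_atD[OF d] in \<open>auto simp: inv invc\<close>)
  then have "((F \<circ> chart_inv d) has_derivative chart_derivative c F p \<circ> chart_derivative d (snd c) p)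
      (at (snd d p) within snd d ` fst d)"
    unfolding at .
  then show "chart_differentiable d F p"
    and "chart_derivative d F p = chart_derivative c F p \<circ> chart_derivative d (snd c) p"
    using chart_derivative_eq[OF d] by (auto simp: chart_differentiable_def differentiable_def)
qed

lemma chart_derivative_self:
  assumes "c \<in> charts_at A p"
  shows "chart_derivative c (snd c) p = id"
proof (rule chart_derivative_eq[OF assms])
  have eq: "(snd c \<circ> chart_inv c) x = id x" if x: "x \<in> snd c ` fst c" for x
  proof -
    obtain q where "q \<in> fst c" "x = snd c q" using x by blast
    then show ?thesis using chart_inv_chart[OF charts_atD(1)[OF assms]] by simp
  qed
  have "snd c p \<in> snd c ` fst c" using charts_atD[OF assms] by simp
  then show "((snd c \<circ> chart_inv c) has_derivative id) (at (snd c p) within snd c ` fst c)"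
    using eq by (rule has_derivative_transform[OF _ _ has_derivative_id])
qed

lemma tangent_space_transform:
  "X \<in> tangent_space A p \<Longrightarrow> c \<in> charts_at A p \<Longrightarrow> d \<in> charts_at A p \<Longrightarrow>
    X d = chart_derivative c (snd d) p (X c)"
  unfolding tangent_space_def by blast

lemma tangent_space_outside: "X \<in> tangent_space A p \<Longrightarrow> c \<notin> charts_at A p \<Longrightarrow> X c = 0"
  unfolding tangent_space_def by blast

lemma tangent_spaceI:
  assumes "\<And>c. c \<notin> charts_at A p \<Longrightarrow> X c = 0"
    and "\<And>c d. c \<in> charts_at A p \<Longrightarrow> d \<in> charts_at A p \<Longrightarrow> X d = chart_derivative c (snd d) p (X c)"
  shows "X \<in> tangent_space A p"
  unfolding tangent_space_def using assms by blast

lemma differential_eq: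
  assumes "X \<in> tangent_space A p" "c \<in> charts_at A p" "chart_differentiable c F p"
  shows "differential A F p X = chart_derivative c F p (X c)"
proof -
  define d where "d = (SOME c. c \<in> charts_at A p)"
  have d: "d \<in> charts_at A p"
    unfolding d_def using assms(2) by (rule someI)
  show ?thesis
    unfolding differential_def Let_def d_def[symmetric]
    using chart_change(2)[OF assms(2) d assms(3)] tangent_space_transform[OF assms(1) d assms(2)] by simp
qed

lemma coord_vector_chart: "c \<in> charts_at A p \<Longrightarrow> coord_vector A c v p c = v"
  by (simp add: coord_vector_def chart_derivative_self)

lemma coord_vector_in_tangent_space:
  assumes c: "c \<in> charts_at A p"
  shows "coord_vector A c v p \<in> tangent_space A p"
proof (rule tangent_spaceI)
  fix d e assume d: "d \<in> charts_at A p" and e: "e \<in> charts_at A p"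
  have "chart_derivative c (snd e) p = chart_derivative d (snd e) p \<circ> chart_derivative c (snd d) p"
    by (rule chart_change(2)[OF d c chart_differentiable_chart[OF d e]])
  then show "coord_vector A c v p e = chart_derivative d (snd e) p (coord_vector A c v p d)"
    using d e by (simp add: coord_vector_def)
qed (auto simp: coord_vector_def)

lemma coord_vector_eq:
  assumes "X \<in> tangent_space A p" "c \<in> charts_at A p"
  shows "coord_vector A c (X c) p = X"
proof
  fix d
  show "coord_vector A c (X c) p d = X d"
    using tangent_space_transform[OF assms, of d] tangent_space_outside[OF assms(1), of d]
    by (simp add: coord_vector_def)
qed

lemma tangent_space_eqI:
  "X \<in> tangent_space A p \<Longrightarrow> Y \<in> tangent_space A p \<Longrightarrow> c \<in> charts_at A p \<Longrightarrow> X c = Y c \<Longrightarrow> X = Y"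
  by (metis coord_vector_eq)

lemma subspace_tangent_space: "subspace (tangent_space A p)"
  unfolding subspace_def
proof (intro conjI ballI allI)
  show "0 \<in> tangent_space A p"
    by (rule tangent_spaceI) (simp_all add: linear_0 chart_derivative_linear chart_differentiable_chart)
  fix X assume X: "X \<in> tangent_space A p"
  show "X + Y \<in> tangent_space A p" if Y: "Y \<in> tangent_space A p" for Y
  proof (rule tangent_spaceI)
    fix c d assume c: "c \<in> charts_at A p" and d: "d \<in> charts_at A p"
    show "(X + Y) d = chart_derivative c (snd d) p ((X + Y) c)"
      using tangent_space_transform[OF X c d] tangent_space_transform[OF Y c d]
      by (simp add: linear_add[OF chart_derivative_linear[OF chart_differentiable_chart[OF c d]]])
  qed (simp add: tangent_space_outside[OF X] tangent_space_outside[OF Y])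
  show "r *\<^sub>R X \<in> tangent_space A p" for r
  proof (rule tangent_spaceI)
    fix c d assume c: "c \<in> charts_at A p" and d: "d \<in> charts_at A p"
    show "(r *\<^sub>R X) d = chart_derivative c (snd d) p ((r *\<^sub>R X) c)"
      using tangent_space_transform[OF X c d]
      by (simp add: scaleR_fun_def linear_scale[OF chart_derivative_linear[OF chart_differentiable_chart[OF c d]]])
  qed (simp add: scaleR_fun_def tangent_space_outside[OF X])
qed

lemma linear_coord_vector:
  assumes c: "c \<in> charts_at A p"
  shows "linear (\<lambda>v. coord_vector A c v p)"
proof (rule linearI; rule ext)
  fix d
  note lin = chart_derivative_linear[OF chart_differentiable_chart[OF c, of d]]
  show "coord_vector A c (v + w) p d = (coord_vector A c v p + coord_vector A c w p) d" for v w
    by (cases "d \<in> charts_at A p") (simp_all add: coord_vector_def linear_add[OF lin])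
  show "coord_vector A c (r *\<^sub>R v) p d = (r *\<^sub>R coord_vector A c v p) d" for r v
    by (cases "d \<in> charts_at A p") (simp_all add: coord_vector_def scaleR_fun_def linear_scale[OF lin])
qed

lemma differential_linear:
  assumes "c \<in> charts_at A p" "chart_differentiable c F p"
    "X \<in> tangent_space A p" "Y \<in> tangent_space A p"
  shows "differential A F p (X + Y) = differential A F p X + differential A F p Y"
    and "differential A F p (r *\<^sub>R X) = r *\<^sub>R differential A F p X"
  using assms subspace_add[OF subspace_tangent_space] subspace_scale[OF subspace_tangent_space]
  by (simp_all add: differential_eq linear_add[OF chart_derivative_linear]
      linear_scale[OF chart_derivative_linear] scaleR_fun_def)

text \<open>The chain rule needs the curve to stay in the chart only near \<open>t\<close>.
  \<open>N\<close> is such a neighbourhood relative to \<open>I\<close>, so end points of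
  \<open>I\<close> are included.\<close>

lemma curve_has_vector_derivative:
  assumes c: "c \<in> charts_at A (C t)" and t: "t \<in> I"
    and N: "openin (top_of_set I) N" "t \<in> N" "C ` N \<subseteq> fst c"
    and der: "((snd c \<circ> C) has_vector_derivative v) (at t within I)"
    and F: "chart_differentiable c F (C t)"
  shows "((F \<circ> C) has_vector_derivative chart_derivative c F (C t) v) (at t within I)"
proof -
  have at: "at t within N = at t within I"
    using at_within_openin_superset[OF N(1,2) openin_imp_subset[OF N(1)]] by simp
  have inv: "chart_inv c (snd c q) = q" if "q \<in> fst c" for q
    using chart_inv_chart[OF charts_atD(1)[OF c] that] .
  have "((F \<circ> chart_inv c) has_derivative chart_derivative c F (C t))
      (at ((snd c \<circ> C) t) within (snd c \<circ> C) ` N)"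
  proof -
    have "(snd c \<circ> C) ` N \<subseteq> snd c ` fst c" using N(3) by auto
    from has_derivative_subset[OF chart_has_derivative[OF F] this] show ?thesis by simp
  qed
  from diff_chain_within[OF der[folded at, unfolded has_vector_derivative_def] this]
  have "((F \<circ> chart_inv c \<circ> (snd c \<circ> C)) has_derivative
      chart_derivative c F (C t) \<circ> (\<lambda>x. x *\<^sub>R v)) (at t within N)" .
  then have "((F \<circ> C) has_derivative chart_derivative c F (C t) \<circ> (\<lambda>x. x *\<^sub>R v)) (at t within N)"
    by (rule has_derivative_transform[rotated 2]) (use N in \<open>auto simp: inv image_subset_iff\<close>)
  then show ?thesis
    unfolding at has_vector_derivative_def
    by (simp add: o_def linear_scale[OF chart_derivative_linear[OF F]])
qed

lemma velocity_eq_coord_vector: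
  assumes I: "is_interval I" "interior I \<noteq> {}" and c: "c \<in> charts_at A (C t)" and t: "t \<in> I"
    and N: "openin (top_of_set I) N" "t \<in> N" "C ` N \<subseteq> fst c"
    and der: "((snd c \<circ> C) has_vector_derivative v) (at t within I)"
  shows "velocity A I C t = coord_vector A c v (C t)"
proof
  fix d
  show "velocity A I C t d = coord_vector A c v (C t) d"
    using vector_derivative_within[OF at_within_interval_nontrivial[OF I t]
        curve_has_vector_derivative[OF c t N der chart_differentiable_chart[OF c, of d]]]
    by (simp add: velocity_def coord_vector_def)
qed

end

lemma chart_inv_id: "x \<in> S \<Longrightarrow> chart_inv (S, id) x = x"
  by (simp add: chart_inv_def inv_into_f_f[of id, simplified])

lemma smooth_curve_iff:
  "smooth_curve A I C \<longleftrightarrow> is_interval I \<and> interior I \<noteq> {} \<and> C ` I \<subseteq> points A \<and>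
     (\<forall>d\<in>A. openin (top_of_set I) (I \<inter> C -` fst d) \<and> smooth_on (I \<inter> C -` fst d) (snd d \<circ> C))"
proof -
  have "smooth_on (I \<inter> C -` fst d) (snd d \<circ> C \<circ> chart_inv (I, id)) \<longleftrightarrow>
      smooth_on (I \<inter> C -` fst d) (snd d \<circ> C)" for d :: "('a, 'b) chart"
    by (rule iffI; erule smooth_on_cong) (auto simp: chart_inv_id)
  then show ?thesis
    unfolding smooth_curve_def smooth_map_def by (simp add: id_atlas_def points_def)
qed

lemma (in diff_atlas) smooth_curve_velocity:
  assumes C: "smooth_curve A I C" and t: "t \<in> I" and c: "c \<in> charts_at A (C t)"
  shows "velocity A I C t \<in> tangent_space A (C t)"
    and "((snd c \<circ> C) has_vector_derivative velocity A I C t c) (at t within I)"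
    and "chart_differentiable c F (C t) \<Longrightarrow>
      ((F \<circ> C) has_vector_derivative differential A F (C t) (velocity A I C t)) (at t within I)"
proof -
  let ?N = "I \<inter> C -` fst c"
  have I: "is_interval I" "interior I \<noteq> {}" and N: "openin (top_of_set I) ?N"
    and sm: "smooth_on ?N (snd c \<circ> C)"
    using C charts_atD[OF c] by (auto simp: smooth_curve_iff)
  have tN: "t \<in> ?N" "C ` ?N \<subseteq> fst c" using t charts_atD[OF c] by auto
  obtain f' where f': "((snd c \<circ> C) has_derivative f') (at t within ?N)"
    using smooth_on_has_derivative[OF sm tN(1)] by blast
  have "f' x = x *\<^sub>R f' 1" for x
    using linear_scale[OF has_derivative_linear[OF f'], of x 1] by (simp only: real_scaleR_def mult_1_right)
  then have "f' = (\<lambda>x. x *\<^sub>R f' 1)"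
    by (rule ext)
  then have der: "((snd c \<circ> C) has_vector_derivative f' 1) (at t within I)"
    using f' unfolding at_within_openin_superset[OF N tN(1) Int_lower1 order_refl]
    by (simp only: has_vector_derivative_def)
  note v = velocity_eq_coord_vector[OF I c t N tN der]
  show V: "velocity A I C t \<in> tangent_space A (C t)"
    unfolding v by (rule coord_vector_in_tangent_space[OF c])
  show "((snd c \<circ> C) has_vector_derivative velocity A I C t c) (at t within I)"
    using der by (simp add: v coord_vector_chart[OF c])
  show "((F \<circ> C) has_vector_derivative differential A F (C t) (velocity A I C t)) (at t within I)"
    if "chart_differentiable c F (C t)"
    using curve_has_vector_derivative[OF c t N tN der that]
    unfolding differential_eq[OF V c that] unfolding v coord_vector_chart[OF c] .
qed

section \<open>The atlas of the extended tangent bundle\<close>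

text \<open>Made for the transitions of the tangent bundle, in which the base point and the
  direction vary together.\<close>

lemma Cinf_on_frechet_derivative_compose:
  assumes "open U" "open V" "g ` U \<subseteq> V" "Cinf_on f V" "Cinf_on g U" "Cinf_on v U"
  shows "Cinf_on (\<lambda>z. frechet_derivative f (at (g z)) (v z)) U"
proof (rule Cinf_on_cong)
  have "Cinf_on (\<lambda>z. frechet_derivative f (at (g z)) b) U" for b
    by (rule Cinf_on_compose[OF assms(1-3) Cinf_on_frechet_derivative[OF assms(2,4) Cinf_on_const] assms(5)])
  then show "Cinf_on (\<lambda>z. \<Sum>b\<in>Basis. (v z \<bullet> b) *\<^sub>R frechet_derivative f (at (g z)) b) U"
    by (intro Cinf_on_sum Cinf_on_scaleR Cinf_on_inner assms)
  show "(\<Sum>b\<in>Basis. (v z \<bullet> b) *\<^sub>R frechet_derivative f (at (g z)) b) = frechet_derivative f (at (g z)) (v z)"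
    if "z \<in> U" for z
  proof -
    have "g z \<in> V" using assms(3) that by blast
    from Cinf_on_has_derivative[OF assms(4) this] show ?thesis
      by (rule linear_sum_Basis[OF has_derivative_linear, symmetric])
  qed
qed (rule assms)

locale boundaryless_atlas =
  fixes A :: "('q, 'e::euclidean_space) chart set"
  assumes smooth_atlas: "smooth_atlas UNIV A"
begin

lemma open_overlap: "c \<in> A \<Longrightarrow> d \<in> A \<Longrightarrow> open (snd c ` (fst c \<inter> fst d))"
  using smooth_atlas unfolding smooth_atlas_def by (auto simp del: split_paired_All split_paired_Ex)

lemma open_chart_image: "c \<in> A \<Longrightarrow> open (snd c ` fst c)"
  using open_overlap[of c c] by simp

lemma Cinf_on_transition:
  assumes "c \<in> A" "d \<in> A"
  shows "Cinf_on (snd d \<circ> chart_inv c) (snd c ` (fst c \<inter> fst d))"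
  using smooth_atlas assms
  by (intro smooth_on_imp_Cinf_on open_overlap) (simp_all add: smooth_atlas_def)

sublocale base: diff_atlas UNIV A
proof
  show "unique_derivatives (UNIV :: 'e set)" by (rule unique_derivatives_UNIV)
  fix c d assume c: "c \<in> A"
  show "inj_on (snd c) (fst c)" using smooth_atlas c by (simp add: smooth_atlas_def)
  assume d: "d \<in> A"
  show "openin (top_of_set UNIV) (snd c ` (fst c \<inter> fst d))"
    using open_overlap[OF c d] by simp
  fix p assume "p \<in> fst c" "p \<in> fst d"
  then have "snd c p \<in> snd c ` (fst c \<inter> fst d)" by simp
  from Cinf_on_has_derivative[OF Cinf_on_transition[OF c d] this]
  show "(snd d \<circ> chart_inv c) differentiable (at (snd c p) within snd c ` (fst c \<inter> fst d))"
    unfolding differentiable_def using has_derivative_at_withinI by blast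
qed

lemma at_within_chart: "c \<in> charts_at A q \<Longrightarrow> at (snd c q) within snd c ` fst c = at (snd c q)"
  using open_chart_image[OF charts_atD(1)] charts_atD(2) by (intro at_within_open imageI)

lemma chart_derivative_transition:
  assumes "c \<in> charts_at A q" "d \<in> charts_at A q"
  shows "chart_derivative c (snd d) q = frechet_derivative (snd d \<circ> chart_inv c) (at (snd c q))"
  unfolding chart_derivative_def[abs_def] at_within_chart[OF assms(1)] by (rule refl)

lemma coord_vector_transition:
  assumes "c \<in> charts_at A q" "d \<in> charts_at A q"
  shows "coord_vector A c v q d = frechet_derivative (snd d \<circ> chart_inv c) (at (snd c q)) v"
  using assms by (simp add: coord_vector_def chart_derivative_transition)

end

definition ext_chart ::
  "('q, 'e::euclidean_space) chart set \<Rightarrow> real \<Rightarrow> real \<Rightarrow> ('q, 'e) chart \<Rightarrow>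
    (('q, 'e) ext_point, ('e \<times> 'e) \<times> real) chart" where
  "ext_chart A a b c =
     ((SIGMA q:fst c. tangent_space A q) \<times> {a..b}, map_prod (\<lambda>(q, X). (snd c q, X c)) id)"

lemma times_singleton_image: "T \<times> {y} = (\<lambda>t. (t, y)) ` T"
  by auto

lemma ext_tangent_atlas_eq: "ext_tangent_atlas A a b = ext_chart A a b ` A"
  by (simp add: ext_tangent_atlas_def prod_atlas_def tangent_atlas_def id_atlas_def
      ext_chart_def image_image times_singleton_image)

lemma snd_ext_chart: "snd (ext_chart A a b c) m = ((snd c (base_point m), fibre_vector m c), time_coord m)"
  by (cases m) (auto simp: ext_chart_def base_point_def fibre_vector_def time_coord_def)

lemma mem_ext_chart:
  "m \<in> fst (ext_chart A a b c) \<longleftrightarrow>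
    base_point m \<in> fst c \<and> fibre_vector m \<in> tangent_space A (base_point m) \<and> time_coord m \<in> {a..b}"
  by (cases m) (auto simp: ext_chart_def base_point_def fibre_vector_def time_coord_def)

lemma mem_points_ext:
  "m \<in> points (ext_tangent_atlas A a b) \<longleftrightarrow>
    base_point m \<in> points A \<and> fibre_vector m \<in> tangent_space A (base_point m) \<and> time_coord m \<in> {a..b}"
  by (cases m) (auto simp: points_ext_tangent_atlas tangent_bundle_def base_point_def fibre_vector_def time_coord_def)

lemma ext_point_eq: "((base_point m, fibre_vector m), time_coord m) = m"
  by (simp add: base_point_def fibre_vector_def time_coord_def)

lemma ext_point_simps [simp]:
  "base_point ((q, X), s) = q" "fibre_vector ((q, X), s) = X" "time_coord ((q, X), s) = s"
  by (simp_all add: base_point_def fibre_vector_def time_coord_def)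

locale ext_atlas = boundaryless_atlas A for A :: "('q, 'e::euclidean_space) chart set" +
  fixes a b :: real
  assumes a_less_b: "a < b"
begin

abbreviation TA where "TA \<equiv> ext_tangent_atlas A a b"
abbreviation xc where "xc \<equiv> ext_chart A a b"

text \<open>The fibre coordinates fill the whole model space because every coordinate vector is
  attained by a \<open>coord_vector\<close>.\<close>

lemma ext_chart_image:
  assumes "c \<in> A" "d \<in> A"
  shows "snd (xc c) ` (fst (xc c) \<inter> fst (xc d)) = (snd c ` (fst c \<inter> fst d) \<times> UNIV) \<times> {a..b}" (is "?L = ?R")
proof
  show "?L \<subseteq> ?R"
    by (auto simp: snd_ext_chart mem_ext_chart simp del: split_paired_All split_paired_Ex)
  show "?R \<subseteq> ?L"
  proof
    fix z assume "z \<in> ?R"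
    then obtain q v s where z: "z = ((snd c q, v), s)" and q: "q \<in> fst c" "q \<in> fst d" and s: "s \<in> {a..b}"
      by auto
    have c: "c \<in> charts_at A q" using assms q by (simp add: charts_at_def)
    show "z \<in> ?L"
    proof (rule image_eqI[of _ _ "((q, coord_vector A c v q), s)"])
      show "z = snd (xc c) ((q, coord_vector A c v q), s)"
        by (simp add: z snd_ext_chart base.coord_vector_chart[OF c])
      show "((q, coord_vector A c v q), s) \<in> fst (xc c) \<inter> fst (xc d)"
        using q s base.coord_vector_in_tangent_space[OF c] by (simp add: mem_ext_chart)
    qed
  qed
qed

lemma ext_chart_image_self: "c \<in> A \<Longrightarrow> snd (xc c) ` fst (xc c) = (snd c ` fst c \<times> UNIV) \<times> {a..b}"
  using ext_chart_image[of c c] by simp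

lemma inj_ext_chart:
  assumes "c \<in> A"
  shows "inj_on (snd (xc c)) (fst (xc c))"
proof (rule inj_onI)
  fix m n assume m: "m \<in> fst (xc c)" and n: "n \<in> fst (xc c)" and eq: "snd (xc c) m = snd (xc c) n"
  have q: "base_point m = base_point n"
    using m n eq by (intro inj_onD[OF base.inj_chart[OF assms]]) (simp_all add: snd_ext_chart mem_ext_chart)
  have "fibre_vector m = fibre_vector n"
  proof (rule base.tangent_space_eqI)
    show "fibre_vector m \<in> tangent_space A (base_point m)" "fibre_vector n \<in> tangent_space A (base_point m)"
      using m n q by (simp_all add: mem_ext_chart)
    show "c \<in> charts_at A (base_point m)" using m assms by (simp add: mem_ext_chart charts_at_def)
    show "fibre_vector m c = fibre_vector n c" using eq by (simp add: snd_ext_chart)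
  qed
  then show "m = n"
    using q eq by (subst (1 2) ext_point_eq[symmetric]) (simp add: snd_ext_chart)
qed

lemma chart_inv_ext_chart:
  assumes "c \<in> A" "x \<in> snd c ` fst c" "s \<in> {a..b}"
  shows "chart_inv (xc c) ((x, v), s) = ((chart_inv c x, coord_vector A c v (chart_inv c x)), s)"
proof -
  obtain q where q: "q \<in> fst c" "x = snd c q" using assms(2) by blast
  have c: "c \<in> charts_at A q" using assms q by (simp add: charts_at_def)
  have inv: "chart_inv c x = q" using base.chart_inv_chart assms(1) q by simp
  have m: "((q, coord_vector A c v q), s) \<in> fst (xc c)"
    using q assms(3) base.coord_vector_in_tangent_space[OF c] by (simp add: mem_ext_chart)
  have "snd (xc c) ((q, coord_vector A c v q), s) = ((x, v), s)"
    by (simp add: snd_ext_chart base.coord_vector_chart[OF c] q)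
  then have "chart_inv (xc c) ((x, v), s) = ((q, coord_vector A c v q), s)"
    unfolding chart_inv_def using inv_into_f_f[OF inj_ext_chart[OF assms(1)] m] by simp
  then show ?thesis by (simp add: inv)
qed

lemma ext_transition:
  assumes c: "c \<in> A" and d: "d \<in> A" and x: "x \<in> snd c ` (fst c \<inter> fst d)" and "s \<in> {a..b}"
  shows "snd (xc d) (chart_inv (xc c) ((x, v), s)) =
    (((snd d \<circ> chart_inv c) x, frechet_derivative (snd d \<circ> chart_inv c) (at x) v), s)"
proof -
  obtain q where q: "q \<in> fst c" "q \<in> fst d" "x = snd c q" using x by blast
  have cd: "c \<in> charts_at A q" "d \<in> charts_at A q" using c d q by (simp_all add: charts_at_def)
  have inv: "chart_inv c x = q" using base.chart_inv_chart c q by simp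
  have "x \<in> snd c ` fst c" using x by blast
  then show ?thesis
    using coord_vector_transition[OF cd, of v] q assms(4)
    by (simp add: chart_inv_ext_chart[OF c] snd_ext_chart inv[unfolded q(3)])
qed

text \<open>The time coordinate runs over all reals here: the formula continues the transition
  smoothly beyond the times \<open>a\<close> and \<open>b\<close>, which settles its derivatives at
  the boundary.\<close>

lemma Cinf_on_ext_transition:
  assumes c: "c \<in> A" and d: "d \<in> A"
  shows "Cinf_on (\<lambda>z. (((snd d \<circ> chart_inv c) (fst (fst z)),
      frechet_derivative (snd d \<circ> chart_inv c) (at (fst (fst z))) (snd (fst z))), snd z))
    ((snd c ` (fst c \<inter> fst d) \<times> UNIV) \<times> (UNIV :: real set))"
proof -
  let ?O = "snd c ` (fst c \<inter> fst d)"
  have "open ((?O \<times> UNIV) \<times> (UNIV :: real set))"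
    using open_overlap[OF c d] by (intro open_Times) auto
  then show ?thesis
    by (intro Cinf_on_Pair Cinf_on_snd Cinf_on_id
        Cinf_on_compose[OF _ open_overlap[OF c d] _ Cinf_on_transition[OF c d]]
        Cinf_on_frechet_derivative_compose[OF _ open_overlap[OF c d] _ Cinf_on_transition[OF c d]]
        Cinf_on_fst) auto
qed

sublocale ext: diff_atlas "ext_model a b" TA
proof
  show "unique_derivatives (ext_model a b :: (('e \<times> 'e) \<times> real) set)"
    by (rule unique_derivatives_ext_model[OF a_less_b])
  fix e f assume "e \<in> TA"
  then obtain c where c: "c \<in> A" and e: "e = xc c" by (auto simp: ext_tangent_atlas_eq)
  show "inj_on (snd e) (fst e)" unfolding e by (rule inj_ext_chart[OF c])
  assume "f \<in> TA"
  then obtain d where d: "d \<in> A" and f: "f = xc d" by (auto simp: ext_tangent_atlas_eq)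
  let ?O = "snd c ` (fst c \<inter> fst d)"
  have im: "snd e ` (fst e \<inter> fst f) = (?O \<times> UNIV) \<times> {a..b}"
    unfolding e f by (rule ext_chart_image[OF c d])
  have op: "open ((?O \<times> UNIV) \<times> (UNIV :: real set))"
    using open_overlap[OF c d] by (intro open_Times) auto
  have "(?O \<times> UNIV) \<times> {a..b} = ext_model a b \<inter> (?O \<times> (UNIV :: 'e set)) \<times> (UNIV :: real set)"
    by (auto simp: ext_model_def)
  then show "openin (top_of_set (ext_model a b)) (snd e ` (fst e \<inter> fst f))"
    unfolding im using op openin_open_Int by metis
  fix p assume p: "p \<in> fst e" "p \<in> fst f"
  then have z: "snd e p \<in> (?O \<times> UNIV) \<times> {a..b}" using im by blast
  have eq: "(snd f \<circ> chart_inv e) y = (((snd d \<circ> chart_inv c) (fst (fst y)),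
      frechet_derivative (snd d \<circ> chart_inv c) (at (fst (fst y))) (snd (fst y))), snd y)"
    if "y \<in> (?O \<times> UNIV) \<times> {a..b}" for y
    using that ext_transition[OF c d, of "fst (fst y)" "snd y" "snd (fst y)"] by (auto simp: e f)
  have "snd e p \<in> (?O \<times> UNIV) \<times> (UNIV :: real set)" using z by auto
  note der = has_derivative_at_withinI[OF Cinf_on_has_derivative[OF Cinf_on_ext_transition[OF c d] this]]
  show "(snd f \<circ> chart_inv e) differentiable (at (snd e p) within snd e ` (fst e \<inter> fst f))"
    unfolding im differentiable_def by (rule exI, rule has_derivative_transform[OF z _ der], erule eq)
qed

lemma ext_charts_at:
  "m \<in> points TA \<Longrightarrow> c \<in> charts_at A (base_point m) \<Longrightarrow> xc c \<in> charts_at TA m"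
  by (simp add: charts_at_def mem_points_ext mem_ext_chart) (simp add: ext_tangent_atlas_eq)

lemma ext_charts_atE:
  assumes "e \<in> charts_at TA m"
  obtains c where "c \<in> charts_at A (base_point m)" "e = xc c" "m \<in> points TA"
proof -
  obtain c where "c \<in> A" "e = xc c" "m \<in> fst (xc c)"
    using assms by (auto simp: charts_at_def ext_tangent_atlas_eq)
  moreover from this have "base_point m \<in> points A"
    by (auto simp: mem_ext_chart points_def)
  ultimately show ?thesis
    by (intro that[of c]) (simp_all add: charts_at_def mem_ext_chart mem_points_ext)
qed

text \<open>Transfers the derivative of a coordinate expression \<open>f\<close> to the function
  \<open>F\<close> on the bundle. The expression has to match \<open>F\<close> on the chart image
  only and may be defined and differentiable beyond it.\<close>

lemma chart_has_derivative_ext: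
  assumes c: "c \<in> charts_at A (base_point m)" and m: "m \<in> points TA"
    and der: "(f has_derivative f') (at (snd (xc c) m) within (snd c ` fst c \<times> UNIV) \<times> {a..b})"
    and eq: "\<And>x v s. x \<in> snd c ` fst c \<Longrightarrow> s \<in> {a..b} \<Longrightarrow>
      F ((chart_inv c x, coord_vector A c v (chart_inv c x)), s) = f ((x, v), s)"
  shows "chart_differentiable (xc c) F m" "chart_derivative (xc c) F m = f'"
proof -
  have cA: "c \<in> A" using charts_atD[OF c] by simp
  have "snd (xc c) m \<in> (snd c ` fst c \<times> UNIV) \<times> {a..b}"
    using ext_chart_image_self[OF cA] charts_atD(2)[OF ext_charts_at[OF m c]] by blast
  then have "((F \<circ> chart_inv (xc c)) has_derivative f') (at (snd (xc c) m) within snd (xc c) ` fst (xc c))"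
    unfolding ext_chart_image_self[OF cA]
    by (rule has_derivative_transform[OF _ _ der]) (auto simp: chart_inv_ext_chart[OF cA] eq)
  then show "chart_differentiable (xc c) F m" "chart_derivative (xc c) F m = f'"
    using ext.chart_derivative_eq[OF ext_charts_at[OF m c]]
    by (auto simp: chart_differentiable_def differentiable_def)
qed

lemma chart_derivative_time_coord:
  assumes c: "c \<in> charts_at A (base_point m)" and m: "m \<in> points TA"
  shows "chart_differentiable (xc c) time_coord m" "chart_derivative (xc c) time_coord m = snd"
  by (rule chart_has_derivative_ext[OF c m bounded_linear_imp_has_derivative[OF bounded_linear_snd]], simp)+

lemma chart_derivative_base_point:
  assumes c: "c \<in> charts_at A (base_point m)" and d: "d \<in> charts_at A (base_point m)" and m: "m \<in> points TA"
  shows "chart_differentiable (xc c) (snd d \<circ> base_point) m"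
    "chart_derivative (xc c) (snd d \<circ> base_point) m = (\<lambda>V. chart_derivative c (snd d) (base_point m) (fst (fst V)))"
proof -
  have der: "((snd d \<circ> chart_inv c) has_derivative chart_derivative c (snd d) (base_point m))
      (at (fst (fst (snd (xc c) m))))"
    using chart_has_derivative[OF base.chart_differentiable_chart[OF c d]] at_within_chart[OF c]
    by (simp add: snd_ext_chart)
  have "bounded_linear (\<lambda>z :: ('e \<times> 'e) \<times> real. fst (fst z))"
    using bounded_linear_compose[OF bounded_linear_fst bounded_linear_fst] .
  from has_derivative_compose[OF bounded_linear_imp_has_derivative[OF this] der]
  have "((\<lambda>z. (snd d \<circ> chart_inv c) (fst (fst z))) has_derivative
      (\<lambda>V. chart_derivative c (snd d) (base_point m) (fst (fst V))))
      (at (snd (xc c) m) within (snd c ` fst c \<times> UNIV) \<times> {a..b})" .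
  from chart_has_derivative_ext[OF c m this]
  show "chart_differentiable (xc c) (snd d \<circ> base_point) m"
    "chart_derivative (xc c) (snd d \<circ> base_point) m = (\<lambda>V. chart_derivative c (snd d) (base_point m) (fst (fst V)))"
    by simp_all
qed

lemma tangent_map_base_point:
  assumes c: "c \<in> charts_at A (base_point m)" and m: "m \<in> points TA" and V: "V \<in> tangent_space TA m"
  shows "tangent_map TA A base_point m V = coord_vector A c (fst (fst (V (xc c)))) (base_point m)"
proof
  fix d
  show "tangent_map TA A base_point m V d = coord_vector A c (fst (fst (V (xc c)))) (base_point m) d"
  proof (cases "d \<in> charts_at A (base_point m)")
    case True
    show ?thesis
      using ext.differential_eq[OF V ext_charts_at[OF m c] chart_derivative_base_point(1)[OF c True m]]
      by (simp add: chart_derivative_base_point(2)[OF c True m] tangent_map_def coord_vector_def True)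
  qed (simp add: tangent_map_def coord_vector_def)
qed

lemma ds_form_eq:
  assumes c: "c \<in> charts_at A (base_point m)" and m: "m \<in> points TA" and V: "V \<in> tangent_space TA m"
  shows "ds_form A a b m V = snd (V (xc c))"
  unfolding ds_form_def
  unfolding ext.differential_eq[OF V ext_charts_at[OF m c] chart_derivative_time_coord(1)[OF c m]]
    chart_derivative_time_coord(2)[OF c m] ..

end

section \<open>Left-invariant frames\<close>

lemma sum_fun_apply: "(\<Sum>i\<in>I. f i) x = (\<Sum>i\<in>I. f i x)"
  for f :: "'i \<Rightarrow> 'a \<Rightarrow> 'b::comm_monoid_add"
  by (induction I rule: infinite_finite_induct) auto

context lie_group
begin

sublocale boundaryless_atlas A
  using manifold by unfold_locales (simp add: smooth_manifold_def)

lemma charts_at_carrier: "c \<in> charts_at A q \<Longrightarrow> q \<in> carrier G"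
  using points_carrier by (auto simp: charts_at_def points_def)

lemma chart_at_carrier:
  assumes "q \<in> carrier G"
  obtains c where "c \<in> charts_at A q"
  using some_chart[of q A] points_carrier assms by blast

text \<open>Smoothness jointly in both factors is the point: it lets the derivative of a left
  translation at the identity depend smoothly on the translating element.\<close>

lemma mult_in_charts:
  assumes c: "c \<in> A" and d: "d \<in> A" and e: "e \<in> A"
  defines "W \<equiv> {(x, y). x \<in> snd c ` fst c \<and> y \<in> snd d ` fst d \<and> chart_inv c x \<otimes> chart_inv d y \<in> fst e}"
  shows "open W" "Cinf_on (\<lambda>z. snd e (chart_inv c (fst z) \<otimes> chart_inv d (snd z))) W"
proof -
  define k where "k = (fst c \<times> fst d, map_prod (snd c) (snd d))"
  let ?m = "\<lambda>(x, y). x \<otimes> y"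
  have k: "k \<in> prod_atlas A A"
    unfolding prod_atlas_def k_def using c d by (intro image_eqI[of _ _ "(c, d)"]) simp_all
  have inv: "chart_inv k (snd c q, snd d p) = (q, p)" if "q \<in> fst c" "p \<in> fst d" for q p
  proof -
    have "inj_on (snd k) (fst k)"
      using base.inj_chart[OF c] base.inj_chart[OF d] by (simp add: k_def map_prod_inj_on)
    from inv_into_f_f[OF this, of "(q, p)"] show ?thesis
      using that by (simp add: chart_inv_def k_def)
  qed
  have invs: "chart_inv c (snd c q) = q" "chart_inv d (snd d p) = p" if "q \<in> fst c" "p \<in> fst d" for q p
    using base.chart_inv_chart c d that by simp_all
  have W: "snd k ` (fst k \<inter> ?m -` fst e) = W"
  proof (intro Set.set_eqI iffI)
    fix z assume "z \<in> snd k ` (fst k \<inter> ?m -` fst e)"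
    then obtain q p where "q \<in> fst c" "p \<in> fst d" "q \<otimes> p \<in> fst e" "z = (snd c q, snd d p)"
      by (auto simp: k_def)
    then show "z \<in> W" by (simp add: W_def invs)
  next
    fix z assume "z \<in> W"
    then obtain q p where "q \<in> fst c" "p \<in> fst d" "z = (snd c q, snd d p)"
      "chart_inv c (snd c q) \<otimes> chart_inv d (snd d p) \<in> fst e"
      by (auto simp: W_def)
    then show "z \<in> snd k ` (fst k \<inter> ?m -` fst e)"
      by (intro image_eqI[of _ _ "(q, p)"]) (simp_all add: k_def invs)
  qed
  have sm: "openin (top_of_set UNIV) W" "smooth_on W (snd e \<circ> ?m \<circ> chart_inv k)"
    using smooth_mult k e unfolding smooth_map_def W[symmetric] by blast+
  then show "open W" by simp
  show "Cinf_on (\<lambda>z. snd e (chart_inv c (fst z) \<otimes> chart_inv d (snd z))) W"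
  proof (rule Cinf_on_cong[OF smooth_on_imp_Cinf_on[OF sm(2) \<open>open W\<close>] \<open>open W\<close>])
    fix z assume "z \<in> W"
    then obtain q p where "q \<in> fst c" "p \<in> fst d" "z = (snd c q, snd d p)"
      by (auto simp: W_def)
    then show "(snd e \<circ> ?m \<circ> chart_inv k) z = snd e (chart_inv c (fst z) \<otimes> chart_inv d (snd z))"
      by (simp add: inv invs)
  qed
qed

text \<open>Left translation is the multiplication with its first slot frozen, so its derivative is
  a partial derivative in the second slot.\<close>

lemma left_translation_in_charts:
  assumes q: "e \<in> charts_at A q" and c: "c \<in> charts_at A p" and d: "d \<in> charts_at A (q \<otimes> p)"
  defines "F \<equiv> \<lambda>z. snd d (chart_inv e (fst z) \<otimes> chart_inv c (snd z))"
  shows "((snd d \<circ> (\<lambda>x. q \<otimes> x) \<circ> chart_inv c) has_derivative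
      (\<lambda>v. frechet_derivative F (at (snd e q, snd c p)) (0, v))) (at (snd c p))"
    and "open {y \<in> snd c ` fst c. q \<otimes> chart_inv c y \<in> fst d}"
proof -
  note mem = charts_atD[OF q] charts_atD[OF c] charts_atD[OF d]
  have inv: "chart_inv e (snd e q) = q" "chart_inv c (snd c p) = p"
    using base.chart_inv_chart mem by simp_all
  let ?W = "{(x, y). x \<in> snd e ` fst e \<and> y \<in> snd c ` fst c \<and> chart_inv e x \<otimes> chart_inv c y \<in> fst d}"
  have W: "open ?W" "Cinf_on F ?W"
    unfolding F_def using mult_in_charts mem by simp_all
  have "(snd e q, snd c p) \<in> ?W" using mem inv by simp
  from Cinf_on_has_derivative[OF W(2) this]
  have "((\<lambda>y. F (snd e q, y)) has_derivative
      (\<lambda>v. frechet_derivative F (at (snd e q, snd c p)) (0, v))) (at (snd c p))"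
    by (rule has_derivative_compose[OF has_derivative_Pair[OF has_derivative_const has_derivative_ident]])
  moreover have "(\<lambda>y. F (snd e q, y)) = snd d \<circ> (\<lambda>x. q \<otimes> x) \<circ> chart_inv c"
    by (rule ext) (simp add: F_def inv)
  ultimately show "((snd d \<circ> (\<lambda>x. q \<otimes> x) \<circ> chart_inv c) has_derivative
      (\<lambda>v. frechet_derivative F (at (snd e q, snd c p)) (0, v))) (at (snd c p))"
    by simp
  have eq: "{y \<in> snd c ` fst c. q \<otimes> chart_inv c y \<in> fst d} = (\<lambda>y. (snd e q, y)) -` ?W"
    using mem inv by auto
  show "open {y \<in> snd c ` fst c. q \<otimes> chart_inv c y \<in> fst d}"
    unfolding eq by (rule open_vimage[OF W(1)]) (intro continuous_intros)
qed

lemma chart_derivative_left_translation: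
  assumes q: "e \<in> charts_at A q" and c: "c \<in> charts_at A p" and d: "d \<in> charts_at A (q \<otimes> p)"
  shows "chart_differentiable c (snd d \<circ> (\<lambda>x. q \<otimes> x)) p"
    and "chart_derivative c (snd d \<circ> (\<lambda>x. q \<otimes> x)) p =
      (\<lambda>v. frechet_derivative (\<lambda>z. snd d (chart_inv e (fst z) \<otimes> chart_inv c (snd z)))
        (at (snd e q, snd c p)) (0, v))"
proof -
  note der = has_derivative_at_withinI[OF left_translation_in_charts(1)[OF q c d]]
  show "chart_differentiable c (snd d \<circ> (\<lambda>x. q \<otimes> x)) p"
    unfolding chart_differentiable_def differentiable_def by (rule exI, rule der)
  show "chart_derivative c (snd d \<circ> (\<lambda>x. q \<otimes> x)) p =
      (\<lambda>v. frechet_derivative (\<lambda>z. snd d (chart_inv e (fst z) \<otimes> chart_inv c (snd z)))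
        (at (snd e q, snd c p)) (0, v))"
    by (rule base.chart_derivative_eq[OF c der])
qed

lemma left_translation_chain:
  assumes q: "q \<in> carrier G" and c: "c \<in> charts_at A p" and d: "d \<in> charts_at A (q \<otimes> p)"
    and F: "chart_differentiable d F (q \<otimes> p)"
  shows "chart_differentiable c (F \<circ> (\<lambda>x. q \<otimes> x)) p"
    and "chart_derivative c (F \<circ> (\<lambda>x. q \<otimes> x)) p =
      chart_derivative d F (q \<otimes> p) \<circ> chart_derivative c (snd d \<circ> (\<lambda>x. q \<otimes> x)) p"
proof -
  obtain e where e: "e \<in> charts_at A q" by (rule chart_at_carrier[OF q])
  let ?f = "snd d \<circ> (\<lambda>x. q \<otimes> x) \<circ> chart_inv c"
  have inv: "chart_inv d (snd d r) = r" if "r \<in> fst d" for r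
    using base.chart_inv_chart charts_atD[OF d] that by simp
  have p: "chart_inv c (snd c p) = p"
    using base.chart_inv_chart charts_atD[OF c] by simp
  have f: "(?f has_derivative chart_derivative c (snd d \<circ> (\<lambda>x. q \<otimes> x)) p) (at (snd c p))"
    using left_translation_in_charts(1)[OF e c d] unfolding chart_derivative_left_translation(2)[OF e c d] .
  have fp: "?f (snd c p) = snd d (q \<otimes> p)" by (simp add: p)
  have "((F \<circ> chart_inv d) has_derivative chart_derivative d F (q \<otimes> p)) (at (?f (snd c p)))"
    unfolding fp using chart_has_derivative[OF F] at_within_chart[OF d] by simp
  from diff_chain_at[OF f this]
  have "((F \<circ> (\<lambda>x. q \<otimes> x) \<circ> chart_inv c) has_derivative
      chart_derivative d F (q \<otimes> p) \<circ> chart_derivative c (snd d \<circ> (\<lambda>x. q \<otimes> x)) p) (at (snd c p))"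
  proof (rule has_derivative_transform_within_open[OF _ left_translation_in_charts(2)[OF e c d]])
    show "snd c p \<in> {y \<in> snd c ` fst c. q \<otimes> chart_inv c y \<in> fst d}"
      using charts_atD[OF c] charts_atD[OF d] by (simp add: p)
    show "((F \<circ> chart_inv d) \<circ> ?f) y = (F \<circ> (\<lambda>x. q \<otimes> x) \<circ> chart_inv c) y"
      if "y \<in> {y \<in> snd c ` fst c. q \<otimes> chart_inv c y \<in> fst d}" for y
      using that by (simp add: inv)
  qed
  note der = has_derivative_at_withinI[OF this]
  show "chart_derivative c (F \<circ> (\<lambda>x. q \<otimes> x)) p =
      chart_derivative d F (q \<otimes> p) \<circ> chart_derivative c (snd d \<circ> (\<lambda>x. q \<otimes> x)) p"
    by (rule base.chart_derivative_eq[OF c der])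
  show "chart_differentiable c (F \<circ> (\<lambda>x. q \<otimes> x)) p"
    unfolding chart_differentiable_def differentiable_def by (rule exI, rule der)
qed

text \<open>The derivative of the translation by \<open>inv q\<close> is a left inverse, by the
  chain rule applied to the composite, which is the identity.\<close>

lemma inj_left_translation_derivative:
  assumes q: "q \<in> carrier G" and c: "c \<in> charts_at A \<one>" and d: "d \<in> charts_at A q"
  shows "inj (chart_derivative c (snd d \<circ> (\<lambda>x. q \<otimes> x)) \<one>)"
proof -
  have d': "d \<in> charts_at A (q \<otimes> \<one>)" using d q by simp
  have c': "c \<in> charts_at A (inv q \<otimes> q)" using c q by simp
  obtain e where e: "e \<in> charts_at A (inv q)" by (rule chart_at_carrier[OF inv_closed[OF q]])
  let ?F = "snd c \<circ> (\<lambda>x. inv q \<otimes> x)"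
  have F: "chart_differentiable d ?F (q \<otimes> \<one>)"
    using chart_derivative_left_translation(1)[OF e d c'] q by simp
  have "chart_derivative c (?F \<circ> (\<lambda>x. q \<otimes> x)) \<one> = chart_derivative c (snd c) \<one>"
  proof (rule base.chart_derivative_cong[OF c base.chart_differentiable_chart[OF c c]])
    fix x assume "x \<in> fst c"
    then have "x \<in> carrier G"
      using charts_atD(1)[OF c] by (intro charts_at_carrier[of c]) (simp add: charts_at_def)
    then show "snd c x = (?F \<circ> (\<lambda>x. q \<otimes> x)) x"
      using q by (simp add: m_assoc[symmetric])
  qed
  then have "chart_derivative d ?F (q \<otimes> \<one>) \<circ> chart_derivative c (snd d \<circ> (\<lambda>x. q \<otimes> x)) \<one> = id"
    using left_translation_chain(2)[OF q c d' F] base.chart_derivative_self[OF c] by simp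
  then have "inj (chart_derivative d ?F (q \<otimes> \<one>) \<circ> chart_derivative c (snd d \<circ> (\<lambda>x. q \<otimes> x)) \<one>)"
    by (simp only: inj_on_id)
  then show ?thesis by (rule inj_on_imageI2)
qed

end

text \<open>One index type serves the coordinates of the model space and the basis vectors, so that
  the frame has a square coefficient matrix in each chart and determinants apply.\<close>

locale framed_lie_group = lie_group G A
  for G :: "('q, 'x) monoid_scheme" (structure) and A :: "('q, real ^ 'n) chart set" +
  fixes \<epsilon> :: "'n::finite \<Rightarrow> ('q, real ^ 'n) tvec"
  assumes tangent_basis: "tangent_basis A \<one> \<epsilon>"
begin

abbreviation frame where "frame \<equiv> left_frame G A \<epsilon>"
abbreviation coframe where "coframe \<equiv> left_coframe G A \<epsilon>"

lemma basis_in_tangent_space: "\<epsilon> i \<in> tangent_space A \<one>"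
  using tangent_basis span_superset[of "range \<epsilon>"] unfolding tangent_basis_def by auto

lemma frame_in_charts:
  assumes c: "c \<in> charts_at A \<one>" and d: "d \<in> charts_at A q"
  shows "frame i q d = chart_derivative c (snd d \<circ> (\<lambda>x. q \<otimes> x)) \<one> (\<epsilon> i c)"
proof -
  have "d \<in> charts_at A (q \<otimes> \<one>)" using d charts_at_carrier[OF d] by simp
  from base.differential_eq[OF basis_in_tangent_space c chart_derivative_left_translation(1)[OF d c this]]
  show ?thesis
    using \<open>d \<in> charts_at A (q \<otimes> \<one>)\<close> by (simp add: left_frame_def tangent_map_def)
qed

lemma frame_in_tangent_space:
  assumes q: "q \<in> carrier G"
  shows "frame i q \<in> tangent_space A q"
proof (rule base.tangent_spaceI)
  obtain c where c: "c \<in> charts_at A \<one>" by (rule chart_at_carrier[OF one_closed])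
  show "frame i q d = 0" if "d \<notin> charts_at A q" for d
    using that q by (simp add: left_frame_def tangent_map_def)
  fix d e assume d: "d \<in> charts_at A q" and e: "e \<in> charts_at A q"
  have d': "d \<in> charts_at A (q \<otimes> \<one>)" and e': "e \<in> charts_at A (q \<otimes> \<one>)" using d e q by simp_all
  show "frame i q e = chart_derivative d (snd e) q (frame i q d)"
    unfolding frame_in_charts[OF c d] frame_in_charts[OF c e]
    using left_translation_chain(2)[OF q c d' base.chart_differentiable_chart[OF d' e']] q by simp
qed

text \<open>In coordinates the frame vector at q is the partial derivative of the multiplication at
  (q, 1) in the fixed direction \<open>\<epsilon> i\<close>, hence smooth in q.\<close>

lemma Cinf_on_frame:
  assumes d: "d \<in> A"
  shows "Cinf_on (\<lambda>x. frame i (chart_inv d x) d) (snd d ` fst d)"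
proof -
  obtain c where c: "c \<in> charts_at A \<one>" by (rule chart_at_carrier[OF one_closed])
  let ?F = "\<lambda>z. snd d (chart_inv d (fst z) \<otimes> chart_inv c (snd z))"
  let ?W = "{(x, y). x \<in> snd d ` fst d \<and> y \<in> snd c ` fst c \<and> chart_inv d x \<otimes> chart_inv c y \<in> fst d}"
  have W: "open ?W" "Cinf_on ?F ?W"
    using mult_in_charts[OF d charts_atD(1)[OF c] d] by simp_all
  have inv: "chart_inv c (snd c \<one>) = \<one>"
    using base.chart_inv_chart charts_atD[OF c] by simp
  have chart: "d \<in> charts_at A (chart_inv d x)" "snd d (chart_inv d x) = x" if "x \<in> snd d ` fst d" for x
  proof -
    obtain q where "q \<in> fst d" "x = snd d q" using \<open>x \<in> snd d ` fst d\<close> by blast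
    then show "d \<in> charts_at A (chart_inv d x)" "snd d (chart_inv d x) = x"
      using base.chart_inv_chart[OF d] d by (simp_all add: charts_at_def)
  qed
  have "Cinf_on (\<lambda>x. frechet_derivative ?F (at (x, snd c \<one>)) (0, \<epsilon> i c)) (snd d ` fst d)"
  proof (rule Cinf_on_frechet_derivative_compose[OF open_chart_image[OF d] W(1) _ W(2)])
    show "(\<lambda>x. (x, snd c \<one>)) ` snd d ` fst d \<subseteq> ?W"
    proof
      fix z assume "z \<in> (\<lambda>x. (x, snd c \<one>)) ` snd d ` fst d"
      then obtain x where x: "x \<in> snd d ` fst d" "z = (x, snd c \<one>)" by blast
      have "chart_inv d x \<in> carrier G" by (rule charts_at_carrier[OF chart(1)[OF x(1)]])
      then show "z \<in> ?W"
        using x charts_atD[OF c] charts_atD[OF chart(1)[OF x(1)]] inv by simp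
    qed
  qed (intro Cinf_on_Pair Cinf_on_id Cinf_on_const open_chart_image d)+
  then show ?thesis
  proof (rule Cinf_on_cong[OF _ open_chart_image[OF d]])
    fix x assume x: "x \<in> snd d ` fst d"
    have "chart_inv d x \<in> carrier G" by (rule charts_at_carrier[OF chart(1)[OF x]])
    then have d': "d \<in> charts_at A (chart_inv d x \<otimes> \<one>)" using chart(1)[OF x] by simp
    show "frechet_derivative ?F (at (x, snd c \<one>)) (0, \<epsilon> i c) = frame i (chart_inv d x) d"
      unfolding frame_in_charts[OF c chart(1)[OF x]]
        chart_derivative_left_translation(2)[OF chart(1)[OF x] c d'] chart(2)[OF x] ..
  qed
qed

text \<open>The frame at q is the image of the given basis under an injective linear map, the
  derivative of the left translation.\<close>

lemma frame_independent:
  assumes d: "d \<in> charts_at A q" and 0: "(\<Sum>i\<in>UNIV. r i *\<^sub>R frame i q d) = 0"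
  shows "r i = 0"
proof -
  obtain c where c: "c \<in> charts_at A \<one>" by (rule chart_at_carrier[OF one_closed])
  have q: "q \<in> carrier G" by (rule charts_at_carrier[OF d])
  let ?D = "chart_derivative c (snd d \<circ> (\<lambda>x. q \<otimes> x)) \<one>"
  have d': "d \<in> charts_at A (q \<otimes> \<one>)" using d q by simp
  have lin: "linear ?D"
    by (rule chart_derivative_linear[OF chart_derivative_left_translation(1)[OF d c d']])
  have "?D (\<Sum>i\<in>UNIV. r i *\<^sub>R \<epsilon> i c) = ?D 0"
    using 0 by (simp add: linear_sum[OF lin] linear_scale[OF lin] linear_0[OF lin] frame_in_charts[OF c d])
  then have "(\<Sum>i\<in>UNIV. r i *\<^sub>R \<epsilon> i c) = 0"
    by (rule injD[OF inj_left_translation_derivative[OF q c d]])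
  then have "(\<Sum>i\<in>UNIV. r i *\<^sub>R \<epsilon> i) = 0"
    by (intro base.tangent_space_eqI[OF _ _ c] subspace_sum[OF base.subspace_tangent_space]
        subspace_scale[OF base.subspace_tangent_space] subspace_0[OF base.subspace_tangent_space]
        basis_in_tangent_space) (simp add: sum_fun_apply scaleR_fun_def)
  moreover have inj: "inj \<epsilon>" and ind: "independent (range \<epsilon>)"
    using tangent_basis by (simp_all add: tangent_basis_def)
  \<comment> \<open>Linear dependence is formulated for sets of vectors; injectivity of \<epsilon>
    turns the indexed coefficients into coefficients on the range.\<close>
  have "(\<Sum>v\<in>range \<epsilon>. r (inv_into UNIV \<epsilon> v) *\<^sub>R v) = (\<Sum>i\<in>UNIV. r i *\<^sub>R \<epsilon> i)"
    using inj by (simp add: sum.reindex)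
  ultimately have 0: "(\<Sum>v\<in>range \<epsilon>. r (inv_into UNIV \<epsilon> v) *\<^sub>R v) = 0" by simp
  show ?thesis
  proof (rule ccontr)
    assume "r i \<noteq> 0"
    then have "r (inv_into UNIV \<epsilon> (\<epsilon> i)) \<noteq> 0" using inj by simp
    with 0 have "dependent (range \<epsilon>)"
      unfolding dependent_finite[OF finite_imageI[OF finite_class.finite_UNIV]]
      by (intro exI[of _ "\<lambda>v. r (inv_into UNIV \<epsilon> v)"] conjI bexI[of _ "\<epsilon> i"]) simp_all
    then show False using ind by simp
  qed
qed

section \<open>Duality of frame and coframe\<close>

definition frame_matrix :: "('q, real ^ 'n) chart \<Rightarrow> 'q \<Rightarrow> real ^ 'n ^ 'n" where
  "frame_matrix d q = (\<chi> k i. frame i q d $ k)"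

lemma frame_matrix_mult: "frame_matrix d q *v r = (\<Sum>i\<in>UNIV. r $ i *\<^sub>R frame i q d)"
  by (simp add: vec_eq_iff frame_matrix_def matrix_vector_mult_def mult.commute)

lemma inj_frame_matrix:
  assumes "d \<in> charts_at A q"
  shows "inj ((*v) (frame_matrix d q))"
proof (rule linear_injective_0[THEN iffD2, OF matrix_vector_mul_linear], intro allI impI)
  fix r assume "frame_matrix d q *v r = 0"
  then have "(\<Sum>i\<in>UNIV. r $ i *\<^sub>R frame i q d) = 0"
    by (simp only: frame_matrix_mult)
  from frame_independent[OF assms this] show "r = 0" by (simp add: vec_eq_iff)
qed

lemma det_frame_matrix: "d \<in> charts_at A q \<Longrightarrow> det (frame_matrix d q) \<noteq> 0"
  unfolding invertible_det_nz[symmetric] invertible_left_inverse matrix_left_invertible_injective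
  by (rule inj_frame_matrix)

text \<open>\<open>representation\<close> yields the expected coefficients only for an independent
  set, and distinct indices must give distinct vectors. Both follow from the injectivity of the
  frame matrix.\<close>

lemma coframe_frame:
  assumes q: "q \<in> carrier G"
  shows "coframe i q (\<Sum>j\<in>UNIV. u j *\<^sub>R frame j q) = u i"
proof -
  obtain d where d: "d \<in> charts_at A q" by (rule chart_at_carrier[OF q])
  let ?fr = "\<lambda>j. frame j q"
  have inj: "inj ?fr"
  proof (rule injI)
    fix j k assume "?fr j = ?fr k"
    then have "frame_matrix d q *v axis j 1 = frame_matrix d q *v axis k 1"
      by (simp add: matrix_vector_mult_basis column_def frame_matrix_def)
    then have "axis j (1 :: real) = axis k 1"
      by (rule injD[OF inj_frame_matrix[OF d]])
    then show "j = k" by (simp add: axis_eq_axis)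
  qed
  have ind: "independent (range ?fr)"
  proof
    assume "dependent (range ?fr)"
    then obtain w v where v: "v \<in> range ?fr" "w v \<noteq> 0" and 0: "(\<Sum>v\<in>range ?fr. w v *\<^sub>R v) = 0"
      using dependent_finite[of "range ?fr"] by auto
    have "(\<Sum>j\<in>UNIV. w (?fr j) *\<^sub>R ?fr j) = 0"
      using 0 inj by (simp add: sum.reindex o_def)
    then have "(\<Sum>j\<in>UNIV. w (?fr j) *\<^sub>R ?fr j) d = 0" by simp
    then have "(\<Sum>j\<in>UNIV. w (?fr j) *\<^sub>R ?fr j d) = 0"
      by (simp add: sum_fun_apply scaleR_fun_def)
    from frame_independent[OF d this] v show False by auto
  qed
  have span: "u j *\<^sub>R ?fr j \<in> span (range ?fr)" for j
    by (intro span_scale span_base) simp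
  have "coframe i q (\<Sum>j\<in>UNIV. u j *\<^sub>R ?fr j) =
      (\<Sum>j\<in>UNIV. representation (range ?fr) (u j *\<^sub>R ?fr j) (?fr i))"
    unfolding left_coframe_def by (subst representation_sum[OF ind]) (simp_all only: span)
  also have "\<dots> = (\<Sum>j\<in>UNIV. if i = j then u j else 0)"
  proof (rule sum.cong[OF refl])
    fix j
    have "(?fr i = ?fr j) = (i = j)" using inj_eq[OF inj, of i j] by simp
    then show "representation (range ?fr) (u j *\<^sub>R ?fr j) (?fr i) = (if i = j then u j else 0)"
      by (simp add: representation_scale[OF ind span_base] representation_basis[OF ind])
  qed
  also have "\<dots> = u i" by simp
  finally show ?thesis .
qed

lemma frame_expansion:
  assumes q: "q \<in> carrier G" and X: "X \<in> tangent_space A q"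
  shows "X = (\<Sum>j\<in>UNIV. coframe j q X *\<^sub>R frame j q)"
proof -
  obtain d where d: "d \<in> charts_at A q" by (rule chart_at_carrier[OF q])
  have "invertible (frame_matrix d q)"
    using det_frame_matrix[OF d] invertible_det_nz by blast
  then obtain N where "frame_matrix d q ** N = mat 1" by (auto simp: invertible_def)
  then have "frame_matrix d q *v (N *v X d) = X d"
    by (simp add: matrix_vector_mul_assoc)
  then obtain u where "(\<Sum>j\<in>UNIV. u $ j *\<^sub>R frame j q d) = X d"
    unfolding frame_matrix_mult by blast
  then have Xu: "X = (\<Sum>j\<in>UNIV. u $ j *\<^sub>R frame j q)"
    by (intro base.tangent_space_eqI[OF X _ d] subspace_sum[OF base.subspace_tangent_space]
        subspace_scale[OF base.subspace_tangent_space] frame_in_tangent_space q)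
      (simp add: sum_fun_apply scaleR_fun_def)
  have "coframe j q X = u $ j" for j
    by (subst Xu) (rule coframe_frame[OF q])
  then show ?thesis
    by (simp only:) (rule Xu)
qed

lemma frame_expansion_chart:
  assumes d: "d \<in> charts_at A q" and X: "X \<in> tangent_space A q"
  shows "X d = (\<Sum>j\<in>UNIV. coframe j q X *\<^sub>R frame j q d)"
  using arg_cong[OF frame_expansion[OF charts_at_carrier[OF d] X], of "\<lambda>Y. Y d"]
  by (simp add: sum_fun_apply scaleR_fun_def)

text \<open>Stated on tangent vectors because \<open>representation\<close> is 0 outside the span of
  the frame, so the coframe need not be linear on the ambient function space.\<close>

lemma coframe_linear:
  assumes q: "q \<in> carrier G" and X: "X \<in> tangent_space A q" and Y: "Y \<in> tangent_space A q"
  shows "coframe i q (r *\<^sub>R X + s *\<^sub>R Y) = r * coframe i q X + s * coframe i q Y"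
proof -
  have "r *\<^sub>R X + s *\<^sub>R Y = (\<Sum>j\<in>UNIV. (r * coframe j q X + s * coframe j q Y) *\<^sub>R frame j q)"
    by (subst (1) frame_expansion[OF q X], subst (1) frame_expansion[OF q Y])
      (simp add: scaleR_sum_right sum.distrib scaleR_add_left)
  then show ?thesis by (simp only: coframe_frame[OF q])
qed

text \<open>The coordinate expression of \<beta>: \<open>x\<close> is the coordinate of the point
  and \<open>v\<close> that of the vector.\<close>

definition coframe_chart :: "('q, real ^ 'n) chart \<Rightarrow> 'n \<Rightarrow> real ^ 'n \<Rightarrow> real ^ 'n \<Rightarrow> real" where
  "coframe_chart d i x v = coframe i (chart_inv d x) (coord_vector A d v (chart_inv d x))"

lemma chart_at_image:
  assumes "d \<in> A" "x \<in> snd d ` fst d"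
  shows "d \<in> charts_at A (chart_inv d x)" "snd d (chart_inv d x) = x"
proof -
  obtain q where "q \<in> fst d" "x = snd d q" using assms(2) by blast
  then show "d \<in> charts_at A (chart_inv d x)" "snd d (chart_inv d x) = x"
    using base.chart_inv_chart[OF assms(1)] assms(1) by (simp_all add: charts_at_def)
qed

lemma coframe_chart_eq:
  assumes d: "d \<in> charts_at A q" and X: "X \<in> tangent_space A q"
  shows "coframe_chart d i (snd d q) (X d) = coframe i q X"
  using base.chart_inv_chart[OF charts_atD[OF d]] base.coord_vector_eq[OF X d]
  by (simp add: coframe_chart_def)

lemma linear_coframe_chart:
  assumes "d \<in> A" "x \<in> snd d ` fst d"
  shows "linear (coframe_chart d i x)"
proof -
  note d = chart_at_image(1)[OF assms]
  note lin = base.linear_coord_vector[OF d]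
  note T = base.coord_vector_in_tangent_space[OF d]
  show ?thesis
    using coframe_linear[OF charts_at_carrier[OF d] T T, of i 1 _ 1]
      coframe_linear[OF charts_at_carrier[OF d] T T, of i _ _ 0]
    by (intro linearI) (simp_all add: coframe_chart_def linear_add[OF lin] linear_scale[OF lin])
qed

lemma coframe_chart_frame:
  assumes "d \<in> A" "x \<in> snd d ` fst d"
  shows "(\<Sum>j\<in>UNIV. coframe_chart d j x v *\<^sub>R frame j (chart_inv d x) d) = v"
    and "coframe_chart d i x (\<Sum>j\<in>UNIV. u j *\<^sub>R frame j (chart_inv d x) d) = u i"
proof -
  note d = chart_at_image(1)[OF assms]
  show "(\<Sum>j\<in>UNIV. coframe_chart d j x v *\<^sub>R frame j (chart_inv d x) d) = v"
    using frame_expansion_chart[OF d base.coord_vector_in_tangent_space[OF d], of v]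
    by (simp add: coframe_chart_def base.coord_vector_chart[OF d])
  have q: "chart_inv d x \<in> carrier G" by (rule charts_at_carrier[OF d])
  let ?X = "\<Sum>j\<in>UNIV. u j *\<^sub>R frame j (chart_inv d x)"
  have "?X \<in> tangent_space A (chart_inv d x)"
    by (intro subspace_sum[OF base.subspace_tangent_space] subspace_scale[OF base.subspace_tangent_space]
        frame_in_tangent_space q)
  note coframe_chart_eq[OF d this, of i, unfolded chart_at_image(2)[OF assms] coframe_frame[OF q]]
  moreover have "?X d = (\<Sum>j\<in>UNIV. u j *\<^sub>R frame j (chart_inv d x) d)"
    by (simp add: sum_fun_apply scaleR_fun_def)
  ultimately show "coframe_chart d i x (\<Sum>j\<in>UNIV. u j *\<^sub>R frame j (chart_inv d x) d) = u i"
    by (simp only:)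
qed

text \<open>The coframe values solve a linear system whose matrix consists of the smooth components
  of the frame and has nonzero determinant.\<close>

lemma Cinf_on_coframe_chart:
  assumes d: "d \<in> A"
  shows "Cinf_on (\<lambda>x. coframe_chart d i x v) (snd d ` fst d)"
proof -
  have "Cinf_on (\<lambda>x. \<chi> j. coframe_chart d j x v) (snd d ` fst d)"
  proof (rule Cinf_on_linear_solution[OF open_chart_image[OF d],
        where M = "\<lambda>k j x. frame j (chart_inv d x) d $ k" and r = "\<lambda>k x. v $ k"])
    show "Cinf_on (\<lambda>x. frame j (chart_inv d x) d $ k) (snd d ` fst d)" for k j
      by (intro Cinf_on_nth open_chart_image Cinf_on_frame d)
    show "Cinf_on (\<lambda>x. v $ k) (snd d ` fst d)" for k by (rule Cinf_on_const)
    fix x assume x: "x \<in> snd d ` fst d"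
    show "det (\<chi> k j. frame j (chart_inv d x) d $ k) \<noteq> 0"
      using det_frame_matrix[OF chart_at_image(1)[OF d x]] by (simp add: frame_matrix_def)
    have "frame_matrix d (chart_inv d x) *v (\<chi> j. coframe_chart d j x v) = v"
      using coframe_chart_frame(1)[OF d x, of v] by (simp add: frame_matrix_mult)
    then show "(\<chi> k j. frame j (chart_inv d x) d $ k) *v (\<chi> j. coframe_chart d j x v) = (\<chi> k. v $ k)"
      by (simp add: frame_matrix_def)
  qed
  from Cinf_on_nth[OF open_chart_image[OF d] this, of i] show ?thesis by simp
qed

end

section \<open>The frame of the extended tangent bundle\<close>

context framed_lie_group
begin

text \<open>The first vector argument is fed into the form and held constant, the second is the
  direction of differentiation. Hence d\<beta>(V, W) is the value at (W, V) minus the value at (V,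
  W).\<close>

definition coframe_deriv :: "('q, real ^ 'n) chart \<Rightarrow> 'n \<Rightarrow> real ^ 'n \<Rightarrow> real ^ 'n \<Rightarrow> real ^ 'n \<Rightarrow> real" where
  "coframe_deriv d i x v = frechet_derivative (\<lambda>x. coframe_chart d i x v) (at x)"

lemma coframe_chart_has_derivative:
  assumes "d \<in> A" "x \<in> snd d ` fst d"
  shows "((\<lambda>x. coframe_chart d i x v) has_derivative coframe_deriv d i x v) (at x)"
  unfolding coframe_deriv_def by (rule Cinf_on_has_derivative[OF Cinf_on_coframe_chart[OF assms(1)] assms(2)])

lemma coframe_chart_expand:
  assumes "d \<in> A" "x \<in> snd d ` fst d"
  shows "coframe_chart d i x v = (\<Sum>k\<in>UNIV. v $ k * coframe_chart d i x (axis k 1))"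
proof -
  note lin = linear_coframe_chart[OF assms, of i]
  have "coframe_chart d i x (\<Sum>k\<in>UNIV. v $ k *\<^sub>R axis k 1) = (\<Sum>k\<in>UNIV. v $ k * coframe_chart d i x (axis k 1))"
    by (simp add: linear_sum[OF lin] linear_scale[OF lin] o_def)
  moreover have "(\<Sum>k\<in>UNIV. v $ k *\<^sub>R (axis k 1 :: real ^ 'n)) = v"
    using basis_expansion[of v] by (simp only: scalar_mult_eq_scaleR)
  ultimately show ?thesis by (simp only:)
qed

lemma coframe_deriv_expand:
  assumes d: "d \<in> A" and x: "x \<in> snd d ` fst d"
  shows "coframe_deriv d i x v w = (\<Sum>k\<in>UNIV. v $ k * coframe_deriv d i x (axis k 1) w)"
proof -
  have "((\<lambda>y. \<Sum>k\<in>UNIV. v $ k * coframe_chart d i y (axis k 1)) has_derivative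
      (\<lambda>w. \<Sum>k\<in>UNIV. v $ k * coframe_deriv d i x (axis k 1) w)) (at x)"
    by (intro has_derivative_sum has_derivative_mult_right coframe_chart_has_derivative d x)
  then have "((\<lambda>y. coframe_chart d i y v) has_derivative
      (\<lambda>w. \<Sum>k\<in>UNIV. v $ k * coframe_deriv d i x (axis k 1) w)) (at x)"
    by (rule has_derivative_transform_within_open[OF _ open_chart_image[OF d] x])
      (rule coframe_chart_expand[OF d, symmetric])
  from frechet_derivative_at[OF this] show ?thesis
    unfolding coframe_deriv_def[of d i x v] by (rule fun_cong[OF sym])
qed

lemma linear_coframe_deriv:
  assumes "d \<in> A" "x \<in> snd d ` fst d"
  shows "linear (\<lambda>v. coframe_deriv d i x v w)" "linear (coframe_deriv d i x v)"
proof -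
  have eq: "(\<lambda>v. coframe_deriv d i x v w) = (\<lambda>v. \<Sum>k\<in>UNIV. v $ k * coframe_deriv d i x (axis k 1) w)"
    by (rule ext) (rule coframe_deriv_expand[OF assms])
  show "linear (\<lambda>v. coframe_deriv d i x v w)"
    unfolding eq by (rule linearI) (simp_all add: sum.distrib algebra_simps sum_distrib_left)
  show "linear (coframe_deriv d i x v)"
    by (rule has_derivative_linear[OF coframe_chart_has_derivative[OF assms]])
qed

text \<open>The product rule for an expression that is smooth in the point and linear in the vector.
  It gives the differential of \<xi>, and the behaviour of the coframe under a chart change.\<close>

lemma coframe_chart_pair_has_derivative:
  assumes d: "d \<in> A" and x: "x \<in> snd d ` fst d"
  shows "((\<lambda>z. coframe_chart d i (fst z) (snd z)) has_derivative
    (\<lambda>V. coframe_deriv d i x v (fst V) + coframe_chart d i x (snd V))) (at (x, v))"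
proof -
  let ?g = "\<lambda>k y. coframe_chart d i y (axis k 1)" and ?g' = "\<lambda>k. coframe_deriv d i x (axis k 1)"
  have g: "((\<lambda>z. ?g k (fst z)) has_derivative (\<lambda>V. ?g' k (fst V))) (at (x, v))" for k
  proof -
    have "(?g k has_derivative ?g' k) (at (fst (x, v)))"
      using coframe_chart_has_derivative[OF d x] by simp
    from has_derivative_compose[OF bounded_linear_imp_has_derivative[OF bounded_linear_fst] this]
    show ?thesis .
  qed
  have s: "((\<lambda>z :: (real ^ 'n) \<times> (real ^ 'n). snd z $ k) has_derivative (\<lambda>V. snd V $ k)) (at (x, v))" for k
    by (rule bounded_linear_imp_has_derivative[OF bounded_linear_compose[OF bounded_linear_vec_nth bounded_linear_snd]])
  have "((\<lambda>z. \<Sum>k\<in>UNIV. snd z $ k * ?g k (fst z)) has_derivative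
      (\<lambda>V. \<Sum>k\<in>UNIV. snd (x, v) $ k * ?g' k (fst V) + snd V $ k * ?g k (fst (x, v)))) (at (x, v))"
    by (intro has_derivative_sum has_derivative_mult g s)
  moreover have "(\<lambda>V. \<Sum>k\<in>UNIV. snd (x, v) $ k * ?g' k (fst V) + snd V $ k * ?g k (fst (x, v))) =
      (\<lambda>V. coframe_deriv d i x v (fst V) + coframe_chart d i x (snd V))"
  proof
    fix V :: "(real ^ 'n) \<times> (real ^ 'n)"
    show "(\<Sum>k\<in>UNIV. snd (x, v) $ k * ?g' k (fst V) + snd V $ k * ?g k (fst (x, v))) =
        coframe_deriv d i x v (fst V) + coframe_chart d i x (snd V)"
      unfolding coframe_deriv_expand[OF d x, of i v] coframe_chart_expand[OF d x, of i "snd V"]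
      by (simp only: sum.distrib fst_conv snd_conv)
  qed
  ultimately have "((\<lambda>z. \<Sum>k\<in>UNIV. snd z $ k * ?g k (fst z)) has_derivative
      (\<lambda>V. coframe_deriv d i x v (fst V) + coframe_chart d i x (snd V))) (at (x, v))"
    by (simp only:)
  then show ?thesis
  proof (rule has_derivative_transform_within_open)
    show "open ((snd d ` fst d) \<times> (UNIV :: (real ^ 'n) set))"
      using open_chart_image[OF d] by (intro open_Times) auto
    show "(x, v) \<in> (snd d ` fst d) \<times> UNIV" using x by simp
    fix z assume "z \<in> (snd d ` fst d) \<times> (UNIV :: (real ^ 'n) set)"
    then have "fst z \<in> snd d ` fst d" by auto
    from coframe_chart_expand[OF d this, of i "snd z"]
    show "(\<Sum>k\<in>UNIV. snd z $ k * ?g k (fst z)) = coframe_chart d i (fst z) (snd z)" by (rule sym)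
  qed
qed

text \<open>The coordinate expression of \<open>d\<beta>\<^sup>i\<close> is independent of the chart because the second
  derivatives of the chart change are symmetric.\<close>

lemma coframe_curvature_chart_independent:
  assumes c: "c \<in> charts_at A q" and d: "d \<in> charts_at A q"
    and X: "X \<in> tangent_space A q" and Y: "Y \<in> tangent_space A q"
  shows "coframe_deriv c i (snd c q) (X c) (Y c) - coframe_deriv c i (snd c q) (Y c) (X c) =
    coframe_deriv d i (snd d q) (X d) (Y d) - coframe_deriv d i (snd d q) (Y d) (X d)"
proof -
  define \<phi> where "\<phi> = snd d \<circ> chart_inv c"
  define O' where "O' = snd c ` (fst c \<inter> fst d)"
  define x where "x = snd c q"
  note cA = charts_atD[OF c] and dA = charts_atD[OF d]
  have O': "open O'" "x \<in> O'" "Cinf_on \<phi> O'"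
    unfolding O'_def \<phi>_def x_def using open_overlap Cinf_on_transition cA dA by simp_all
  have \<phi>x: "\<phi> x = snd d q" unfolding \<phi>_def x_def using base.chart_inv_chart cA by simp
  have "snd d q \<in> snd d ` fst d" using dA by simp
  have tr: "Z d = frechet_derivative \<phi> (at x) (Z c)" if "Z \<in> tangent_space A q" for Z
    using base.tangent_space_transform[OF that c d] chart_derivative_transition[OF c d]
    unfolding \<phi>_def x_def by simp
  \<comment> \<open>The form in chart \<open>c\<close> is the form in chart \<open>d\<close>
    evaluated at \<phi>(y) on D\<phi>(y) v; differentiating in y produces one tensorial term and one
    with the second derivative of \<phi>. Only the latter obstructs invariance, and it cancels after
    antisymmetrization.\<close>
  have key: "coframe_deriv c i x v w = coframe_deriv d i (snd d q) (frechet_derivative \<phi> (at x) v)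
      (frechet_derivative \<phi> (at x) w) +
      coframe_chart d i (snd d q) (frechet_derivative (\<lambda>y. frechet_derivative \<phi> (at y) v) (at x) w)" for v w
  proof -
    let ?\<psi> = "\<lambda>y. frechet_derivative \<phi> (at y) v"
    have \<psi>: "Cinf_on ?\<psi> O'"
      by (intro Cinf_on_frechet_derivative O' Cinf_on_const)
    have "((\<lambda>y. (\<phi> y, ?\<psi> y)) has_derivative
        (\<lambda>w. (frechet_derivative \<phi> (at x) w, frechet_derivative ?\<psi> (at x) w))) (at x)"
      by (intro has_derivative_Pair Cinf_on_has_derivative[OF O'(3,2)] Cinf_on_has_derivative[OF \<psi> O'(2)])
    moreover have "((\<lambda>z. coframe_chart d i (fst z) (snd z)) has_derivative
      (\<lambda>V. coframe_deriv d i (snd d q) (?\<psi> x) (fst V) + coframe_chart d i (snd d q) (snd V))) (at (\<phi> x, ?\<psi> x))"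
      unfolding \<phi>x by (rule coframe_chart_pair_has_derivative[OF dA(1) \<open>snd d q \<in> snd d ` fst d\<close>])
    ultimately have "((\<lambda>y. coframe_chart d i (fst (\<phi> y, ?\<psi> y)) (snd (\<phi> y, ?\<psi> y))) has_derivative
        (\<lambda>w. coframe_deriv d i (snd d q) (?\<psi> x) (fst (frechet_derivative \<phi> (at x) w, frechet_derivative ?\<psi> (at x) w)) +
          coframe_chart d i (snd d q) (snd (frechet_derivative \<phi> (at x) w, frechet_derivative ?\<psi> (at x) w)))) (at x)"
      by (rule has_derivative_compose)
    then have "((\<lambda>y. coframe_chart c i y v) has_derivative
        (\<lambda>w. coframe_deriv d i (snd d q) (?\<psi> x) (frechet_derivative \<phi> (at x) w) +
          coframe_chart d i (snd d q) (frechet_derivative ?\<psi> (at x) w))) (at x)"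
      unfolding fst_conv snd_conv
    proof (rule has_derivative_transform_within_open[OF _ O'(1,2)])
      fix y assume "y \<in> O'"
      then obtain p where p: "p \<in> fst c" "p \<in> fst d" "y = snd c p" unfolding O'_def by blast
      have cp: "c \<in> charts_at A p" and dp: "d \<in> charts_at A p" using p cA dA by (simp_all add: charts_at_def)
      have inv: "chart_inv c y = p" using base.chart_inv_chart cA p by simp
      have \<phi>y: "\<phi> y = snd d p" unfolding \<phi>_def using inv by simp
      let ?Z = "coord_vector A c v p"
      have Z: "?Z \<in> tangent_space A p" by (rule base.coord_vector_in_tangent_space[OF cp])
      have "coframe_chart c i y v = coframe i p ?Z" unfolding coframe_chart_def inv ..
      moreover have "?Z d = ?\<psi> y"
        using coord_vector_transition[OF cp dp] unfolding \<phi>_def p(3) .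
      ultimately show "coframe_chart d i (\<phi> y) (?\<psi> y) = coframe_chart c i y v"
        using coframe_chart_eq[OF dp Z, of i] unfolding \<phi>y by simp
    qed
    from frechet_derivative_at[OF this] show ?thesis
      unfolding coframe_deriv_def[of c i x v] by (rule fun_cong[OF sym])
  qed
  show ?thesis
    unfolding tr[OF X] tr[OF Y] x_def[symmetric] key
      symmetric_second_derivative[OF O'(3,1,2), of "X c" "Y c"]
    by simp
qed

end

section \<open>Coframe and dual frame on the extended tangent bundle\<close>

locale ext_framed = framed_lie_group G A \<epsilon>
  for G :: "('q, 'x) monoid_scheme" (structure) and A :: "('q, real ^ 'n) chart set"
    and \<epsilon> :: "'n::finite \<Rightarrow> ('q, real ^ 'n) tvec" +
  fixes a b :: real
  assumes a_less_b: "a < b"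
begin

sublocale ext_atlas A a b
  by unfold_locales (rule a_less_b)

abbreviation theta where "theta \<equiv> theta_form G A a b \<epsilon>"
abbreviation xi where "xi \<equiv> xi_fun G A \<epsilon>"
abbreviation ds where "ds \<equiv> ds_form A a b"
abbreviation dd where "dd \<equiv> differential TA"

definition eta :: "'n \<Rightarrow> ('q, real ^ 'n) ext_point \<Rightarrow>
    (('q, real ^ 'n) ext_point, ((real ^ 'n) \<times> (real ^ 'n)) \<times> real) tvec \<Rightarrow> real" where
  "eta i m V = theta i m V - xi i m * ds m V"

lemma base_point_in_chart:
  "c \<in> charts_at A (base_point m) \<Longrightarrow> c \<in> A"
  "c \<in> charts_at A (base_point m) \<Longrightarrow> snd c (base_point m) \<in> snd c ` fst c"
  by (simp_all add: charts_at_def)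

lemma ext_chart_exists:
  assumes "m \<in> points TA"
  obtains c where "c \<in> charts_at A (base_point m)"
  using ext_charts_atE[OF some_chart[OF assms]] by metis

lemma theta_eq:
  assumes c: "c \<in> charts_at A (base_point m)" and m: "m \<in> points TA" and V: "V \<in> tangent_space TA m"
  shows "theta i m V = coframe_chart c i (snd c (base_point m)) (fst (fst (V (xc c))))"
  unfolding theta_form_def tangent_map_base_point[OF c m V] coframe_chart_def
    base.chart_inv_chart[OF charts_atD[OF c]] ..

lemma xi_eq:
  assumes c: "c \<in> charts_at A (base_point m)" and m: "m \<in> points TA"
  shows "xi i m = coframe_chart c i (snd c (base_point m)) (fibre_vector m c)"
  using coframe_chart_eq[OF c, of "fibre_vector m" i] m by (simp add: xi_fun_def mem_points_ext)

lemma xi_has_derivative: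
  assumes c: "c \<in> charts_at A (base_point m)"
  shows "((\<lambda>z. coframe_chart c i (fst (fst z)) (snd (fst z))) has_derivative
      (\<lambda>V. coframe_deriv c i (snd c (base_point m)) (fibre_vector m c) (fst (fst V)) +
        coframe_chart c i (snd c (base_point m)) (snd (fst V))))
    (at (snd (xc c) m) within S)"
proof -
  have "((\<lambda>z. coframe_chart c i (fst z) (snd z)) has_derivative
      (\<lambda>V. coframe_deriv c i (snd c (base_point m)) (fibre_vector m c) (fst V) +
        coframe_chart c i (snd c (base_point m)) (snd V))) (at (fst (snd (xc c) m)))"
    unfolding snd_ext_chart fst_conv
    by (rule coframe_chart_pair_has_derivative[OF base_point_in_chart[OF c]])
  from has_derivative_compose[OF bounded_linear_imp_has_derivative[OF bounded_linear_fst] this]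
  show ?thesis .
qed

lemma xi_chart_derivative:
  assumes c: "c \<in> charts_at A (base_point m)" and m: "m \<in> points TA"
  shows "chart_differentiable (xc c) (xi i) m"
    and "chart_derivative (xc c) (xi i) m =
      (\<lambda>V. coframe_deriv c i (snd c (base_point m)) (fibre_vector m c) (fst (fst V)) +
        coframe_chart c i (snd c (base_point m)) (snd (fst V)))"
proof -
  have eq: "xi i ((chart_inv c x, coord_vector A c v (chart_inv c x)), s) =
      coframe_chart c i (fst (fst ((x, v), s))) (snd (fst ((x, v), s)))" for x v and s :: real
    by (simp add: xi_fun_def coframe_chart_def)
  note * = chart_has_derivative_ext[OF c m xi_has_derivative[OF c] eq]
  show "chart_differentiable (xc c) (xi i) m" by (rule *)
  show "chart_derivative (xc c) (xi i) m =
      (\<lambda>V. coframe_deriv c i (snd c (base_point m)) (fibre_vector m c) (fst (fst V)) +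
        coframe_chart c i (snd c (base_point m)) (snd (fst V)))" by (rule *)
qed

lemma differential_xi_eq:
  assumes c: "c \<in> charts_at A (base_point m)" and m: "m \<in> points TA" and V: "V \<in> tangent_space TA m"
  shows "dd (xi i) m V = coframe_deriv c i (snd c (base_point m)) (fibre_vector m c) (fst (fst (V (xc c)))) +
    coframe_chart c i (snd c (base_point m)) (snd (fst (V (xc c))))"
  unfolding ext.differential_eq[OF V ext_charts_at[OF m c] xi_chart_derivative(1)[OF c m]]
    xi_chart_derivative(2)[OF c m] ..

text \<open>The system is triangular: \<theta> fixes the base component, d\<xi> then fixes the fibre
  component, and ds is the time component.\<close>

lemma tangent_vector_ext1:
  assumes m: "m \<in> points TA"
  shows "\<exists>V\<in>tangent_space TA m. (\<forall>i. theta i m V = t i) \<and> (\<forall>i. dd (xi i) m V = u i) \<and> ds m V = \<sigma>"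
proof -
  obtain c where c: "c \<in> charts_at A (base_point m)" by (rule ext_chart_exists[OF m])
  note cA = base_point_in_chart[OF c] and C = ext_charts_at[OF m c]
  have inv: "chart_inv c (snd c (base_point m)) = base_point m"
    by (rule base.chart_inv_chart[OF charts_atD[OF c]])
  define w where "w = (\<Sum>j\<in>UNIV. t j *\<^sub>R frame j (base_point m) c)"
  \<comment> \<open>d\<xi> also differentiates the coframe along the base component
    \<open>w\<close>; that contribution is removed in advance.\<close>
  define y where "y = (\<Sum>j\<in>UNIV. (u j - coframe_deriv c j (snd c (base_point m)) (fibre_vector m c) w)
    *\<^sub>R frame j (base_point m) c)"
  let ?V = "coord_vector TA (xc c) ((w, y), \<sigma>) m"
  have V: "?V \<in> tangent_space TA m" by (rule ext.coord_vector_in_tangent_space[OF C])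
  have Vc: "?V (xc c) = ((w, y), \<sigma>)" by (rule ext.coord_vector_chart[OF C])
  have "theta i m ?V = t i" for i
    unfolding theta_eq[OF c m V] Vc using coframe_chart_frame(2)[OF cA, of i t] by (simp add: w_def inv)
  moreover have "dd (xi i) m ?V = u i" for i
    unfolding differential_xi_eq[OF c m V] Vc
    using coframe_chart_frame(2)[OF cA, of i
        "\<lambda>j. u j - coframe_deriv c j (snd c (base_point m)) (fibre_vector m c) w"]
    by (simp add: y_def inv)
  moreover have "ds m ?V = \<sigma>"
    unfolding ds_form_eq[OF c m V] Vc by simp
  ultimately show ?thesis using V by blast
qed

lemma tangent_vector_eqI:
  assumes m: "m \<in> points TA" and V: "V \<in> tangent_space TA m" and W: "W \<in> tangent_space TA m"
    and th: "\<And>i. theta i m V = theta i m W" and dxi: "\<And>i. dd (xi i) m V = dd (xi i) m W"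
    and dt: "ds m V = ds m W"
  shows "V = W"
proof -
  obtain c where c: "c \<in> charts_at A (base_point m)" by (rule ext_chart_exists[OF m])
  note cA = base_point_in_chart[OF c]
  have eqI: "v = w" if "\<And>i. coframe_chart c i (snd c (base_point m)) v = coframe_chart c i (snd c (base_point m)) w" for v w
    by (subst coframe_chart_frame(1)[OF cA, of v, symmetric],
        subst coframe_chart_frame(1)[OF cA, of w, symmetric]) (simp only: that)
  have 1: "fst (fst (V (xc c))) = fst (fst (W (xc c)))"
    by (rule eqI) (use th in \<open>simp only: theta_eq[OF c m V] theta_eq[OF c m W]\<close>)
  have 2: "snd (fst (V (xc c))) = snd (fst (W (xc c)))"
  proof (rule eqI)
    fix i
    show "coframe_chart c i (snd c (base_point m)) (snd (fst (V (xc c)))) =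
        coframe_chart c i (snd c (base_point m)) (snd (fst (W (xc c))))"
      using dxi[of i] unfolding differential_xi_eq[OF c m V] differential_xi_eq[OF c m W] 1 by simp
  qed
  have 3: "snd (V (xc c)) = snd (W (xc c))"
    using dt unfolding ds_form_eq[OF c m V] ds_form_eq[OF c m W] .
  have "V (xc c) = W (xc c)"
    using 1 2 3 by (simp add: prod_eq_iff)
  then show ?thesis by (rule ext.tangent_space_eqI[OF V W ext_charts_at[OF m c]])
qed

text \<open>Existence and uniqueness of the dual vector, which give the description in
  \<open>ext_frame\<close> its meaning.\<close>

lemma ext_frame_props:
  assumes m: "m \<in> points TA"
  shows "ext_frame G A a b \<epsilon> k m \<in> tangent_space TA m"
    and "ext_coframe G A a b \<epsilon> l m (ext_frame G A a b \<epsilon> k m) = (if l = k then 1 else 0)"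
proof -
  let ?P = "\<lambda>V. V \<in> tangent_space TA m \<and> (\<forall>l. ext_coframe G A a b \<epsilon> l m V = (if l = k then 1 else 0))"
  have "\<exists>!V. ?P V"
  proof (rule ex_ex1I)
    obtain V where V: "V \<in> tangent_space TA m"
      "\<forall>i. theta i m V = (if Pos i = k then 1 else 0)"
      "\<forall>i. dd (xi i) m V = (if Vel i = k then 1 else 0)"
      "ds m V = (if Time = k then 1 else 0)"
      using tangent_vector_ext1[OF m, of "\<lambda>i. if Pos i = k then 1 else 0"
          "\<lambda>i. if Vel i = k then 1 else 0" "if Time = k then 1 else 0"] by blast
    have "ext_coframe G A a b \<epsilon> l m V = (if l = k then 1 else 0)" for l
      using V by (cases l) simp_all
    with V(1) show "\<exists>V. ?P V" by blast
    fix V W assume V: "?P V" and W: "?P W"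
    have eq: "ext_coframe G A a b \<epsilon> l m V = ext_coframe G A a b \<epsilon> l m W" for l
      using V W by simp
    show "V = W"
      using eq[of "Pos _"] eq[of "Vel _"] eq[of Time] V W
      by (intro tangent_vector_eqI[OF m]) simp_all
  qed
  from theI'[OF this] have "?P (ext_frame G A a b \<epsilon> k m)" unfolding ext_frame_def .
  then show "ext_frame G A a b \<epsilon> k m \<in> tangent_space TA m"
    and "ext_coframe G A a b \<epsilon> l m (ext_frame G A a b \<epsilon> k m) = (if l = k then 1 else 0)" by blast+
qed

abbreviation Exi where "Exi j m \<equiv> ext_frame G A a b \<epsilon> (Vel j) m"

lemma Exi_in_tangent_space: "m \<in> points TA \<Longrightarrow> Exi j m \<in> tangent_space TA m"
  by (rule ext_frame_props)

lemma Exi_coframe: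
  assumes "m \<in> points TA"
  shows "theta i m (Exi j m) = 0" "dd (xi i) m (Exi j m) = (if i = j then 1 else 0)" "ds m (Exi j m) = 0"
  using ext_frame_props(2)[OF assms, of "Pos i" "Vel j"] ext_frame_props(2)[OF assms, of "Vel i" "Vel j"]
    ext_frame_props(2)[OF assms, of Time "Vel j"] by simp_all

text \<open>A vertical vector with fibre part the frame vector has the right coframe values, because
  the term of d\<xi> that differentiates the coframe sees the base component only, and this is
  0.\<close>

lemma Exi_chart:
  assumes c: "c \<in> charts_at A (base_point m)" and m: "m \<in> points TA"
  shows "Exi j m (xc c) = ((0, frame j (base_point m) c), 0)"
proof -
  note cA = base_point_in_chart[OF c] and C = ext_charts_at[OF m c]
  let ?W = "coord_vector TA (xc c) ((0, frame j (base_point m) c), 0) m"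
  have W: "?W \<in> tangent_space TA m" by (rule ext.coord_vector_in_tangent_space[OF C])
  have Wc: "?W (xc c) = ((0, frame j (base_point m) c), 0)" by (rule ext.coord_vector_chart[OF C])
  have "coframe_chart c i (snd c (base_point m)) (frame j (base_point m) c) = (if i = j then 1 else 0)" for i
    unfolding coframe_chart_eq[OF c frame_in_tangent_space[OF charts_at_carrier[OF c]]]
    using coframe_frame[OF charts_at_carrier[OF c], of i "\<lambda>k. if k = j then 1 else 0"]
    by (simp add: if_distrib[of "\<lambda>r. r *\<^sub>R _"] sum.delta cong: if_cong)
  then have "Exi j m = ?W"
    by (intro tangent_vector_eqI[OF m Exi_in_tangent_space[OF m] W])
      (simp_all add: Exi_coframe[OF m] theta_eq[OF c m W] differential_xi_eq[OF c m W] ds_form_eq[OF c m W] Wc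
        linear_0[OF linear_coframe_chart[OF cA]] linear_0[OF linear_coframe_deriv(2)[OF cA]])
  then show ?thesis by (simp only: Wc)
qed

lemma deriv_xi_eq:
  assumes c: "c \<in> charts_at A (base_point m)" and m: "m \<in> points TA" and F: "chart_differentiable (xc c) F m"
  shows "deriv_xi G A a b \<epsilon> j F m = chart_derivative (xc c) F m ((0, frame j (base_point m) c), 0)"
  unfolding deriv_along_def ext.differential_eq[OF Exi_in_tangent_space[OF m] ext_charts_at[OF m c] F]
    Exi_chart[OF c m] ..

lemma smooth_function_chart:
  assumes F: "smooth_function (ext_model a b) TA F" and c: "c \<in> A"
  shows "smooth_on ((snd c ` fst c \<times> UNIV) \<times> {a..b}) (F \<circ> chart_inv (xc c))"
proof -
  have "xc c \<in> TA" using c by (simp add: ext_tangent_atlas_eq)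
  then have "smooth_on (snd (xc c) ` (fst (xc c) \<inter> F -` UNIV)) (id \<circ> F \<circ> chart_inv (xc c))"
    using F unfolding smooth_function_def smooth_map_def id_atlas_def by fastforce
  then show ?thesis
    using ext_chart_image_self[OF c] by simp
qed

lemma smooth_function_chart_differentiable:
  assumes F: "smooth_function (ext_model a b) TA F" and c: "c \<in> charts_at A (base_point m)" and m: "m \<in> points TA"
  shows "chart_differentiable (xc c) F m"
proof -
  note cA = charts_atD(1)[OF c]
  have "snd (xc c) m \<in> (snd c ` fst c \<times> UNIV) \<times> {a..b}"
    using ext_chart_image_self[OF cA] charts_atD(2)[OF ext_charts_at[OF m c]] by blast
  from smooth_on_has_derivative[OF smooth_function_chart[OF F cA] this]
  show ?thesis
    unfolding chart_differentiable_def differentiable_def ext_chart_image_self[OF cA] by metis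
qed

end

section \<open>The exterior derivative of the Lagrange form\<close>

text \<open>Tangent spaces are subspaces of a space of functions on charts, and the forms are
  controlled only on those subspaces; global \<open>linear\<close> would ask for more than they
  provide.\<close>

definition linear_fun_on :: "'v::real_vector set \<Rightarrow> ('v \<Rightarrow> real) \<Rightarrow> bool" where
  "linear_fun_on S f \<longleftrightarrow> (\<forall>x\<in>S. \<forall>y\<in>S. \<forall>r. f (r *\<^sub>R x + y) = r * f x + f y)"

lemma linear_fun_onD: "linear_fun_on S f \<Longrightarrow> x \<in> S \<Longrightarrow> y \<in> S \<Longrightarrow> f (r *\<^sub>R x + y) = r * f x + f y"
  unfolding linear_fun_on_def by blast

lemma linear_fun_on_0:
  assumes "linear_fun_on S f" "subspace S"
  shows "f 0 = 0"
  using linear_fun_onD[OF assms(1) subspace_0[OF assms(2)] subspace_0[OF assms(2)], of 1] by simp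

lemma linear_fun_on_add: "linear_fun_on S f \<Longrightarrow> x \<in> S \<Longrightarrow> y \<in> S \<Longrightarrow> f (x + y) = f x + f y"
  using linear_fun_onD[of S f x y 1] by simp

lemma linear_fun_on_scale: "linear_fun_on S f \<Longrightarrow> subspace S \<Longrightarrow> x \<in> S \<Longrightarrow> f (r *\<^sub>R x) = r * f x"
  using linear_fun_onD[of S f x 0 r] linear_fun_on_0[of S f] subspace_0[of S] by simp

lemma linear_fun_on_sum:
  assumes "linear_fun_on S f" "subspace S" "\<And>i. i \<in> I \<Longrightarrow> x i \<in> S"
  shows "f (\<Sum>i\<in>I. r i *\<^sub>R x i) = (\<Sum>i\<in>I. r i * f (x i))"
  using assms(3)
proof (induction I rule: infinite_finite_induct)
  case (insert j I)
  have "(\<Sum>i\<in>I. r i *\<^sub>R x i) \<in> S"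
    using insert.prems by (intro subspace_sum[OF assms(2)] subspace_scale[OF assms(2)]) simp
  then show ?case
    using insert by (simp add: linear_fun_onD[OF assms(1)])
qed (simp_all add: linear_fun_on_0[OF assms(1,2)])

lemma sum_mult_indicator: "(\<Sum>j\<in>UNIV. f j * (if i = j then 1 else 0)) = f i"
  for f :: "'n::finite \<Rightarrow> real"
proof -
  have "f j * (if i = j then 1 else 0) = (if i = j then f j else 0)" for j by simp
  then show ?thesis by (simp only: sum.delta' finite_class.finite_UNIV UNIV_I if_True)
qed

lemma invertible_transpose_real:
  fixes M :: "real ^ 'n ^ 'n"
  shows "invertible M \<Longrightarrow> invertible (transpose M)"
  by (simp add: invertible_det_nz)

lemma matrix_vector_mult_axis: "(M *v axis k 1) $ j = M $ j $ k"
  for M :: "real ^ 'n ^ 'm"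
  by (simp add: matrix_vector_mult_basis column_def)

lemma transpose_matrix_vector_mult: "(transpose M *v x) $ k = (\<Sum>j\<in>UNIV. x $ j * M $ j $ k)"
  for M :: "real ^ 'n ^ 'm"
  by (simp add: matrix_vector_mult_def transpose_def mult.commute)

context ext_framed
begin

lemma theta_linear: "m \<in> points TA \<Longrightarrow> linear_fun_on (tangent_space TA m) (theta i m)"
  unfolding linear_fun_on_def
proof (intro ballI allI)
  fix X Y r assume m: "m \<in> points TA" and X: "X \<in> tangent_space TA m" and Y: "Y \<in> tangent_space TA m"
  obtain c where c: "c \<in> charts_at A (base_point m)" by (rule ext_chart_exists[OF m])
  have XY: "r *\<^sub>R X + Y \<in> tangent_space TA m"
    using ext.subspace_tangent_space X Y by (simp add: subspace_add subspace_scale)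
  note lin = linear_coframe_chart[OF base_point_in_chart[OF c], of i]
  show "theta i m (r *\<^sub>R X + Y) = r * theta i m X + theta i m Y"
    unfolding theta_eq[OF c m X] theta_eq[OF c m Y] theta_eq[OF c m XY]
    by (simp add: scaleR_fun_def linear_add[OF lin] linear_scale[OF lin])
qed

lemma ds_linear: "m \<in> points TA \<Longrightarrow> linear_fun_on (tangent_space TA m) (ds m)"
  unfolding linear_fun_on_def
proof (intro ballI allI)
  fix X Y r assume m: "m \<in> points TA" and X: "X \<in> tangent_space TA m" and Y: "Y \<in> tangent_space TA m"
  obtain c where c: "c \<in> charts_at A (base_point m)" by (rule ext_chart_exists[OF m])
  have XY: "r *\<^sub>R X + Y \<in> tangent_space TA m"
    using ext.subspace_tangent_space X Y by (simp add: subspace_add subspace_scale)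
  show "ds m (r *\<^sub>R X + Y) = r * ds m X + ds m Y"
    unfolding ds_form_eq[OF c m X] ds_form_eq[OF c m Y] ds_form_eq[OF c m XY]
    by (simp add: scaleR_fun_def)
qed

lemma eta_linear: "m \<in> points TA \<Longrightarrow> linear_fun_on (tangent_space TA m) (eta i m)"
  using theta_linear[of m i] ds_linear[of m]
  unfolding linear_fun_on_def eta_def by (simp add: algebra_simps)

lemma dd_linear:
  assumes c: "c \<in> charts_at A (base_point m)" and m: "m \<in> points TA" and F: "chart_differentiable (xc c) F m"
  shows "linear_fun_on (tangent_space TA m) (dd F m)"
  unfolding linear_fun_on_def
proof (intro ballI allI)
  fix X Y r assume X: "X \<in> tangent_space TA m" and Y: "Y \<in> tangent_space TA m"
  have rX: "r *\<^sub>R X \<in> tangent_space TA m"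
    using ext.subspace_tangent_space X by (simp add: subspace_scale)
  show "dd F m (r *\<^sub>R X + Y) = r * dd F m X + dd F m Y"
    using ext.differential_linear(1)[OF ext_charts_at[OF m c] F rX Y]
      ext.differential_linear(2)[OF ext_charts_at[OF m c] F X X, of r] by simp
qed

lemma dd_xi_linear:
  assumes m: "m \<in> points TA"
  shows "linear_fun_on (tangent_space TA m) (dd (xi i) m)"
proof -
  obtain c where c: "c \<in> charts_at A (base_point m)" by (rule ext_chart_exists[OF m])
  show ?thesis by (rule dd_linear[OF c m xi_chart_derivative(1)[OF c m]])
qed

text \<open>Reduces the pairing of d\<Theta> with a vector that is killed by all \<theta> and by ds
  to the pairings with the vertical frame.\<close>

lemma vertical_expansion:
  assumes m: "m \<in> points TA" and V: "V \<in> tangent_space TA m"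
    and th: "\<And>i. theta i m V = 0" and s: "ds m V = 0"
  shows "V = (\<Sum>j\<in>UNIV. dd (xi j) m V *\<^sub>R Exi j m)"
proof (rule tangent_vector_eqI[OF m V])
  note sub = ext.subspace_tangent_space[of m]
  have E: "Exi j m \<in> tangent_space TA m" for j by (rule Exi_in_tangent_space[OF m])
  show "(\<Sum>j\<in>UNIV. dd (xi j) m V *\<^sub>R Exi j m) \<in> tangent_space TA m"
    by (intro subspace_sum[OF sub] subspace_scale[OF sub] E)
  show "theta i m V = theta i m (\<Sum>j\<in>UNIV. dd (xi j) m V *\<^sub>R Exi j m)" for i
    by (simp add: linear_fun_on_sum[OF theta_linear[OF m] sub E] Exi_coframe[OF m] th)
  show "ds m V = ds m (\<Sum>j\<in>UNIV. dd (xi j) m V *\<^sub>R Exi j m)"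
    by (simp add: linear_fun_on_sum[OF ds_linear[OF m] sub E] Exi_coframe[OF m] s)
  show "dd (xi i) m V = dd (xi i) m (\<Sum>j\<in>UNIV. dd (xi j) m V *\<^sub>R Exi j m)" for i
    unfolding linear_fun_on_sum[OF dd_xi_linear[OF m] sub E] Exi_coframe[OF m] sum_mult_indicator ..
qed

lemma coframe_const_chart_derivative:
  assumes c: "c \<in> charts_at A (base_point m)" and m: "m \<in> points TA"
  shows "chart_differentiable (xc c) (\<lambda>n. coframe_chart c i (snd c (base_point n)) w) m"
    and "chart_derivative (xc c) (\<lambda>n. coframe_chart c i (snd c (base_point n)) w) m =
      (\<lambda>V. coframe_deriv c i (snd c (base_point m)) w (fst (fst V)))"
proof -
  note cA = base_point_in_chart[OF c]
  have "((\<lambda>x. coframe_chart c i x w) has_derivative coframe_deriv c i (snd c (base_point m)) w)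
      (at (fst (fst (snd (xc c) m))))"
    unfolding snd_ext_chart fst_conv by (rule coframe_chart_has_derivative[OF cA])
  from has_derivative_compose[OF bounded_linear_imp_has_derivative[OF
        bounded_linear_compose[OF bounded_linear_fst bounded_linear_fst]] this]
  have der: "((\<lambda>z. coframe_chart c i (fst (fst z)) w) has_derivative
      (\<lambda>V. coframe_deriv c i (snd c (base_point m)) w (fst (fst V))))
      (at (snd (xc c) m) within (snd c ` fst c \<times> UNIV) \<times> {a..b})" .
  have eq: "coframe_chart c i (snd c (base_point ((chart_inv c x, coord_vector A c v (chart_inv c x)), s))) w =
      coframe_chart c i (fst (fst ((x, v), s))) w" if "x \<in> snd c ` fst c" for x v and s :: real
    using chart_at_image(2)[OF cA(1) that] by simp
  note * = chart_has_derivative_ext[OF c m der eq]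
  show "chart_differentiable (xc c) (\<lambda>n. coframe_chart c i (snd c (base_point n)) w) m" by (rule *)
  show "chart_derivative (xc c) (\<lambda>n. coframe_chart c i (snd c (base_point n)) w) m =
      (\<lambda>V. coframe_deriv c i (snd c (base_point m)) w (fst (fst V)))" by (rule *)
qed

end

section \<open>Exterior derivative of \<Theta> in terms of the coframe\<close>

locale lagrangian = ext_framed G A \<epsilon> a b
  for G :: "('q, 'x) monoid_scheme" (structure) and A :: "('q, real ^ 'n) chart set"
    and \<epsilon> :: "'n::finite \<Rightarrow> ('q, real ^ 'n) tvec" and a b :: real +
  fixes L :: "('q, real ^ 'n) ext_point \<Rightarrow> real" and p :: "'n \<Rightarrow> ('q, real ^ 'n) ext_point \<Rightarrow> real"
  assumes smooth_L: "smooth_function (ext_model a b) TA L"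
    and smooth_p: "smooth_function (ext_model a b) TA (p i)"
begin

abbreviation Theta where "Theta \<equiv> lagrange_form G A a b \<epsilon> L p"
abbreviation dTheta where "dTheta \<equiv> ext_deriv TA Theta"

lemma Theta_coord_vector:
  assumes c: "c \<in> charts_at A (base_point n)" and n: "n \<in> points TA"
  shows "Theta n (coord_vector TA (xc c) \<omega> n) = L n * snd \<omega> +
    (\<Sum>i\<in>UNIV. p i n * (coframe_chart c i (snd c (base_point n)) (fst (fst \<omega>)) - xi i n * snd \<omega>))"
proof -
  note C = ext_charts_at[OF n c]
  note V = ext.coord_vector_in_tangent_space[OF C, of \<omega>]
  show ?thesis
    unfolding lagrange_form_def theta_eq[OF c n V] ds_form_eq[OF c n V] ext.coord_vector_chart[OF C] ..
qed

lemma Theta_coord_vector_derivative: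
  assumes c: "c \<in> charts_at A (base_point m)" and m: "m \<in> points TA"
  shows "chart_derivative (xc c) (\<lambda>n. Theta n (coord_vector TA (xc c) \<omega> n)) m = (\<lambda>V.
    chart_derivative (xc c) L m V * snd \<omega> +
    (\<Sum>i\<in>UNIV. p i m * (coframe_deriv c i (snd c (base_point m)) (fst (fst \<omega>)) (fst (fst V)) -
        chart_derivative (xc c) (xi i) m V * snd \<omega>) +
      chart_derivative (xc c) (p i) m V *
        (coframe_chart c i (snd c (base_point m)) (fst (fst \<omega>)) - xi i m * snd \<omega>)))"
proof -
  note C = ext_charts_at[OF m c]
  let ?i = "chart_inv (xc c)" and ?cf = "\<lambda>i n. coframe_chart c i (snd c (base_point n)) (fst (fst \<omega>))"
  have inv: "?i (snd (xc c) m) = m"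
    by (rule ext.chart_inv_chart[OF charts_atD[OF C]])
  \<comment> \<open>\<open>Theta\<close> is known to have this form over the chart domain only. The
    product rule is applied to this expression, and the result carried over by
    \<open>chart_derivative_cong\<close>.\<close>
  define K where "K = (\<lambda>n. L n * snd \<omega> + (\<Sum>i\<in>UNIV. p i n * (?cf i n - xi i n * snd \<omega>)))"
  define K' where "K' = (\<lambda>V. chart_derivative (xc c) L m V * snd \<omega> +
    (\<Sum>i\<in>UNIV. (p i \<circ> ?i) (snd (xc c) m) * (chart_derivative (xc c) (?cf i) m V -
        chart_derivative (xc c) (xi i) m V * snd \<omega>) +
      chart_derivative (xc c) (p i) m V *
        ((?cf i \<circ> ?i) (snd (xc c) m) - (xi i \<circ> ?i) (snd (xc c) m) * snd \<omega>)))"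
  have "((\<lambda>z. (L \<circ> ?i) z * snd \<omega> + (\<Sum>i\<in>UNIV. (p i \<circ> ?i) z * ((?cf i \<circ> ?i) z - (xi i \<circ> ?i) z * snd \<omega>)))
      has_derivative K') (at (snd (xc c) m) within snd (xc c) ` fst (xc c))"
    unfolding K'_def
    by (intro has_derivative_add has_derivative_sum has_derivative_mult has_derivative_mult_left
        has_derivative_diff chart_has_derivative coframe_const_chart_derivative(1)[OF c m]
        xi_chart_derivative(1)[OF c m]
        smooth_function_chart_differentiable[OF smooth_L c m]
        smooth_function_chart_differentiable[OF smooth_p c m])
  then have der: "((K \<circ> ?i) has_derivative K') (at (snd (xc c) m) within snd (xc c) ` fst (xc c))"
    by (simp only: K_def o_def)
  have K: "chart_differentiable (xc c) K m" "chart_derivative (xc c) K m = K'"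
    using ext.chart_derivative_eq[OF C der] der by (auto simp: chart_differentiable_def differentiable_def)
  have "chart_derivative (xc c) (\<lambda>n. Theta n (coord_vector TA (xc c) \<omega> n)) m = chart_derivative (xc c) K m"
  proof (rule ext.chart_derivative_cong[OF C K(1)])
    fix n assume n: "n \<in> fst (xc c)"
    have "c \<in> charts_at A (base_point n)"
      using n charts_atD(1)[OF c] by (simp add: mem_ext_chart charts_at_def)
    moreover have "n \<in> points TA"
      using n charts_atD(1)[OF C] unfolding points_def by blast
    ultimately    show "K n = Theta n (coord_vector TA (xc c) \<omega> n)"
      unfolding K_def by (rule Theta_coord_vector[symmetric])
  qed
  also have "\<dots> = K'" by (rule K(2))
  finally show ?thesis
    by (simp only: K'_def o_def inv coframe_const_chart_derivative(2)[OF c m])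
qed

lemma dTheta_antisym: "dTheta m V W = - dTheta m W V"
  by (simp add: ext_deriv_def Let_def)

text \<open>All terms on the right are intrinsic except the two with \<open>coframe_deriv\<close>,
  which form the coordinate expression of d\<beta>; this isolates what may depend on the
  chart.\<close>

lemma Theta_chart_exterior_derivative:
  assumes d: "d \<in> charts_at A (base_point m)" and m: "m \<in> points TA"
    and V: "V \<in> tangent_space TA m" and W: "W \<in> tangent_space TA m"
  shows "chart_derivative (xc d) (\<lambda>x. Theta x (coord_vector TA (xc d) (W (xc d)) x)) m (V (xc d)) -
      chart_derivative (xc d) (\<lambda>x. Theta x (coord_vector TA (xc d) (V (xc d)) x)) m (W (xc d)) =
    dd L m V * ds m W - dd L m W * ds m V +
    (\<Sum>i\<in>UNIV. dd (p i) m V * eta i m W - dd (p i) m W * eta i m V +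
      p i m * (coframe_deriv d i (snd d (base_point m)) (fst (fst (W (xc d)))) (fst (fst (V (xc d)))) -
        coframe_deriv d i (snd d (base_point m)) (fst (fst (V (xc d)))) (fst (fst (W (xc d)))) -
        dd (xi i) m V * ds m W + dd (xi i) m W * ds m V))"
proof -
  note D = ext_charts_at[OF m d]
  have dL: "chart_derivative (xc d) L m (X (xc d)) = dd L m X" if "X \<in> tangent_space TA m" for X
    by (rule ext.differential_eq[OF that D smooth_function_chart_differentiable[OF smooth_L d m], symmetric])
  have dp: "chart_derivative (xc d) (p i) m (X (xc d)) = dd (p i) m X" if "X \<in> tangent_space TA m" for X i
    by (rule ext.differential_eq[OF that D smooth_function_chart_differentiable[OF smooth_p d m], symmetric])
  have dxi: "chart_derivative (xc d) (xi i) m (X (xc d)) = dd (xi i) m X" if "X \<in> tangent_space TA m" for X i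
    by (rule ext.differential_eq[OF that D xi_chart_derivative(1)[OF d m], symmetric])
  have et: "coframe_chart d i (snd d (base_point m)) (fst (fst (X (xc d)))) - xi i m * ds m X = eta i m X"
    if "X \<in> tangent_space TA m" for X i
    unfolding eta_def theta_eq[OF d m that] ..
  show ?thesis
    unfolding Theta_coord_vector_derivative[OF d m]
      dL[OF V] dL[OF W] dp[OF V] dp[OF W] dxi[OF V] dxi[OF W]
      ds_form_eq[OF d m V, symmetric] ds_form_eq[OF d m W, symmetric] et[OF V] et[OF W]
    by (simp add: sum_subtractf sum.distrib algebra_simps)
qed

text \<open>\<open>ext_deriv\<close> uses a chart obtained by choice. Invariance of the coordinate
  expression of d\<beta> replaces it by the prescribed chart \<open>c\<close>.\<close>

lemma dTheta_eq:
  assumes c: "c \<in> charts_at A (base_point m)" and m: "m \<in> points TA"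
    and V: "V \<in> tangent_space TA m" and W: "W \<in> tangent_space TA m"
  shows "dTheta m V W = dd L m V * ds m W - dd L m W * ds m V +
    (\<Sum>i\<in>UNIV. dd (p i) m V * eta i m W - dd (p i) m W * eta i m V +
      p i m * (coframe_deriv c i (snd c (base_point m)) (fst (fst (W (xc c)))) (fst (fst (V (xc c)))) -
        coframe_deriv c i (snd c (base_point m)) (fst (fst (V (xc c)))) (fst (fst (W (xc c)))) -
        dd (xi i) m V * ds m W + dd (xi i) m W * ds m V))"
proof -
  obtain d where d: "d \<in> charts_at A (base_point m)" and
    some: "(SOME c. c \<in> charts_at TA m) = xc d"
    by (rule ext_charts_atE[OF some_chart[OF m]])
  \<comment> \<open>The base components in different charts belong to one tangent vector of the
    group, its projection, so that the invariance lemma applies.\<close>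
  define P where "P = (\<lambda>X. tangent_map TA A base_point m X)"
  have P: "P X \<in> tangent_space A (base_point m)" if "X \<in> tangent_space TA m" for X
    unfolding P_def tangent_map_base_point[OF d m that] by (rule base.coord_vector_in_tangent_space[OF d])
  have Pc: "fst (fst (X (xc e))) = P X e" if "X \<in> tangent_space TA m" "e \<in> charts_at A (base_point m)" for X e
    unfolding P_def tangent_map_base_point[OF that(2) m that(1)] by (rule base.coord_vector_chart[OF that(2), symmetric])
  show ?thesis
    unfolding ext_deriv_def Let_def some Theta_chart_exterior_derivative[OF d m V W]
      Pc[OF V d] Pc[OF W d] Pc[OF V c] Pc[OF W c] coframe_curvature_chart_independent[OF c d P[OF W] P[OF V]] ..
qed

lemma dTheta_chart:
  assumes c: "c \<in> charts_at A (base_point m)" and m: "m \<in> points TA"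
    and V: "V \<in> tangent_space TA m" and W: "W \<in> tangent_space TA m"
  shows "dTheta m V W =
    chart_derivative (xc c) (\<lambda>x. Theta x (coord_vector TA (xc c) (W (xc c)) x)) m (V (xc c)) -
    chart_derivative (xc c) (\<lambda>x. Theta x (coord_vector TA (xc c) (V (xc c)) x)) m (W (xc c))"
  unfolding dTheta_eq[OF assms] Theta_chart_exterior_derivative[OF assms] ..

lemma dTheta_linear:
  assumes m: "m \<in> points TA" and V: "V \<in> tangent_space TA m"
  shows "linear_fun_on (tangent_space TA m) (dTheta m V)"
  unfolding linear_fun_on_def
proof (intro ballI allI)
  fix X Y r assume X: "X \<in> tangent_space TA m" and Y: "Y \<in> tangent_space TA m"
  obtain c where c: "c \<in> charts_at A (base_point m)" by (rule ext_chart_exists[OF m])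
  note cA = base_point_in_chart[OF c]
  have XY: "r *\<^sub>R X + Y \<in> tangent_space TA m"
    using ext.subspace_tangent_space X Y by (simp add: subspace_add subspace_scale)
  note 1 = linear_fun_onD[OF ds_linear[OF m] X Y] linear_fun_onD[OF eta_linear[OF m] X Y]
    linear_fun_onD[OF dd_xi_linear[OF m] X Y]
    linear_fun_onD[OF dd_linear[OF c m smooth_function_chart_differentiable[OF smooth_L c m]] X Y]
    linear_fun_onD[OF dd_linear[OF c m smooth_function_chart_differentiable[OF smooth_p c m]] X Y]
  have 2: "fst (fst ((r *\<^sub>R X + Y) (xc c))) = r *\<^sub>R fst (fst (X (xc c))) + fst (fst (Y (xc c)))"
    by (simp add: scaleR_fun_def)
  note lin = linear_coframe_deriv[OF cA]
  have 3: "coframe_deriv c i (snd c (base_point m)) (r *\<^sub>R v + w) u =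
      r * coframe_deriv c i (snd c (base_point m)) v u + coframe_deriv c i (snd c (base_point m)) w u"
    "coframe_deriv c i (snd c (base_point m)) u (r *\<^sub>R v + w) =
      r * coframe_deriv c i (snd c (base_point m)) u v + coframe_deriv c i (snd c (base_point m)) u w" for i u v w
    using linear_add[OF lin(1)] linear_scale[OF lin(1)]
    by (simp_all add: linear_add[OF lin(2)] linear_scale[OF lin(2)])
  show "dTheta m V (r *\<^sub>R X + Y) = r * dTheta m V X + dTheta m V Y"
    unfolding dTheta_eq[OF c m V X] dTheta_eq[OF c m V Y] dTheta_eq[OF c m V XY] 1 2 3
    by (simp add: algebra_simps sum.distrib sum_subtractf sum_distrib_left)
qed

text \<open>On a vertical frame vector every base component vanishes, and with it d\<beta>; of the
  coframe only d\<xi> with the same index survives.\<close>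

lemma dTheta_Exi:
  assumes m: "m \<in> points TA" and V: "V \<in> tangent_space TA m"
  shows "dTheta m V (Exi j m) = (p j m - deriv_xi G A a b \<epsilon> j L m) * ds m V -
    (\<Sum>i\<in>UNIV. deriv_xi G A a b \<epsilon> j (p i) m * eta i m V)"
proof -
  obtain c where c: "c \<in> charts_at A (base_point m)" by (rule ext_chart_exists[OF m])
  note cA = base_point_in_chart[OF c] and E = Exi_in_tangent_space[OF m]
  have 0: "fst (fst (Exi j m (xc c))) = 0" unfolding Exi_chart[OF c m] by simp
  have eta: "eta i m (Exi j m) = 0" for i by (simp add: eta_def Exi_coframe[OF m])
  have "dTheta m V (Exi j m) = - dd L m (Exi j m) * ds m V +
      (\<Sum>i\<in>UNIV. (if i = j then p i m * ds m V else 0) - dd (p i) m (Exi j m) * eta i m V)"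
    unfolding dTheta_eq[OF c m V E] 0 linear_0[OF linear_coframe_deriv(1)[OF cA]]
      linear_0[OF linear_coframe_deriv(2)[OF cA]] eta Exi_coframe[OF m]
    by (rule arg_cong2[where f = "(+)"], simp, rule sum.cong[OF refl], simp)
  also have "\<dots> = - dd L m (Exi j m) * ds m V + (p j m * ds m V - (\<Sum>i\<in>UNIV. dd (p i) m (Exi j m) * eta i m V))"
    unfolding sum_subtractf by simp
  finally show ?thesis
    by (simp add: deriv_along_def algebra_simps)
qed

section \<open>Nonsingularity for the Legendre momenta\<close>

context
  assumes legendre: "\<And>i m. m \<in> points TA \<Longrightarrow> p i m = deriv_xi G A a b \<epsilon> i L m"
    and regular: "\<And>m. m \<in> points TA \<Longrightarrow>
      invertible (\<chi> i j. deriv_xi G A a b \<epsilon> i (deriv_xi G A a b \<epsilon> j L) m)"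
begin

definition hess :: "('q, real ^ 'n) ext_point \<Rightarrow> real ^ 'n ^ 'n" where
  "hess m = (\<chi> i j. deriv_xi G A a b \<epsilon> i (deriv_xi G A a b \<epsilon> j L) m)"

text \<open>The Legendre relation holds throughout the chart domain, so it may be
  differentiated.\<close>

lemma deriv_xi_p:
  assumes m: "m \<in> points TA"
  shows "deriv_xi G A a b \<epsilon> j (p i) m = hess m $ j $ i"
proof -
  obtain c where c: "c \<in> charts_at A (base_point m)" by (rule ext_chart_exists[OF m])
  note C = ext_charts_at[OF m c] and pd = smooth_function_chart_differentiable[OF smooth_p c m, of i]
  have "p i n = deriv_xi G A a b \<epsilon> i L n" if "n \<in> fst (xc c)" for n
    using charts_atD(1)[OF C] that unfolding points_def by (intro legendre[unfolded points_def]) blast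
  note * = ext.chart_derivative_cong[where G = "deriv_xi G A a b \<epsilon> i L", OF C pd this]
  have "deriv_xi G A a b \<epsilon> j (deriv_xi G A a b \<epsilon> i L) m = deriv_xi G A a b \<epsilon> j (p i) m"
    using deriv_xi_eq[OF c m pd, of j] deriv_xi_eq[OF c m *(1), of j] by (simp only: *(2))
  then show ?thesis by (simp add: hess_def)
qed

lemma invertible_hess: "m \<in> points TA \<Longrightarrow> invertible (hess m)"
  unfolding hess_def by (rule regular)

lemma dTheta_Exi_legendre:
  assumes m: "m \<in> points TA" and V: "V \<in> tangent_space TA m"
  shows "dTheta m V (Exi j m) = - (hess m *v (\<chi> i. eta i m V)) $ j"
  unfolding dTheta_Exi[OF m V] deriv_xi_p[OF m] legendre[OF m]
  by (simp add: matrix_vector_mult_def)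

text \<open>The matrix itself acts on the \<eta>-components of a null vector; its transpose acts on
  the d\<xi>-components of a vertical vector in the second argument of d\<Theta>.\<close>

lemma hess_kernel:
  assumes "m \<in> points TA" "hess m *v x = 0 \<or> transpose (hess m) *v x = 0"
  shows "x = 0"
proof -
  have "invertible (hess m)" "invertible (transpose (hess m))"
    using invertible_hess[OF assms(1)] by (simp_all add: invertible_transpose_real)
  then show ?thesis
    using assms(2) unfolding invertible_left_inverse matrix_left_invertible_ker by blast
qed

lemma null_vector_eta:
  assumes m: "m \<in> points TA" and V: "V \<in> null_space TA dTheta m"
  shows "eta i m V = 0"
proof -
  have VT: "V \<in> tangent_space TA m" and "dTheta m V (Exi j m) = 0" for j
    using V Exi_in_tangent_space[OF m] unfolding null_space_def by blast+
  then have "hess m *v (\<chi> i. eta i m V) = 0"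
    by (simp add: dTheta_Exi_legendre[OF m VT] vec_eq_iff)
  from hess_kernel[OF m disjI1[OF this]] show ?thesis by (simp add: vec_eq_iff)
qed

text \<open>Since \<eta> and ds vanish on \<open>V\<close>, so does \<theta>, and \<open>V\<close>
  is vertical. Pairing with vectors on which \<eta> takes unit values shows that the transposed
  Hessian kills its vertical components.\<close>

lemma null_vector_0:
  assumes m: "m \<in> points TA" and V: "V \<in> null_space TA dTheta m" and s: "ds m V = 0"
  shows "V = 0"
proof -
  have VT: "V \<in> tangent_space TA m" and null: "\<And>W. W \<in> tangent_space TA m \<Longrightarrow> dTheta m V W = 0"
    using V unfolding null_space_def by blast+
  have th: "theta i m V = 0" for i
    using null_vector_eta[OF m V, of i] s by (simp add: eta_def)
  note V_eq = vertical_expansion[OF m VT th s] and sub = ext.subspace_tangent_space[of m]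
  have "(transpose (hess m) *v (\<chi> j. dd (xi j) m V)) $ k = 0" for k
  proof -
    \<comment> \<open>A test vector with \<eta>(W) the k-th unit vector; it extracts the k-th
      component of the transposed system.\<close>
    obtain W where W: "W \<in> tangent_space TA m" "\<forall>i. theta i m W = (if i = k then 1 else 0)" "ds m W = 0"
      using tangent_vector_ext1[OF m, of "\<lambda>i. if i = k then 1 else 0" "\<lambda>i. 0" 0] by blast
    have eta: "(\<chi> i. eta i m W) = axis k 1"
      using W by (simp add: eta_def axis_def vec_eq_iff)
    have "0 = dTheta m W V"
      using null[OF W(1)] dTheta_antisym[of m W V] by simp
    also have "\<dots> = dTheta m W (\<Sum>j\<in>UNIV. dd (xi j) m V *\<^sub>R Exi j m)"
      using V_eq by (rule arg_cong)
    also have "\<dots> = (\<Sum>j\<in>UNIV. dd (xi j) m V * dTheta m W (Exi j m))"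
      by (rule linear_fun_on_sum[OF dTheta_linear[OF m W(1)] sub Exi_in_tangent_space[OF m]])
    also have "\<dots> = - (transpose (hess m) *v (\<chi> j. dd (xi j) m V)) $ k"
      unfolding dTheta_Exi_legendre[OF m W(1)] eta vector_uminus_component matrix_vector_mult_axis transpose_matrix_vector_mult
      by (simp add: sum_negf)
    finally show ?thesis by simp
  qed
  then have "transpose (hess m) *v (\<chi> j. dd (xi j) m V) = 0"
    unfolding vec_eq_iff zero_index by (rule allI)
  then have "(\<chi> j. dd (xi j) m V) = 0"
    by (rule hess_kernel[OF m disjI2])
  then have "dd (xi j) m V = 0" for j by (simp add: vec_eq_iff)
  then show ?thesis by (subst V_eq) simp
qed

text \<open>Adding vertical vectors changes neither \<eta> nor ds. This freedom suffices, by
  invertibility of the transposed Hessian, to cancel the pairings with the remaining frame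
  directions.\<close>

lemma null_vector_exists:
  assumes m: "m \<in> points TA"
  obtains V where "V \<in> null_space TA dTheta m" "ds m V = 1"
proof -
  note sub = ext.subspace_tangent_space[of m] and E = Exi_in_tangent_space[OF m]
  define Q where "Q = (\<lambda>k. SOME W. W \<in> tangent_space TA m \<and>
    (\<forall>i. theta i m W = (if i = k then 1 else 0)) \<and> ds m W = 0)"
  have ex: "\<exists>W. W \<in> tangent_space TA m \<and> (\<forall>i. theta i m W = (if i = k then 1 else 0)) \<and> ds m W = 0" for k
    using tangent_vector_ext1[OF m, of "\<lambda>i. if i = k then 1 else 0" "\<lambda>i. 0" 0] by blast
  have "Q k \<in> tangent_space TA m \<and> (\<forall>i. theta i m (Q k) = (if i = k then 1 else 0)) \<and> ds m (Q k) = 0" for k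
    unfolding Q_def by (rule someI_ex[OF ex])
  then have Q: "Q k \<in> tangent_space TA m" "theta i m (Q k) = (if i = k then 1 else 0)"
    "ds m (Q k) = 0" for i k
    by blast+
  have eta_Q: "(\<chi> i. eta i m (Q k)) = axis k 1" for k
    using Q by (simp add: eta_def axis_def vec_eq_iff)
  \<comment> \<open>The conditions \<theta> = \<xi> and ds = 1 amount to \<eta> = 0 with unit time
    component; the vertical part, here 0, is corrected below.\<close>
  obtain V0 where V0: "V0 \<in> tangent_space TA m" "\<forall>i. theta i m V0 = xi i m" "ds m V0 = 1"
    using tangent_vector_ext1[OF m, of "\<lambda>i. xi i m" "\<lambda>i. 0" 1] by blast
  have "invertible (transpose (hess m))"
    by (rule invertible_transpose_real[OF invertible_hess[OF m]])
  then obtain N where "transpose (hess m) ** N = mat 1" by (auto simp: invertible_def)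
  then have "transpose (hess m) *v (N *v (\<chi> k. dTheta m (Q k) V0)) = (\<chi> k. dTheta m (Q k) V0)"
    by (simp add: matrix_vector_mul_assoc)
  \<comment> \<open>As d\<Theta>(Q k, E j) = - \<open>hess m $ j $ k\<close>, the vertical
    correction with these coefficients makes every d\<Theta>(Q k, V) vanish.\<close>
  then obtain w where w: "transpose (hess m) *v w = (\<chi> k. dTheta m (Q k) V0)" by blast
  define V where "V = V0 + (\<Sum>j\<in>UNIV. w $ j *\<^sub>R Exi j m)"
  have S: "(\<Sum>j\<in>UNIV. w $ j *\<^sub>R Exi j m) \<in> tangent_space TA m"
    by (intro subspace_sum[OF sub] subspace_scale[OF sub] E)
  have V: "V \<in> tangent_space TA m"
    unfolding V_def by (rule subspace_add[OF sub V0(1) S])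
  have dsV: "ds m V = 1"
    unfolding V_def linear_fun_on_add[OF ds_linear[OF m] V0(1) S]
      linear_fun_on_sum[OF ds_linear[OF m] sub E] by (simp add: Exi_coframe[OF m] V0)
  have etaV: "eta i m V = 0" for i
    unfolding V_def linear_fun_on_add[OF eta_linear[OF m] V0(1) S]
      linear_fun_on_sum[OF eta_linear[OF m] sub E] by (simp add: Exi_coframe[OF m] V0 eta_def)
  have VE: "dTheta m V (Exi j m) = 0" for j
  proof -
    have "(\<chi> i. eta i m V) = 0" by (simp add: etaV vec_eq_iff)
    then show ?thesis unfolding dTheta_Exi_legendre[OF m V] by simp
  qed
  have QV: "dTheta m (Q k) V = 0" for k
  proof -
    have "dTheta m (Q k) V = dTheta m (Q k) V0 + (\<Sum>j\<in>UNIV. w $ j * dTheta m (Q k) (Exi j m))"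
      unfolding V_def linear_fun_on_add[OF dTheta_linear[OF m Q(1)] V0(1) S]
        linear_fun_on_sum[OF dTheta_linear[OF m Q(1)] sub E] ..
    also have "(\<Sum>j\<in>UNIV. w $ j * dTheta m (Q k) (Exi j m)) = - (transpose (hess m) *v w) $ k"
      unfolding dTheta_Exi_legendre[OF m Q(1)] eta_Q vector_uminus_component matrix_vector_mult_axis transpose_matrix_vector_mult
      by (simp add: sum_negf)
    finally show ?thesis unfolding w by simp
  qed
  have "dTheta m V W = 0" if W: "W \<in> tangent_space TA m" for W
  proof -
    \<comment> \<open>\<open>R\<close> agrees with \<open>W\<close> under ds and all \<eta>, so the
      difference is vertical. \<open>V\<close>, the vectors \<open>Q k\<close> and the vertical
      frame thus span, and \<open>V\<close> pairs to 0 with each of them.\<close>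
    define R where "R = ds m W *\<^sub>R V + (\<Sum>k\<in>UNIV. eta k m W *\<^sub>R Q k)"
    have RS: "(\<Sum>k\<in>UNIV. eta k m W *\<^sub>R Q k) \<in> tangent_space TA m"
      by (intro subspace_sum[OF sub] subspace_scale[OF sub] Q)
    have R: "R \<in> tangent_space TA m"
      unfolding R_def by (intro subspace_add[OF sub] subspace_scale[OF sub] V RS)
    have lin: "f R = ds m W * f V + (\<Sum>k\<in>UNIV. eta k m W * f (Q k))"
      if f: "linear_fun_on (tangent_space TA m) f" for f
      unfolding R_def linear_fun_onD[OF f V RS] linear_fun_on_sum[OF f sub Q(1)] ..
    have eta_Q': "eta i m (Q k) = (if i = k then 1 else 0)" for i k
      using Q by (simp add: eta_def)
    define Y where "Y = W - R"
    have Y: "Y \<in> tangent_space TA m" unfolding Y_def by (rule subspace_diff[OF sub W R])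
    have WRY: "W = R + Y" by (simp add: Y_def)
    have dsY: "ds m Y = 0"
      using linear_fun_on_add[OF ds_linear[OF m] R Y] lin[OF ds_linear[OF m]]
      unfolding WRY[symmetric] by (simp add: dsV Q)
    have "eta i m Y = 0" for i
      using linear_fun_on_add[OF eta_linear[OF m, of i] R Y] lin[OF eta_linear[OF m, of i]]
      unfolding WRY[symmetric] by (simp add: etaV eta_Q' sum_mult_indicator)
    then have "theta i m Y = 0" for i using dsY by (simp add: eta_def)
    note Y_eq = vertical_expansion[OF m Y this dsY]
    have "dTheta m V Y = dTheta m V (\<Sum>j\<in>UNIV. dd (xi j) m Y *\<^sub>R Exi j m)"
      using Y_eq by (rule arg_cong)
    also have "\<dots> = (\<Sum>j\<in>UNIV. dd (xi j) m Y * dTheta m V (Exi j m))"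
      by (rule linear_fun_on_sum[OF dTheta_linear[OF m V] sub E])
    finally have "dTheta m V Y = 0" by (simp add: VE)
    moreover have "dTheta m V V = 0" using dTheta_antisym[of m V V] by simp
    moreover have "dTheta m V (Q k) = 0" for k using dTheta_antisym[of m V "Q k"] QV by simp
    ultimately show ?thesis
      unfolding WRY linear_fun_on_add[OF dTheta_linear[OF m V] R Y] lin[OF dTheta_linear[OF m V]] by simp
  qed
  then have "V \<in> null_space TA dTheta m" using V by (simp add: null_space_def)
  then show ?thesis using dsV by (rule that)
qed

lemma nonsingular_legendre: "nonsingular_form TA dTheta"
  unfolding nonsingular_form_def
proof
  fix m assume m: "m \<in> points TA"
  obtain V where V: "V \<in> null_space TA dTheta m" and dsV: "ds m V = 1"
    by (rule null_vector_exists[OF m])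
  note sub = ext.subspace_tangent_space[of m]
  have VT: "V \<in> tangent_space TA m" using V by (simp add: null_space_def)
  have "V \<noteq> 0" using dsV linear_fun_on_0[OF ds_linear[OF m] sub] by auto
  have "W \<in> span {V}" if W: "W \<in> null_space TA dTheta m" for W
  proof -
    have WT: "W \<in> tangent_space TA m" using W by (simp add: null_space_def)
    \<comment> \<open>Removing the multiple of \<open>V\<close> with the same time component leaves
      a null vector with ds = 0, which must vanish. The null space is therefore the line through
      \<open>V\<close>.\<close>
    define Y where "Y = (- ds m W) *\<^sub>R V + W"
    have YT: "Y \<in> tangent_space TA m"
      unfolding Y_def by (intro subspace_add[OF sub] subspace_scale[OF sub] VT WT)
    have "dTheta m Y Z = 0" if Z: "Z \<in> tangent_space TA m" for Z
    proof -
      have "dTheta m Z Y = (- ds m W) * dTheta m Z V + dTheta m Z W"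
        unfolding Y_def by (rule linear_fun_onD[OF dTheta_linear[OF m Z] VT WT])
      moreover have "dTheta m Z V = 0" "dTheta m Z W = 0"
        using V W Z dTheta_antisym[of m Z V] dTheta_antisym[of m Z W] by (simp_all add: null_space_def)
      ultimately show ?thesis using dTheta_antisym[of m Y Z] by simp
    qed
    then have "Y \<in> null_space TA dTheta m" using YT by (simp add: null_space_def)
    moreover have "ds m Y = 0"
      unfolding Y_def linear_fun_onD[OF ds_linear[OF m] VT WT] by (simp add: dsV)
    ultimately have "Y = 0" by (rule null_vector_0[OF m])
    have "W = r *\<^sub>R V" if "(- r) *\<^sub>R V + W = 0" for r
      using that by (simp add: add_eq_0_iff)
    from this[OF \<open>Y = 0\<close>[unfolded Y_def]] have W_eq: "W = ds m W *\<^sub>R V" .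
    show ?thesis by (subst W_eq) (intro span_scale span_base, simp)
  qed
  then have "span (null_space TA dTheta m) = span {V}"
    using V by (intro subset_antisym span_minimal span_mono subspace_span) auto
  then show "dim (null_space TA dTheta m) = 1"
    using dim_eq_card[of "{V}" "null_space TA dTheta m"] \<open>V \<noteq> 0\<close> by simp
qed

end

end

section \<open>Holonomic curves\<close>

lemma smooth_on_has_vector_derivative:
  fixes f :: "real \<Rightarrow> 'f::real_normed_vector"
  assumes "smooth_on S f" "t \<in> S"
  shows "(f has_vector_derivative vector_derivative f (at t within S)) (at t within S)"
proof -
  obtain f' where f': "(f has_derivative f') (at t within S)"
    using smooth_on_has_derivative[OF assms] by blast
  have "f' x = x *\<^sub>R f' 1" for x
    using linear_scale[OF has_derivative_linear[OF f'], of x 1] by (simp only: real_scaleR_def mult_1_right)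
  then have "f' = (\<lambda>x. x *\<^sub>R f' 1)" by (rule ext)
  with f' have "(f has_vector_derivative f' 1) (at t within S)"
    by (simp only: has_vector_derivative_def)
  then have "f differentiable (at t within S)"
    using f' by (auto simp: differentiable_def)
  then show ?thesis by (simp only: vector_derivative_works)
qed

lemma inj_on_of_derivative_nonzero:
  fixes f :: "real \<Rightarrow> real"
  assumes I: "is_interval I" and der: "\<And>t. t \<in> I \<Longrightarrow> (f has_vector_derivative f' t) (at t within I)"
    and nz: "\<And>t. t \<in> I \<Longrightarrow> f' t \<noteq> 0"
  shows "inj_on f I"
proof (rule linorder_inj_onI')
  fix s t assume st: "s \<in> I" "t \<in> I" "s < t"
  have sub: "{s..t} \<subseteq> I"
    using I st unfolding is_interval_1 by (meson atLeastAtMost_iff subsetI)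
  have "\<exists>z\<in>{s<..<t}. f t - f s = (t - s) *\<^sub>R f' z"
  proof (rule mvt_simple[OF \<open>s < t\<close>])
    fix x assume "s \<le> x" "x \<le> t"
    then have "x \<in> I" using sub by auto
    from has_derivative_subset[OF der[OF this, unfolded has_vector_derivative_def] sub]
    show "(f has_derivative (\<lambda>h. h *\<^sub>R f' x)) (at x within {s..t})" .
  qed
  then obtain z where "z \<in> {s<..<t}" "f t - f s = (t - s) *\<^sub>R f' z" by blast
  moreover from this have "z \<in> I" using sub by (intro subsetD[OF sub]) simp
  ultimately show "f s \<noteq> f t" using nz[of z] \<open>s < t\<close> by auto
qed

text \<open>The local inverse of an extension of \<open>\<tau>\<close> provides the extensions that smoothness at the
  end points of \<open>\<tau> ` I\<close> requires.\<close>

lemma smooth_curve_reparametrize: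
  fixes \<tau> :: "real \<Rightarrow> real" and A :: "('q, 'e::euclidean_space) chart set"
  assumes I: "is_interval I" "interior I \<noteq> {}" and \<tau>: "smooth_on I \<tau>"
    and nz: "\<And>t. t \<in> I \<Longrightarrow> vector_derivative \<tau> (at t within I) \<noteq> 0"
    and C: "smooth_curve A I C"
  shows "inj_on \<tau> I" "smooth_curve A (\<tau> ` I) (C \<circ> inv_into I \<tau>)"
proof -
  have der: "(\<tau> has_vector_derivative vector_derivative \<tau> (at t within I)) (at t within I)" if "t \<in> I" for t
    by (rule smooth_on_has_vector_derivative[OF \<tau> that])
  show inj: "inj_on \<tau> I"
    by (rule inj_on_of_derivative_nonzero[OF I(1) der nz])
  have cont: "continuous_on I \<tau>" by (rule smooth_on_continuous[OF \<tau>])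
  have pc: "path_connected I" using I(1) by (simp add: is_interval_path_connected)
  have op: "openin (top_of_set (\<tau> ` I)) (\<tau> ` N)" if "openin (top_of_set I) N" for N
    by (rule injective_into_1d_imp_open_map[OF cont pc inj that])
  let ?g = "inv_into I \<tau>"
  have g: "?g (\<tau> t) = t" if "t \<in> I" for t using inj that by simp
  have J: "is_interval (\<tau> ` I)"
    using I(1) cont by (simp add: is_interval_connected_1 connected_continuous_image)
  have int: "interior (\<tau> ` I) \<noteq> {}"
  proof -
    have "open (\<tau> ` interior I)"
      using injective_into_1d_imp_open_map_UNIV[OF open_interior cont inj interior_subset] .
    moreover have "\<tau> ` interior I \<subseteq> \<tau> ` I" using interior_subset by blast
    ultimately have "\<tau> ` interior I \<subseteq> interior (\<tau> ` I)" by (intro interior_maximal)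
    then show ?thesis using I(2) by blast
  qed
  have pts: "(C \<circ> ?g) ` \<tau> ` I \<subseteq> points A"
    using C g unfolding smooth_curve_iff by auto
  have "openin (top_of_set (\<tau> ` I)) (\<tau> ` I \<inter> (C \<circ> ?g) -` fst d) \<and>
      smooth_on (\<tau> ` I \<inter> (C \<circ> ?g) -` fst d) (snd d \<circ> (C \<circ> ?g))" if d: "d \<in> A" for d
  proof
    let ?N = "I \<inter> C -` fst d"
    have N: "openin (top_of_set I) ?N" and sm: "smooth_on ?N (snd d \<circ> C)"
      using C d unfolding smooth_curve_iff by blast+
    have im: "\<tau> ` I \<inter> (C \<circ> ?g) -` fst d = \<tau> ` ?N" using g by auto
    show "openin (top_of_set (\<tau> ` I)) (\<tau> ` I \<inter> (C \<circ> ?g) -` fst d)"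
      unfolding im by (rule op[OF N])
    show "smooth_on (\<tau> ` I \<inter> (C \<circ> ?g) -` fst d) (snd d \<circ> (C \<circ> ?g))"
      unfolding im
    proof (rule smooth_onI)
      fix s0 assume "s0 \<in> \<tau> ` ?N"
      then obtain t0 where t0: "t0 \<in> ?N" "s0 = \<tau> t0" by blast
      then have "t0 \<in> I" by blast
      obtain U e where U: "open U" "t0 \<in> U" "Cinf_on e U" "\<And>t. t \<in> I \<Longrightarrow> t \<in> U \<Longrightarrow> e t = \<tau> t"
        using smooth_on_local_extension[OF \<tau> \<open>t0 \<in> I\<close>] by blast
      obtain U2 f where U2: "open U2" "t0 \<in> U2" "Cinf_on f U2"
        "\<And>t. t \<in> ?N \<Longrightarrow> t \<in> U2 \<Longrightarrow> f t = (snd d \<circ> C) t"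
        using smooth_on_local_extension[OF sm t0(1)] by blast
      have e': "(e has_vector_derivative frechet_derivative e (at t0) 1) (at t0 within I)"
      proof -
        have e0: "(e has_derivative frechet_derivative e (at t0)) (at t0)"
          by (rule Cinf_on_has_derivative[OF U(3,2)])
        have "frechet_derivative e (at t0) x = x *\<^sub>R frechet_derivative e (at t0) 1" for x
          using linear_scale[OF has_derivative_linear[OF e0], of x 1]
          by (simp only: real_scaleR_def mult_1_right)
        then have "frechet_derivative e (at t0) = (\<lambda>x. x *\<^sub>R frechet_derivative e (at t0) 1)" by (rule ext)
        with e0 have "(e has_vector_derivative frechet_derivative e (at t0) 1) (at t0)"
          by (simp only: has_vector_derivative_def)
        then show ?thesis by (rule has_vector_derivative_at_within)
      qed
      obtain r where "r > 0" "ball t0 r \<subseteq> U" using U(1,2) by (auto simp: open_contains_ball)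
      then have "(\<tau> has_vector_derivative frechet_derivative e (at t0) 1) (at t0 within I)"
        using U(4) \<open>t0 \<in> I\<close>
        by (intro has_vector_derivative_transform_within[OF e' \<open>r > 0\<close> \<open>t0 \<in> I\<close>])
          (auto simp: subset_eq dist_commute)
      \<comment> \<open>At an end point of \<open>I\<close> the derivative of the extension is fixed
        by the one-sided derivative of \<tau>, which is nonzero by assumption.\<close>
      then have "frechet_derivative e (at t0) 1 \<noteq> 0"
        using vector_derivative_unique_within[OF at_within_interval_nontrivial[OF I \<open>t0 \<in> I\<close>] der[OF \<open>t0 \<in> I\<close>]]
          nz[OF \<open>t0 \<in> I\<close>] by metis
      from local_inverse_real[OF U(1,3,2) this]
      obtain W V h where W: "open W" "t0 \<in> W" "W \<subseteq> U" "open V" "e ` W = V" "Cinf_on h V"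
        and h: "\<And>t. t \<in> W \<Longrightarrow> h (e t) = t" by blast
      have "openin (top_of_set I) (?N \<inter> (W \<inter> U2))"
        by (rule openin_Int_open[OF N open_Int[OF W(1) U2(1)]])
      \<comment> \<open>By openness of \<tau>, points of its image inside \<open>O'\<close> come
        from parameters close to \<open>t0\<close>, where \<open>h\<close> is the inverse of the
        extension and \<open>f\<close> extends the chart expression of the curve.\<close>
      from op[OF this] obtain O' where O': "open O'" "\<tau> ` (?N \<inter> (W \<inter> U2)) = \<tau> ` I \<inter> O'"
        unfolding openin_open by blast
      let ?U = "V \<inter> h -` U2 \<inter> O'"
      have "continuous_on V h" by (rule Cinf_on_continuous[OF W(6)])
      then have "open (V \<inter> h -` U2)" using W(4) U2(1) by (intro continuous_open_preimage)
      then have "open ?U" using O'(1) by blast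
      moreover have "s0 \<in> ?U"
      proof -
        have "e t0 = s0" using U(4)[OF \<open>t0 \<in> I\<close> U(2)] t0(2) by simp
        moreover have "s0 \<in> O'" using O'(2) t0 W(2) U2(2) by blast
        ultimately show ?thesis using h[OF W(2)] W(2,5) U2(2) by auto
      qed
      moreover have "Cinf_on (\<lambda>s. f (h s)) ?U"
        by (rule Cinf_on_compose[OF \<open>open ?U\<close> U2(1) _ U2(3) Cinf_on_subset[OF W(6)]]) auto
      moreover have "f (h s) = (snd d \<circ> (C \<circ> ?g)) s" if s: "s \<in> \<tau> ` ?N \<inter> ?U" for s
      proof -
        have "s \<in> \<tau> ` (?N \<inter> (W \<inter> U2))" using O'(2) s by blast
        then obtain t where t: "t \<in> ?N" "t \<in> W" "t \<in> U2" "s = \<tau> t" by blast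
        have "h s = t" using h[OF t(2)] U(4)[of t] t W(3) by auto
        then show ?thesis using U2(4)[OF t(1,3)] g t by simp
      qed
      ultimately show "\<exists>U k. open U \<and> s0 \<in> U \<and> Cinf_on k U \<and>
          (\<forall>s\<in>\<tau> ` ?N \<inter> U. k s = (snd d \<circ> (C \<circ> ?g)) s)"
        by blast
    qed
  qed
  then show "smooth_curve A (\<tau> ` I) (C \<circ> ?g)"
    unfolding smooth_curve_iff using J int pts by blast
qed

context ext_framed
begin

text \<open>The numbers \<eta> are the frame components of the difference between the projected
  vector and ds(V) times the fibre vector.\<close>

lemma eta_zero_iff:
  assumes m: "m \<in> points TA" and V: "V \<in> tangent_space TA m"
  shows "(\<forall>i. eta i m V = 0) \<longleftrightarrow> tangent_map TA A base_point m V = ds m V *\<^sub>R fibre_vector m"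
proof -
  obtain c where c: "c \<in> charts_at A (base_point m)" by (rule ext_chart_exists[OF m])
  have q: "base_point m \<in> carrier G" by (rule charts_at_carrier[OF c])
  have X: "fibre_vector m \<in> tangent_space A (base_point m)" using m by (simp add: mem_points_ext)
  have P: "tangent_map TA A base_point m V \<in> tangent_space A (base_point m)"
    unfolding tangent_map_base_point[OF c m V] by (rule base.coord_vector_in_tangent_space[OF c])
  have sX: "ds m V *\<^sub>R fibre_vector m \<in> tangent_space A (base_point m)"
    by (rule subspace_scale[OF base.subspace_tangent_space X])
  have "coframe i (base_point m) (ds m V *\<^sub>R fibre_vector m) = ds m V * xi i m" for i
    using coframe_linear[OF q X X, of i "ds m V" 0] by (simp add: xi_fun_def)
  then have eta: "eta i m V = coframe i (base_point m) (tangent_map TA A base_point m V) -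
      coframe i (base_point m) (ds m V *\<^sub>R fibre_vector m)" for i
    by (simp add: eta_def theta_form_def)
  show ?thesis
  proof
    assume "\<forall>i. eta i m V = 0"
    then have "coframe i (base_point m) (tangent_map TA A base_point m V) =
        coframe i (base_point m) (ds m V *\<^sub>R fibre_vector m)" for i
      using eta[of i] by simp
    then show "tangent_map TA A base_point m V = ds m V *\<^sub>R fibre_vector m"
      by (subst frame_expansion[OF q P], subst frame_expansion[OF q sX]) (simp only:)
  next
    assume "tangent_map TA A base_point m V = ds m V *\<^sub>R fibre_vector m"
    then show "\<forall>i. eta i m V = 0" unfolding eta by simp
  qed
qed

lemma smooth_curve_time_base:
  assumes C: "smooth_curve TA I C"
  shows "smooth_on I (\<lambda>t. time_coord (C t))" "smooth_curve A I (\<lambda>t. base_point (C t))"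
    and "t \<in> I \<Longrightarrow> ((\<lambda>t. time_coord (C t)) has_vector_derivative ds (C t) (velocity TA I C t)) (at t within I)"
    and "t \<in> I \<Longrightarrow> d \<in> charts_at A (base_point (C t)) \<Longrightarrow> ((\<lambda>t. snd d (base_point (C t))) has_vector_derivative
        tangent_map TA A base_point (C t) (velocity TA I C t) d) (at t within I)"
proof -
  have pts: "C t \<in> points TA" if "t \<in> I" for t
    using C that unfolding smooth_curve_iff by blast
  have I: "is_interval I" "interior I \<noteq> {}" using C unfolding smooth_curve_iff by blast+
  have N_eq: "I \<inter> C -` fst (xc c) = I \<inter> (\<lambda>t. base_point (C t)) -` fst c" for c
    using pts by (auto simp: mem_ext_chart mem_points_ext)
  have sm: "openin (top_of_set I) (I \<inter> (\<lambda>t. base_point (C t)) -` fst c)"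
    "smooth_on (I \<inter> (\<lambda>t. base_point (C t)) -` fst c) (snd (xc c) \<circ> C)" if c: "c \<in> A" for c
  proof -
    have "xc c \<in> TA" using c by (simp add: ext_tangent_atlas_eq)
    then show "openin (top_of_set I) (I \<inter> (\<lambda>t. base_point (C t)) -` fst c)"
      "smooth_on (I \<inter> (\<lambda>t. base_point (C t)) -` fst c) (snd (xc c) \<circ> C)"
      using C unfolding smooth_curve_iff N_eq[symmetric] by blast+
  qed
  show "smooth_on I (\<lambda>t. time_coord (C t))"
  proof (rule smooth_on_openin_local)
    fix t assume t: "t \<in> I"
    obtain c where c: "c \<in> charts_at A (base_point (C t))" by (rule ext_chart_exists[OF pts[OF t]])
    have "smooth_on (I \<inter> (\<lambda>t. base_point (C t)) -` fst c) (\<lambda>t. snd ((snd (xc c) \<circ> C) t))"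
      by (rule smooth_on_bounded_linear[OF bounded_linear_snd sm(2)[OF charts_atD(1)[OF c]]])
    then have "smooth_on (I \<inter> (\<lambda>t. base_point (C t)) -` fst c) (\<lambda>t. time_coord (C t))"
      by (simp add: snd_ext_chart)
    then show "\<exists>N. openin (top_of_set I) N \<and> t \<in> N \<and> smooth_on N (\<lambda>t. time_coord (C t))"
      using sm(1)[OF charts_atD(1)[OF c]] t charts_atD(2)[OF c] by blast
  qed
  have "smooth_on (I \<inter> (\<lambda>t. base_point (C t)) -` fst c) (snd c \<circ> (\<lambda>t. base_point (C t)))"
    if c: "c \<in> A" for c
  proof -
    have "smooth_on (I \<inter> (\<lambda>t. base_point (C t)) -` fst c) (\<lambda>t. fst (fst ((snd (xc c) \<circ> C) t)))"
      by (rule smooth_on_bounded_linear[OF bounded_linear_compose[OF bounded_linear_fst bounded_linear_fst] sm(2)[OF c]])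
    then show ?thesis by (simp add: snd_ext_chart o_def)
  qed
  moreover have "(\<lambda>t. base_point (C t)) ` I \<subseteq> points A"
    using pts by (auto simp: mem_points_ext)
  ultimately show "smooth_curve A I (\<lambda>t. base_point (C t))"
    unfolding smooth_curve_iff using I sm(1) by blast
  assume t: "t \<in> I"
  obtain c where c: "c \<in> charts_at A (base_point (C t))" by (rule ext_chart_exists[OF pts[OF t]])
  note vel = ext.smooth_curve_velocity[OF C t ext_charts_at[OF pts[OF t] c]]
  show "((\<lambda>t. time_coord (C t)) has_vector_derivative ds (C t) (velocity TA I C t)) (at t within I)"
    using vel(3)[OF chart_derivative_time_coord(1)[OF c pts[OF t]]]
    by (simp add: ds_form_def o_def)
  assume d: "d \<in> charts_at A (base_point (C t))"
  show "((\<lambda>t. snd d (base_point (C t))) has_vector_derivative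
        tangent_map TA A base_point (C t) (velocity TA I C t) d) (at t within I)"
    using vel(3)[OF chart_derivative_base_point(1)[OF c d pts[OF t]]] d
    by (simp add: tangent_map_def o_def)
qed

text \<open>The chain rule for the base curve, written as \<open>c\<close> after the time
  coordinate, in a single chart; one chart determines a tangent vector.\<close>

lemma base_curve_velocity:
  assumes C: "smooth_curve TA I C" and c: "smooth_curve A (\<tau> ` I) c" and t: "t \<in> I"
    and \<tau>: "\<And>t. t \<in> I \<Longrightarrow> \<tau> t = time_coord (C t)" and cb: "\<And>t. t \<in> I \<Longrightarrow> c (\<tau> t) = base_point (C t)"
  shows "tangent_map TA A base_point (C t) (velocity TA I C t) =
    ds (C t) (velocity TA I C t) *\<^sub>R velocity A (\<tau> ` I) c (\<tau> t)"
proof -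
  have m: "C t \<in> points TA" using C t unfolding smooth_curve_iff by blast
  have I: "is_interval I" "interior I \<noteq> {}" using C unfolding smooth_curve_iff by blast+
  obtain d where d: "d \<in> charts_at A (base_point (C t))" by (rule ext_chart_exists[OF m])
  have V: "velocity TA I C t \<in> tangent_space TA (C t)"
    by (rule ext.smooth_curve_velocity(1)[OF C t ext_charts_at[OF m d]])
  have st: "\<tau> t \<in> \<tau> ` I" using t by blast
  have dc: "d \<in> charts_at A (c (\<tau> t))" using d cb[OF t] by simp
  note vel = base.smooth_curve_velocity[OF c st dc]
  have "(\<tau> has_vector_derivative ds (C t) (velocity TA I C t)) (at t within I)"
    by (rule has_vector_derivative_transform[OF t _ smooth_curve_time_base(3)[OF C t]]) (rule \<tau>)
  from vector_diff_chain_within[OF this vel(2)]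
  have "((snd d \<circ> c \<circ> \<tau>) has_vector_derivative
      ds (C t) (velocity TA I C t) *\<^sub>R velocity A (\<tau> ` I) c (\<tau> t) d) (at t within I)" .
  then have 1: "((\<lambda>t. snd d (base_point (C t))) has_vector_derivative
      ds (C t) (velocity TA I C t) *\<^sub>R velocity A (\<tau> ` I) c (\<tau> t) d) (at t within I)"
    by (rule has_vector_derivative_transform[OF t, rotated]) (simp add: cb)
  have "tangent_map TA A base_point (C t) (velocity TA I C t) d =
      ds (C t) (velocity TA I C t) *\<^sub>R velocity A (\<tau> ` I) c (\<tau> t) d"
    by (rule vector_derivative_unique_within[OF at_within_interval_nontrivial[OF I t]
        smooth_curve_time_base(4)[OF C t d] 1])
  moreover have "tangent_map TA A base_point (C t) (velocity TA I C t) \<in> tangent_space A (base_point (C t))"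
    unfolding tangent_map_base_point[OF d m V] by (rule base.coord_vector_in_tangent_space[OF d])
  moreover have "ds (C t) (velocity TA I C t) *\<^sub>R velocity A (\<tau> ` I) c (\<tau> t) \<in> tangent_space A (base_point (C t))"
    using subspace_scale[OF base.subspace_tangent_space vel(1)] unfolding cb[OF t] .
  ultimately show ?thesis
    by (intro base.tangent_space_eqI[OF _ _ d]) (simp_all add: scaleR_fun_def)
qed

text \<open>Time itself serves as the parameter. Since ds is nonzero on the velocity, time can be
  inverted along the curve; \<eta> = 0 makes the projected velocity ds times the fibre vector, and
  cancelling ds identifies the fibre vector with the velocity of the base curve.\<close>

lemma holonomicI:
  assumes C: "smooth_curve TA I C"
    and eta: "\<And>t i. t \<in> I \<Longrightarrow> eta i (C t) (velocity TA I C t) = 0"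
    and nz: "\<And>t. t \<in> I \<Longrightarrow> ds (C t) (velocity TA I C t) \<noteq> 0"
  shows "holonomic A I C"
proof -
  define \<tau> where "\<tau> = (\<lambda>t. time_coord (C t))"
  define c where "c = (\<lambda>t. base_point (C t)) \<circ> inv_into I \<tau>"
  have I: "is_interval I" "interior I \<noteq> {}" using C unfolding smooth_curve_iff by blast+
  have sm: "smooth_on I \<tau>" unfolding \<tau>_def by (rule smooth_curve_time_base(1)[OF C])
  have "vector_derivative \<tau> (at t within I) = ds (C t) (velocity TA I C t)" if t: "t \<in> I" for t
    using vector_derivative_within[OF at_within_interval_nontrivial[OF I t] smooth_curve_time_base(3)[OF C t]]
    unfolding \<tau>_def .
  then have nz': "vector_derivative \<tau> (at t within I) \<noteq> 0" if "t \<in> I" for t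
    using nz[OF that] that by simp
  have inj: "inj_on \<tau> I" and cJ: "smooth_curve A (\<tau> ` I) c"
    unfolding c_def using smooth_curve_reparametrize[OF I sm nz' smooth_curve_time_base(2)[OF C]] by blast+
  have mono: "strict_mono_on I \<tau> \<or> strict_antimono_on I \<tau>"
    using injective_eq_monotone_map[OF I(1) smooth_on_continuous[OF sm]] inj by blast
  have cb: "c (\<tau> t) = base_point (C t)" if "t \<in> I" for t
    using inj that by (simp add: c_def)
  have "C t = lift_curve A (\<tau> ` I) c (\<tau> t)" if t: "t \<in> I" for t
  proof -
    have m: "C t \<in> points TA" using C t unfolding smooth_curve_iff by blast
    obtain d where d: "d \<in> charts_at A (base_point (C t))" by (rule ext_chart_exists[OF m])
    have V: "velocity TA I C t \<in> tangent_space TA (C t)"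
      by (rule ext.smooth_curve_velocity(1)[OF C t ext_charts_at[OF m d]])
    have "tangent_map TA A base_point (C t) (velocity TA I C t) =
        ds (C t) (velocity TA I C t) *\<^sub>R fibre_vector (C t)"
      using eta_zero_iff[OF m V] eta[OF t] by blast
    from trans[OF sym[OF this] base_curve_velocity[OF C cJ t \<tau>_def[THEN fun_cong] cb]]
    have "ds (C t) (velocity TA I C t) *\<^sub>R fibre_vector (C t) =
        ds (C t) (velocity TA I C t) *\<^sub>R velocity A (\<tau> ` I) c (\<tau> t)" .
    then have "fibre_vector (C t) = velocity A (\<tau> ` I) c (\<tau> t)"
      using nz[OF t] by simp
    then show ?thesis
      unfolding lift_curve_def cb[OF t] using ext_point_eq[of "C t"] by (simp add: \<tau>_def)
  qed
  then show ?thesis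
    unfolding holonomic_def using sm mono nz' cJ by blast
qed

text \<open>The form of a lift forces the reparametrization to be the time coordinate, so its
  derivative is ds of the velocity.\<close>

lemma holonomicD:
  assumes C: "smooth_curve TA I C" and hol: "holonomic A I C" and t: "t \<in> I"
  shows "eta i (C t) (velocity TA I C t) = 0" "ds (C t) (velocity TA I C t) \<noteq> 0"
proof -
  obtain \<tau> c where nz: "\<forall>t\<in>I. vector_derivative \<tau> (at t within I) \<noteq> 0" and cJ: "smooth_curve A (\<tau> ` I) c"
    and lift: "\<forall>t\<in>I. C t = lift_curve A (\<tau> ` I) c (\<tau> t)"
    using hol unfolding holonomic_def by blast
  have I: "is_interval I" "interior I \<noteq> {}" using C unfolding smooth_curve_iff by blast+
  have m: "C t \<in> points TA" using C t unfolding smooth_curve_iff by blast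
  obtain d where d: "d \<in> charts_at A (base_point (C t))" by (rule ext_chart_exists[OF m])
  have V: "velocity TA I C t \<in> tangent_space TA (C t)"
    by (rule ext.smooth_curve_velocity(1)[OF C t ext_charts_at[OF m d]])
  have \<tau>: "\<tau> u = time_coord (C u)" and cb: "c (\<tau> u) = base_point (C u)"
    and fib: "velocity A (\<tau> ` I) c (\<tau> u) = fibre_vector (C u)" if "u \<in> I" for u
    using bspec[OF lift that] by (simp_all add: lift_curve_def time_coord_def base_point_def fibre_vector_def)
  have "tangent_map TA A base_point (C t) (velocity TA I C t) = ds (C t) (velocity TA I C t) *\<^sub>R fibre_vector (C t)"
    using base_curve_velocity[OF C cJ t \<tau> cb] fib[OF t] by simp
  then show "eta i (C t) (velocity TA I C t) = 0"
    using eta_zero_iff[OF m V] by blast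
  have "(\<tau> has_vector_derivative ds (C t) (velocity TA I C t)) (at t within I)"
    by (rule has_vector_derivative_transform[OF t _ smooth_curve_time_base(3)[OF C t]]) (rule \<tau>)
  from vector_derivative_within[OF at_within_interval_nontrivial[OF I t] this] nz t
  show "ds (C t) (velocity TA I C t) \<noteq> 0" by auto
qed

end

section \<open>Vortex lines through interior points\<close>

text \<open>If \<open>v0\<close> spans the kernel of the skew-symmetric matrix \<open>M\<close> at \<open>z0\<close>, then \<open>M + v0 v0\<^sup>T\<close> is
  invertible near \<open>z0\<close> and maps a kernel vector of \<open>M\<close> to \<open>v0\<close>, which makes that vector smooth
  by Cramer's rule.\<close>

lemma smooth_kernel_field:
  fixes D :: "'i::finite \<Rightarrow> 'i \<Rightarrow> 'e::euclidean_space \<Rightarrow> real"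
  assumes "open Z" "z0 \<in> Z" and D: "\<And>k l. Cinf_on (D k l) Z"
    and skew: "\<And>k l z. D k l z = - D l k z"
    and ker: "\<And>z. z \<in> Z \<Longrightarrow> \<exists>v. v \<noteq> 0 \<and> (\<forall>w. (\<chi> k l. D k l z) *v w = 0 \<longleftrightarrow> (\<exists>r. w = r *\<^sub>R v))"
  obtains Z' u where "open Z'" "z0 \<in> Z'" "Z' \<subseteq> Z" "Cinf_on u Z'"
    "\<And>z. z \<in> Z' \<Longrightarrow> (\<chi> k l. D k l z) *v u z = 0 \<and> u z \<noteq> 0"
proof -
  define M where "M = (\<lambda>z. \<chi> k l. D k l z)"
  obtain v0 where v0: "v0 \<noteq> 0" "\<And>w. M z0 *v w = 0 \<longleftrightarrow> (\<exists>r. w = r *\<^sub>R v0)"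
    using ker[OF \<open>z0 \<in> Z\<close>] unfolding M_def by blast
  have Mv0: "M z0 *v v0 = 0"
    unfolding v0(2) by (rule exI[of _ 1]) simp
  define N where "N = (\<lambda>z. \<chi> k l. D k l z + v0 $ k * v0 $ l)"
  have N_mult: "N z *v w = M z *v w + (v0 \<bullet> w) *\<^sub>R v0" for z w
    by (simp add: vec_eq_iff N_def M_def matrix_vector_mult_def inner_vec_def sum.distrib
        distrib_left sum_distrib_left mult_ac)
  have skewM: "x \<bullet> (M z *v y) = - ((M z *v x) \<bullet> y)" for x y z
  proof -
    have "transpose (M z) = - M z"
      by (simp add: vec_eq_iff M_def transpose_def) (intro allI, rule skew)
    then have "x \<bullet> (M z *v y) = (- M z *v x) \<bullet> y"
      using transpose_matrix_vector[of "M z" x] dot_lmul_matrix[of x "M z" y] by (simp only:)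
    also have "- M z *v x = - (M z *v x)"
      by (simp add: vec_eq_iff matrix_vector_mult_def sum_negf)
    finally show ?thesis by simp
  qed
  have "inj ((*v) (N z0))"
  proof (rule linear_injective_0[THEN iffD2, OF matrix_vector_mul_linear], intro allI impI)
    fix w assume w: "N z0 *v w = 0"
    \<comment> \<open>The part with \<open>M\<close> drops out, since skew symmetry moves
      \<open>M\<close> onto its kernel vector \<open>v0\<close>. Hence the kernel of
      \<open>N z0\<close> is orthogonal to \<open>v0\<close> and also a multiple of it.\<close>
    have "v0 \<bullet> (N z0 *v w) = (v0 \<bullet> w) * (v0 \<bullet> v0)"
      unfolding N_mult by (simp add: inner_add_right skewM Mv0)
    then have vw: "v0 \<bullet> w = 0" using v0(1) by (simp add: w)
    then have "M z0 *v w = 0" using w unfolding N_mult by simp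
    then obtain r where "w = r *\<^sub>R v0" unfolding v0(2) by blast
    then show "w = 0" using vw v0(1) by simp
  qed
  then have det0: "det (N z0) \<noteq> 0"
    unfolding invertible_det_nz[symmetric] invertible_left_inverse matrix_left_invertible_injective .
  define Z' where "Z' = Z \<inter> (\<lambda>z. det (N z)) -` (- {0})"
  have detN: "Cinf_on (\<lambda>z. det (N z)) Z"
    unfolding N_def by (intro Cinf_on_det Cinf_on_add D Cinf_on_const \<open>open Z\<close>)
  have open_Z': "open Z'"
    unfolding Z'_def by (intro continuous_open_preimage Cinf_on_continuous[OF detN] \<open>open Z\<close>) auto
  have "Z' \<subseteq> Z" by (auto simp: Z'_def)
  have det: "det (N z) \<noteq> 0" if "z \<in> Z'" for z using that by (simp add: Z'_def)
  define u where "u = (\<lambda>z. SOME w. N z *v w = v0)"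
  have u: "N z *v u z = v0" if "z \<in> Z'" for z
    unfolding u_def
  proof (rule someI_ex)
    have "invertible (N z)" using det[OF that] by (simp add: invertible_det_nz)
    then obtain K where "N z ** K = mat 1" by (auto simp: invertible_def)
    then have "N z *v (K *v v0) = v0" by (simp add: matrix_vector_mul_assoc)
    then show "\<exists>w. N z *v w = v0" by blast
  qed
  have "Cinf_on u Z'"
  proof (rule Cinf_on_linear_solution[OF open_Z'])
    show "Cinf_on (\<lambda>z. D k l z + v0 $ k * v0 $ l) Z'" for k l
      by (intro Cinf_on_add Cinf_on_subset[OF D \<open>Z' \<subseteq> Z\<close>] Cinf_on_const open_Z')
    show "Cinf_on (\<lambda>z. v0 $ k) Z'" for k by (rule Cinf_on_const)
    show "det (\<chi> k l. D k l z + v0 $ k * v0 $ l) \<noteq> 0" if "z \<in> Z'" for z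
      using det[OF that] unfolding N_def .
    show "(\<chi> k l. D k l z + v0 $ k * v0 $ l) *v u z = (\<chi> k. v0 $ k)" if "z \<in> Z'" for z
      using u[OF that] unfolding N_def by simp
  qed
  moreover have "(\<chi> k l. D k l z) *v u z = 0 \<and> u z \<noteq> 0" if z: "z \<in> Z'" for z
  proof
    have "z \<in> Z" using z \<open>Z' \<subseteq> Z\<close> by blast
    then obtain v where v: "v \<noteq> 0" "\<And>w. M z *v w = 0 \<longleftrightarrow> (\<exists>r. w = r *\<^sub>R v)"
      using ker unfolding M_def by blast
    have Mv: "M z *v v = 0"
      unfolding v(2) by (rule exI[of _ 1]) simp
    have inj: "inj ((*v) (N z))"
      using det[OF z] unfolding invertible_det_nz[symmetric] invertible_left_inverse
        matrix_left_invertible_injective .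
    have Nv: "N z *v v = (v0 \<bullet> v) *\<^sub>R v0" unfolding N_mult Mv by simp
    \<comment> \<open>A kernel vector of \<open>M\<close> orthogonal to \<open>v0\<close> would be
      killed by \<open>N\<close> as well. Dividing by this product identifies \<open>u z\<close> as
      a multiple of \<open>v\<close>.\<close>
    have nz: "v0 \<bullet> v \<noteq> 0"
    proof
      assume "v0 \<bullet> v = 0"
      then have "N z *v v = N z *v 0" by (simp add: Nv)
      from injD[OF inj this] v(1) show False by simp
    qed
    have "N z *v v = N z *v ((v0 \<bullet> v) *\<^sub>R u z)"
      unfolding Nv by (simp add: matrix_vector_mult_scaleR u[OF z])
    then have "v = (v0 \<bullet> v) *\<^sub>R u z" by (rule injD[OF inj])
    then obtain r where r: "r \<noteq> 0" "v = r *\<^sub>R u z" using nz by blast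
    then have "u z = (1 / r) *\<^sub>R v" by simp
    then show "(\<chi> k l. D k l z) *v u z = 0" using v(2) unfolding M_def by blast
    show "u z \<noteq> 0" using u[OF z] v0(1) by auto
  qed
  ultimately show ?thesis
    using that[OF open_Z' _ \<open>Z' \<subseteq> Z\<close>] det0 \<open>z0 \<in> Z\<close> by (simp add: Z'_def)
qed

text \<open>Cramer's rule needs a vector type \<open>real ^ 'i\<close>; \<open>pack\<close> identifies one with the model space of the
  extended tangent bundle.\<close>

definition pack :: "real ^ (('n + 'n) + unit) \<Rightarrow> ((real ^ 'n::finite) \<times> (real ^ 'n)) \<times> real" where
  "pack u = ((\<chi> i. u $ Inl (Inl i), \<chi> i. u $ Inl (Inr i)), u $ Inr ())"

lemma linear_pack: "linear pack"
  by (rule linearI) (simp_all add: pack_def vec_eq_iff)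

lemma bij_pack: "bij (pack :: real ^ (('n::finite + 'n) + unit) \<Rightarrow> _)"
proof (rule bijI)
  show "inj (pack :: real ^ (('n + 'n) + unit) \<Rightarrow> _)"
  proof (rule injI)
    fix u v :: "real ^ (('n + 'n) + unit)" assume eq: "pack u = pack v"
    show "u = v"
      unfolding vec_eq_iff
    proof
      fix k :: "('n + 'n) + unit"
      show "u $ k = v $ k"
      proof (cases k)
        case (Inl j)
        then show ?thesis using eq by (cases j) (simp_all add: pack_def vec_eq_iff)
      next
        case (Inr j)
        then show ?thesis using eq by (simp add: pack_def)
      qed
    qed
  qed
  have "\<exists>u. \<omega> = pack u" for \<omega> :: "((real ^ 'n) \<times> (real ^ 'n)) \<times> real"
    by (rule exI[of _ "\<chi> k. case k of Inl (Inl i) \<Rightarrow> fst (fst \<omega>) $ i | Inl (Inr i) \<Rightarrow> snd (fst \<omega>) $ i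
        | Inr _ \<Rightarrow> snd \<omega>"]) (simp add: pack_def prod_eq_iff vec_eq_iff)
  then show "surj (pack :: real ^ (('n + 'n) + unit) \<Rightarrow> _)" unfolding surj_def by blast
qed

lemma linear_pack_expand:
  assumes "linear (f :: _ \<Rightarrow> real)"
  shows "f (pack u) = (\<Sum>k\<in>UNIV. u $ k * f (pack (axis k 1)))"
proof -
  have "u = (\<Sum>k\<in>UNIV. u $ k *\<^sub>R axis k 1)"
    using basis_expansion[of u] by (simp only: scalar_mult_eq_scaleR)
  then have "f (pack u) = f (pack (\<Sum>k\<in>UNIV. u $ k *\<^sub>R axis k 1))" by (rule arg_cong)
  also have "\<dots> = (\<Sum>k\<in>UNIV. u $ k * f (pack (axis k 1)))"
    by (simp add: linear_sum[OF linear_pack] linear_scale[OF linear_pack] linear_sum[OF assms]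
        linear_scale[OF assms])
  finally show ?thesis .
qed

section \<open>The form d\<Theta> in chart coordinates at interior times\<close>

context lagrangian
begin

text \<open>The value of \<Theta> on the vector field with constant coordinates \<omega>, as a
  function of the coordinates of the point.\<close>

definition coef :: "('q, real ^ 'n) chart \<Rightarrow> ((real ^ 'n) \<times> (real ^ 'n)) \<times> real \<Rightarrow>
    ((real ^ 'n) \<times> (real ^ 'n)) \<times> real \<Rightarrow> real" where
  "coef c \<omega> z = Theta (chart_inv (xc c) z) (coord_vector TA (xc c) \<omega> (chart_inv (xc c) z))"

text \<open>The coordinate expression of d\<Theta> on two constant fields. It uses derivatives in
  the full space, so it represents d\<Theta> on the open set \<open>int_image\<close> only.\<close>

definition dcoef :: "('q, real ^ 'n) chart \<Rightarrow> ((real ^ 'n) \<times> (real ^ 'n)) \<times> real \<Rightarrow>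
    ((real ^ 'n) \<times> (real ^ 'n)) \<times> real \<Rightarrow> ((real ^ 'n) \<times> (real ^ 'n)) \<times> real \<Rightarrow> real" where
  "dcoef c \<omega> \<omega>' z = frechet_derivative (coef c \<omega>') (at z) \<omega> - frechet_derivative (coef c \<omega>) (at z) \<omega>'"

abbreviation int_image :: "('q, real ^ 'n) chart \<Rightarrow> (((real ^ 'n) \<times> (real ^ 'n)) \<times> real) set" where
  "int_image c \<equiv> (snd c ` fst c \<times> UNIV) \<times> {a<..<b}"

lemma open_int_image: "c \<in> A \<Longrightarrow> open (int_image c)"
  using open_chart_image by (intro open_Times) auto

lemma ext_chart_point:
  assumes c: "c \<in> A" and z: "z \<in> (snd c ` fst c \<times> UNIV) \<times> {a..b}"
  shows "chart_inv (xc c) z \<in> points TA" "chart_inv (xc c) z \<in> fst (xc c)"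
    "c \<in> charts_at A (base_point (chart_inv (xc c) z))" "snd (xc c) (chart_inv (xc c) z) = z"
proof -
  have "xc c \<in> TA" using c by (simp add: ext_tangent_atlas_eq)
  obtain k where k: "k \<in> fst (xc c)" "z = snd (xc c) k"
    using z unfolding ext_chart_image_self[OF c, symmetric] by blast
  have inv: "chart_inv (xc c) z = k"
    unfolding k(2) by (rule ext.chart_inv_chart[OF \<open>xc c \<in> TA\<close> k(1)])
  show "chart_inv (xc c) z \<in> fst (xc c)" "snd (xc c) (chart_inv (xc c) z) = z"
    using k inv by simp_all
  show "chart_inv (xc c) z \<in> points TA"
    unfolding inv points_def using k(1) \<open>xc c \<in> TA\<close> by blast
  show "c \<in> charts_at A (base_point (chart_inv (xc c) z))"
    unfolding inv using k(1) c by (simp add: mem_ext_chart charts_at_def)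
qed

lemma int_image_subset: "z \<in> int_image c \<Longrightarrow> z \<in> (snd c ` fst c \<times> UNIV) \<times> {a..b}"
  by auto

lemma chart_derivative_interior:
  assumes c: "c \<in> A" and z: "z \<in> int_image c"
  shows "chart_derivative (xc c) F (chart_inv (xc c) z) = frechet_derivative (F \<circ> chart_inv (xc c)) (at z)"
proof -
  note p = ext_chart_point[OF c int_image_subset[OF z]]
  have "at z within (snd c ` fst c \<times> UNIV) \<times> {a..b} = at z"
    using z open_int_image[OF c] by (rule at_within_open_subset) auto
  then show ?thesis
    unfolding chart_derivative_def[abs_def] p(4) ext_chart_image_self[OF c] by simp
qed

lemma dTheta_interior:
  assumes c: "c \<in> A" and z: "z \<in> int_image c"
  shows "dTheta (chart_inv (xc c) z) (coord_vector TA (xc c) \<omega> (chart_inv (xc c) z))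
    (coord_vector TA (xc c) \<omega>' (chart_inv (xc c) z)) = dcoef c \<omega> \<omega>' z"
proof -
  note p = ext_chart_point[OF c int_image_subset[OF z]]
  note C = ext_charts_at[OF p(1,3)]
  note T = ext.coord_vector_in_tangent_space[OF C]
  have "(\<lambda>x. Theta x (coord_vector TA (xc c) \<omega> x)) \<circ> chart_inv (xc c) = coef c \<omega>" for \<omega>
    by (rule ext) (simp add: coef_def)
  then show ?thesis
    unfolding dTheta_chart[OF p(3,1) T T] ext.coord_vector_chart[OF C]
      chart_derivative_interior[OF c z] dcoef_def by simp
qed

lemma Cinf_on_coef:
  assumes c: "c \<in> A"
  shows "Cinf_on (coef c \<omega>) (int_image c)"
proof (rule Cinf_on_cong[OF _ open_int_image[OF c]])
  let ?O = "snd c ` fst c"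
  note op = open_int_image[OF c]
  have F: "Cinf_on (F \<circ> chart_inv (xc c)) (int_image c)" if "smooth_function (ext_model a b) TA F" for F
    by (rule smooth_on_imp_Cinf_on[OF smooth_on_subset[OF smooth_function_chart[OF that c]] op]) auto
  have proj: "Cinf_on (\<lambda>z. coframe_chart c i (fst (fst z)) w) (int_image c)" for i w
    by (rule Cinf_on_compose[OF op open_chart_image[OF c] _ Cinf_on_coframe_chart[OF c]])
      (auto intro!: Cinf_on_fst Cinf_on_id op)
  have fib: "Cinf_on (\<lambda>z :: ((real ^ 'n) \<times> (real ^ 'n)) \<times> real. snd (fst z) $ k) (int_image c)" for k
    by (intro Cinf_on_nth Cinf_on_snd Cinf_on_fst Cinf_on_id op)
  \<comment> \<open>Linearity in the fibre coordinates gives joint smoothness from smoothness in the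
    base coordinates alone.\<close>
  let ?xi = "\<lambda>i z. \<Sum>k\<in>UNIV. snd (fst z) $ k * coframe_chart c i (fst (fst z)) (axis k 1)"
  let ?f = "\<lambda>z. (L \<circ> chart_inv (xc c)) z * snd \<omega> + (\<Sum>i\<in>UNIV. (p i \<circ> chart_inv (xc c)) z *
    (coframe_chart c i (fst (fst z)) (fst (fst \<omega>)) - ?xi i z * snd \<omega>))"
  show "Cinf_on ?f (int_image c)"
    by (intro Cinf_on_add Cinf_on_sum Cinf_on_mult Cinf_on_diff op Cinf_on_const proj fib
        F[OF smooth_L] F[OF smooth_p])
  fix z assume z: "z \<in> int_image c"
  note q = ext_chart_point[OF c int_image_subset[OF z]]
  have base: "snd c (base_point (chart_inv (xc c) z)) = fst (fst z)"
    and fib: "fibre_vector (chart_inv (xc c) z) c = snd (fst z)"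
    using arg_cong[OF q(4), of "\<lambda>w. fst (fst w)"] arg_cong[OF q(4), of "\<lambda>w. snd (fst w)"]
    by (simp_all add: snd_ext_chart)
  have "xi i (chart_inv (xc c) z) = ?xi i z" for i
    unfolding xi_eq[OF q(3,1)] base fib
    by (rule coframe_chart_expand[OF c]) (use z in auto)
  then show "?f z = coef c \<omega> z"
    unfolding coef_def Theta_coord_vector[OF q(3,1)] base by simp
qed

lemma Cinf_on_dcoef: "c \<in> A \<Longrightarrow> Cinf_on (dcoef c \<omega> \<omega>') (int_image c)"
  unfolding dcoef_def by (intro Cinf_on_diff Cinf_on_frechet_derivative Cinf_on_coef Cinf_on_const open_int_image)

lemma linear_dcoef:
  assumes c: "c \<in> A" and z: "z \<in> int_image c"
  shows "linear (\<lambda>\<omega>'. dcoef c \<omega> \<omega>' z)"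
proof -
  note q = ext_chart_point[OF c int_image_subset[OF z]]
  note C = ext_charts_at[OF q(1,3)]
  note T = ext.coord_vector_in_tangent_space[OF C]
  note lin = ext.linear_coord_vector[OF C] and dl = dTheta_linear[OF q(1) T]
  show ?thesis
    unfolding dTheta_interior[OF assms, symmetric]
    by (rule linearI) (simp_all add: linear_add[OF lin] linear_scale[OF lin]
        linear_fun_on_add[OF dl T T] linear_fun_on_scale[OF dl ext.subspace_tangent_space T])
qed

lemma null_space_dcoef:
  assumes c: "c \<in> A" and z: "z \<in> int_image c"
  shows "coord_vector TA (xc c) \<omega> (chart_inv (xc c) z) \<in> null_space TA dTheta (chart_inv (xc c) z) \<longleftrightarrow>
    (\<forall>\<omega>'. dcoef c \<omega> \<omega>' z = 0)"
proof -
  note q = ext_chart_point[OF c int_image_subset[OF z]]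
  note C = ext_charts_at[OF q(1,3)]
  note T = ext.coord_vector_in_tangent_space[OF C]
  have "(\<forall>W\<in>tangent_space TA (chart_inv (xc c) z).
      dTheta (chart_inv (xc c) z) (coord_vector TA (xc c) \<omega> (chart_inv (xc c) z)) W = 0) \<longleftrightarrow>
    (\<forall>\<omega>'. dcoef c \<omega> \<omega>' z = 0)"
  proof (intro iffI ballI allI)
    fix W assume W: "W \<in> tangent_space TA (chart_inv (xc c) z)" and 0: "\<forall>\<omega>'. dcoef c \<omega> \<omega>' z = 0"
    from dTheta_interior[OF assms, of \<omega> "W (xc c)"] 0
    show "dTheta (chart_inv (xc c) z) (coord_vector TA (xc c) \<omega> (chart_inv (xc c) z)) W = 0"
      unfolding ext.coord_vector_eq[OF W C] by simp
  next
    fix \<omega>' assume 0: "\<forall>W\<in>tangent_space TA (chart_inv (xc c) z).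
      dTheta (chart_inv (xc c) z) (coord_vector TA (xc c) \<omega> (chart_inv (xc c) z)) W = 0"
    show "dcoef c \<omega> \<omega>' z = 0"
      unfolding dTheta_interior[OF assms, symmetric] by (rule bspec[OF 0 T])
  qed
  then show ?thesis unfolding null_space_def using T by simp
qed

text \<open>The column index stands in the first slot of the form, so that multiplication by
  \<open>u\<close> inserts \<open>pack u\<close> there.\<close>

lemma dcoef_kernel:
  assumes c: "c \<in> A" and z: "z \<in> int_image c"
  shows "(\<chi> k l. dcoef c (pack (axis l 1)) (pack (axis k 1)) z) *v u = 0 \<longleftrightarrow> (\<forall>\<omega>'. dcoef c (pack u) \<omega>' z = 0)"
proof -
  have anti: "dcoef c \<omega> \<omega>' z = - dcoef c \<omega>' \<omega> z" for \<omega> \<omega>' by (simp add: dcoef_def)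
  have "((\<chi> k l. dcoef c (pack (axis l 1)) (pack (axis k 1)) z) *v u) $ k = dcoef c (pack u) (pack (axis k 1)) z" for k
  proof -
    have 1: "dcoef c (pack (axis k 1)) (pack u) z = (\<Sum>l\<in>UNIV. u $ l * dcoef c (pack (axis k 1)) (pack (axis l 1)) z)"
      by (rule linear_pack_expand[OF linear_dcoef[OF assms]])
    have 2: "u $ l * dcoef c (pack (axis k 1)) (pack (axis l 1)) z =
        - (dcoef c (pack (axis l 1)) (pack (axis k 1)) z * u $ l)" for l
      by (subst anti) simp
    have "dcoef c (pack u) (pack (axis k 1)) z = (\<Sum>l\<in>UNIV. dcoef c (pack (axis l 1)) (pack (axis k 1)) z * u $ l)"
      by (subst anti, subst 1) (simp add: 2 sum_negf)
    then show ?thesis by (simp add: matrix_vector_mult_def)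
  qed
  then have "(\<chi> k l. dcoef c (pack (axis l 1)) (pack (axis k 1)) z) *v u = 0 \<longleftrightarrow>
      (\<forall>k. dcoef c (pack u) (pack (axis k 1)) z = 0)"
    by (simp only: vec_eq_iff zero_index)
  also have "\<dots> \<longleftrightarrow> (\<forall>\<omega>'. dcoef c (pack u) \<omega>' z = 0)"
  proof (intro iffI allI)
    fix \<omega>' :: "((real ^ 'n) \<times> (real ^ 'n)) \<times> real"
    assume 0: "\<forall>k. dcoef c (pack u) (pack (axis k 1)) z = 0"
    obtain w where "\<omega>' = pack w" using bij_is_surj[OF bij_pack] by (rule surjE)
    then show "dcoef c (pack u) \<omega>' z = 0"
      using linear_pack_expand[OF linear_dcoef[OF assms], of "pack u" w] 0 by simp
  qed blast
  finally show ?thesis .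
qed

text \<open>In a chart the null direction has a smooth generator near an interior point; its
  integral curve, carried back to the bundle, is the desired line.\<close>

lemma vortex_line_through:
  assumes nonsing: "nonsingular_form TA dTheta" and m: "m \<in> points TA" and s: "time_coord m \<in> {a<..<b}"
  obtains I C where "vortex_line TA Theta I C" "(0::real) \<in> I" "C 0 = m"
proof -
  obtain c where c: "c \<in> charts_at A (base_point m)" by (rule ext_chart_exists[OF m])
  have cA: "c \<in> A" by (rule charts_atD(1)[OF c])
  have xcT: "xc c \<in> TA" using cA by (simp add: ext_tangent_atlas_eq)
  define z0 where "z0 = snd (xc c) m"
  have z0: "z0 \<in> int_image c"
    using base_point_in_chart[OF c] s by (simp add: z0_def snd_ext_chart)
  have m_z0: "chart_inv (xc c) z0 = m"
    unfolding z0_def by (rule ext.chart_inv_chart[OF charts_atD[OF ext_charts_at[OF m c]]])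
  let ?D = "\<lambda>k l. dcoef c (pack (axis l 1)) (pack (axis k 1))"
  \<comment> \<open>Nonsingularity in coordinates: a basis of the null space has one element, and
    its coordinates span the kernel of the matrix.\<close>
  have ker: "\<exists>v. v \<noteq> 0 \<and> (\<forall>w. (\<chi> k l. ?D k l z) *v w = 0 \<longleftrightarrow> (\<exists>r. w = r *\<^sub>R v))"
    if z: "z \<in> int_image c" for z
  proof -
    note q = ext_chart_point[OF cA int_image_subset[OF z]]
    note C = ext_charts_at[OF q(1,3)]
    let ?n = "chart_inv (xc c) z"
    let ?cv = "\<lambda>\<omega>. coord_vector TA (xc c) \<omega> ?n"
    have "dim (null_space TA dTheta ?n) = 1"
      using nonsing q(1) unfolding nonsingular_form_def by blast
    then obtain Bs where Bs: "Bs \<subseteq> null_space TA dTheta ?n" "independent Bs"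
      "null_space TA dTheta ?n \<subseteq> span Bs" "card Bs = 1"
      using basis_exists[of "null_space TA dTheta ?n"] by metis
    then obtain V where V: "Bs = {V}" by (auto simp: card_1_singleton_iff)
    have "V \<noteq> 0" using Bs(2) V by auto
    have VT: "V \<in> tangent_space TA ?n" using Bs(1) V by (simp add: null_space_def)
    obtain v where v: "V (xc c) = pack v" using bij_is_surj[OF bij_pack] by (rule surjE)
    have cv: "?cv (pack v) = V" using ext.coord_vector_eq[OF VT C] unfolding v .
    note lin = ext.linear_coord_vector[OF C]
    have "v \<noteq> 0"
    proof
      assume "v = 0"
      then have "V = ?cv (pack 0)" using cv by simp
      then show False using \<open>V \<noteq> 0\<close> by (simp only: linear_0[OF linear_pack] linear_0[OF lin])
    qed
    moreover have "(\<chi> k l. ?D k l z) *v w = 0 \<longleftrightarrow> (\<exists>r. w = r *\<^sub>R v)" for w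
      unfolding dcoef_kernel[OF cA z] null_space_dcoef[OF cA z, symmetric]
    proof
      assume "?cv (pack w) \<in> null_space TA dTheta ?n"
      then have "?cv (pack w) \<in> span {V}" using Bs(3) V by blast
      then obtain r where "?cv (pack w) = r *\<^sub>R V" unfolding span_singleton by blast
      then have "?cv (pack w) (xc c) = r *\<^sub>R V (xc c)" by (simp add: scaleR_fun_def)
      then have "pack w = pack (r *\<^sub>R v)"
        unfolding ext.coord_vector_chart[OF C] v by (simp add: linear_scale[OF linear_pack])
      from injD[OF bij_is_inj[OF bij_pack] this] show "\<exists>r. w = r *\<^sub>R v" ..
    next
      assume "\<exists>r. w = r *\<^sub>R v"
      then obtain r where "w = r *\<^sub>R v" ..
      have "?cv (pack v) \<in> null_space TA dTheta ?n" unfolding cv using Bs(1) V by blast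
      then have "dcoef c (pack v) \<omega>' z = 0" for \<omega>'
        unfolding null_space_dcoef[OF cA z] by blast
      moreover have "dcoef c (r *\<^sub>R pack v) \<omega>' z = - dcoef c \<omega>' (r *\<^sub>R pack v) z" for \<omega>'
        by (simp add: dcoef_def)
      moreover have "dcoef c \<omega>' (r *\<^sub>R pack v) z = r * dcoef c \<omega>' (pack v) z" for \<omega>'
        using linear_scale[OF linear_dcoef[OF cA z]] by simp
      moreover have "dcoef c \<omega>' (pack v) z = - dcoef c (pack v) \<omega>' z" for \<omega>'
        by (simp add: dcoef_def)
      ultimately show "?cv (pack w) \<in> null_space TA dTheta ?n"
        unfolding null_space_dcoef[OF cA z] \<open>w = r *\<^sub>R v\<close> linear_scale[OF linear_pack] by simp
    qed
    ultimately show ?thesis by blast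
  qed
  obtain Z u where Z: "open Z" "z0 \<in> Z" "Z \<subseteq> int_image c" "Cinf_on u Z"
    and u: "\<And>z. z \<in> Z \<Longrightarrow> (\<chi> k l. ?D k l z) *v u z = 0 \<and> u z \<noteq> 0"
  proof (rule smooth_kernel_field[OF open_int_image[OF cA] z0, of ?D])
    show "Cinf_on (?D k l) (int_image c)" for k l by (rule Cinf_on_dcoef[OF cA])
    show "?D k l z = - ?D l k z" for k l z by (simp add: dcoef_def)
  qed (use ker in blast)+
  have "bounded_linear (pack :: real ^ (('n + 'n) + unit) \<Rightarrow> _)"
    by (rule linear_conv_bounded_linear[THEN iffD1, OF linear_pack])
  from Cinf_on_bounded_linear[OF this Z(1,4)] have X: "Cinf_on (\<lambda>z. pack (u z)) Z" .
  obtain h \<gamma> where h: "h > 0" "\<gamma> 0 = z0" and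
    \<gamma>: "\<And>t. \<bar>t\<bar> < h \<Longrightarrow> \<gamma> t \<in> Z \<and> (\<gamma> has_vector_derivative pack (u (\<gamma> t))) (at t)"
    using local_integral_curve[OF Z(1,2) X] by blast
  define I where "I = {- h<..<h}"
  have I: "open I" "is_interval I" "interior I \<noteq> {}" "0 \<in> I"
    using h(1) by (auto simp: I_def interior_open is_interval_1)
  have \<gamma>': "\<gamma> t \<in> Z" "(\<gamma> has_vector_derivative pack (u (\<gamma> t))) (at t)" if "t \<in> I" for t
    using \<gamma>[of t] that by (auto simp: I_def)
  have smooth: "Cinf_on \<gamma> I" by (rule Cinf_on_integral_curve[OF I(1) Z(1) X \<gamma>'])
  define C where "C = (\<lambda>t. chart_inv (xc c) (\<gamma> t))"
  have im: "\<gamma> t \<in> int_image c" if "t \<in> I" for t using \<gamma>'(1)[OF that] Z(3) by blast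
  have q: "C t \<in> points TA" "C t \<in> fst (xc c)" "c \<in> charts_at A (base_point (C t))"
    "snd (xc c) (C t) = \<gamma> t" if "t \<in> I" for t
    using ext_chart_point[OF cA int_image_subset[OF im[OF that]]] by (simp_all add: C_def)
  have curve: "smooth_curve TA I C"
    unfolding smooth_curve_iff
  proof (intro conjI ballI)
    show "C ` I \<subseteq> points TA" using q(1) by blast
    \<comment> \<open>A smooth curve must be smooth in every chart, so the curve built in one chart
      is followed through the transition to the others.\<close>
    fix e assume "e \<in> TA"
    then obtain d where d: "d \<in> A" and e: "e = xc d" by (auto simp: ext_tangent_atlas_eq)
    let ?O = "(snd c ` (fst c \<inter> fst d) \<times> (UNIV :: (real ^ 'n) set)) \<times> (UNIV :: real set)"
    have opO: "open ?O" using open_overlap[OF cA d] by (intro open_Times) auto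
    have mem: "C t \<in> fst (xc d) \<longleftrightarrow> \<gamma> t \<in> ?O" if t: "t \<in> I" for t
    proof
      assume "C t \<in> fst (xc d)"
      then have "snd (xc c) (C t) \<in> snd (xc c) ` (fst (xc c) \<inter> fst (xc d))" using q(2)[OF t] by blast
      then show "\<gamma> t \<in> ?O" unfolding ext_chart_image[OF cA d] q(4)[OF t] by auto
    next
      assume "\<gamma> t \<in> ?O"
      then have "\<gamma> t \<in> snd (xc c) ` (fst (xc c) \<inter> fst (xc d))"
        unfolding ext_chart_image[OF cA d] using im[OF t] by auto
      then obtain k where k: "k \<in> fst (xc c)" "k \<in> fst (xc d)" "\<gamma> t = snd (xc c) k" by blast
      have "C t = k" unfolding C_def k(3) by (rule ext.chart_inv_chart[OF xcT k(1)])
      then show "C t \<in> fst (xc d)" using k(2) by simp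
    qed
    have eq: "I \<inter> C -` fst e = I \<inter> \<gamma> -` ?O" 
      unfolding e by (rule Set.set_eqI, unfold Int_iff vimage_eq, rule conj_cong[OF refl mem])
    have op: "open (I \<inter> \<gamma> -` ?O)"
      by (rule continuous_open_preimage[OF Cinf_on_continuous[OF smooth] I(1) opO])
    show "openin (top_of_set I) (I \<inter> C -` fst e)"
      unfolding eq by (rule open_subset[OF _ op]) auto
    have "Cinf_on (\<lambda>t. (\<lambda>z. (((snd d \<circ> chart_inv c) (fst (fst z)),
        frechet_derivative (snd d \<circ> chart_inv c) (at (fst (fst z))) (snd (fst z))), snd z)) (\<gamma> t)) (I \<inter> \<gamma> -` ?O)"
      by (rule Cinf_on_compose[OF op opO _ Cinf_on_ext_transition[OF cA d] Cinf_on_subset[OF smooth]]) auto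
    then have "Cinf_on (snd e \<circ> C) (I \<inter> \<gamma> -` ?O)"
    proof (rule Cinf_on_cong[OF _ op])
      fix t assume t: "t \<in> I \<inter> \<gamma> -` ?O"
      then have "\<gamma> t \<in> ?O" "\<gamma> t \<in> int_image c" using im by blast+
      then have "fst (fst (\<gamma> t)) \<in> snd c ` (fst c \<inter> fst d)" "snd (\<gamma> t) \<in> {a..b}"
        by (simp_all only: mem_Times_iff) simp
      from ext_transition[OF cA d this, of "snd (fst (\<gamma> t))"]
      show "(((snd d \<circ> chart_inv c) (fst (fst (\<gamma> t))),
        frechet_derivative (snd d \<circ> chart_inv c) (at (fst (fst (\<gamma> t)))) (snd (fst (\<gamma> t)))), snd (\<gamma> t)) = (snd e \<circ> C) t"
        by (simp add: e C_def)
    qed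
    then show "smooth_on (I \<inter> C -` fst e) (snd e \<circ> C)"
      unfolding eq by (rule Cinf_on_imp_smooth_on[OF _ op order_refl])
  qed (rule I)+
  have vel: "velocity TA I C t = coord_vector TA (xc c) (pack (u (\<gamma> t))) (C t)" if t: "t \<in> I" for t
  proof (rule ext.velocity_eq_coord_vector[where C = C and t = t and N = I, OF I(2,3) ext_charts_at[OF q(1,3)[OF t]] t])
    show "openin (top_of_set I) I" by simp
    show "C ` I \<subseteq> fst (xc c)" using q(2) by blast
    have "(\<gamma> has_vector_derivative pack (u (\<gamma> t))) (at t within I)"
      by (rule has_vector_derivative_at_within[OF \<gamma>'(2)[OF t]])
    then show "((snd (xc c) \<circ> C) has_vector_derivative pack (u (\<gamma> t))) (at t within I)"
      by (rule has_vector_derivative_transform[OF t, rotated]) (simp add: q(4))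
  qed (rule t)
  have "vortex_line TA Theta I C"
    unfolding vortex_line_def
  proof (intro conjI ballI curve)
    fix t assume t: "t \<in> I"
    note C = ext_charts_at[OF q(1,3)[OF t]]
    have ut: "(\<chi> k l. ?D k l (\<gamma> t)) *v u (\<gamma> t) = 0" "u (\<gamma> t) \<noteq> 0"
      using u[OF \<gamma>'(1)[OF t]] by blast+
    show "velocity TA I C t \<in> null_space TA dTheta (C t)"
      unfolding vel[OF t] using ut(1) unfolding C_def dcoef_kernel[OF cA im[OF t]] null_space_dcoef[OF cA im[OF t]] .
    show "velocity TA I C t \<noteq> 0"
    proof
      assume "velocity TA I C t = 0"
      then have "coord_vector TA (xc c) (pack (u (\<gamma> t))) (C t) (xc c) = 0"
        unfolding vel[OF t] by simp
      then have "pack (u (\<gamma> t)) = pack 0"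
        unfolding ext.coord_vector_chart[OF C] by (simp add: linear_0[OF linear_pack])
      from injD[OF bij_is_inj[OF bij_pack] this] ut(2) show False by simp
    qed
  qed
  then show ?thesis by (rule that[OF _ I(4)]) (simp add: C_def h(2) m_z0)
qed

section \<open>The equivalence\<close>

lemma holonomic_imp_legendre_interior:
  assumes nonsing: "nonsingular_form TA dTheta"
    and hol: "\<And>I C. vortex_line TA Theta I C \<Longrightarrow> holonomic A I C"
    and m: "m \<in> points TA" and s: "time_coord m \<in> {a<..<b}"
  shows "p j m = deriv_xi G A a b \<epsilon> j L m"
proof -
  obtain I C where vl: "vortex_line TA Theta I C" and 0: "(0::real) \<in> I" "C 0 = m"
    by (rule vortex_line_through[OF nonsing m s])
  have curve: "smooth_curve TA I C" and null: "velocity TA I C 0 \<in> null_space TA dTheta m"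
    using vl 0 unfolding vortex_line_def by blast+
  have V: "velocity TA I C 0 \<in> tangent_space TA m" using null by (simp add: null_space_def)
  note h = holonomicD[OF curve hol[OF vl] 0(1), unfolded 0(2)]
  have "dTheta m (velocity TA I C 0) (Exi j m) = 0"
    using null Exi_in_tangent_space[OF m] unfolding null_space_def by blast
  then have "(p j m - deriv_xi G A a b \<epsilon> j L m) * ds m (velocity TA I C 0) = 0"
    unfolding dTheta_Exi[OF m V] h(1) by simp
  then show ?thesis using h(2) by simp
qed

text \<open>With base point and fibre vector fixed, one chart covers the whole slice and only the
  time coordinate moves. Continuity of the derivative at the end times comes from smoothness of
  one-sided derivatives.\<close>

lemma continuous_on_time_slice:
  assumes m: "m \<in> points TA"
  shows "continuous_on {a..b} (\<lambda>s. p j (fst m, s))"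
    "continuous_on {a..b} (\<lambda>s. deriv_xi G A a b \<epsilon> j L (fst m, s))"
proof -
  obtain c where c: "c \<in> charts_at A (base_point m)" by (rule ext_chart_exists[OF m])
  have cA: "c \<in> A" by (rule charts_atD(1)[OF c])
  let ?S = "(snd c ` fst c \<times> (UNIV :: (real ^ 'n) set)) \<times> {a..b}"
  let ?z = "\<lambda>s. (fst (snd (xc c) m), s)"
  have pts: "(fst m, s) \<in> points TA" "c \<in> charts_at A (base_point (fst m, s))"
    "snd (xc c) (fst m, s) = ?z s" if "s \<in> {a..b}" for s
    using m c that by (simp_all add: mem_points_ext base_point_def fibre_vector_def time_coord_def snd_ext_chart)
  have zS: "?z ` {a..b} \<subseteq> ?S"
    using base_point_in_chart[OF c] by (auto simp: snd_ext_chart)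
  have cont: "continuous_on {a..b} ?z" by (intro continuous_intros)
  have inv: "chart_inv (xc c) (?z s) = (fst m, s)" if "s \<in> {a..b}" for s
    using ext.chart_inv_chart[OF charts_atD[OF ext_charts_at[OF pts(1,2)[OF that]]]] pts(3)[OF that] by simp
  have "continuous_on {a..b} (\<lambda>s. (p j \<circ> chart_inv (xc c)) (?z s))"
    by (rule continuous_on_compose2[OF smooth_on_continuous[OF smooth_function_chart[OF smooth_p cA]] cont zS])
  then show "continuous_on {a..b} (\<lambda>s. p j (fst m, s))"
    by (rule continuous_on_eq) (simp add: inv)
  have "xc c \<in> TA" using cA by (simp add: ext_tangent_atlas_eq)
  then have ud: "unique_derivatives ?S"
    using ext.unique_derivatives_chart[of "xc c"] unfolding ext_chart_image_self[OF cA] by blast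
  \<comment> \<open>The coordinates of the vertical frame vector depend on the base point only, so
    the direction is constant along the slice.\<close>
  let ?v = "((0, frame j (base_point m) c), 0)"
  have "continuous_on {a..b} (\<lambda>s. frechet_derivative (L \<circ> chart_inv (xc c)) (at (?z s) within ?S) ?v)"
    by (rule continuous_on_compose2[OF smooth_on_continuous[OF
            smooth_on_frechet_derivative[OF ud smooth_function_chart[OF smooth_L cA]]] cont zS])
  then show "continuous_on {a..b} (\<lambda>s. deriv_xi G A a b \<epsilon> j L (fst m, s))"
  proof (rule continuous_on_eq)
    fix s assume s: "s \<in> {a..b}"
    have "base_point (fst m, s) = base_point m" by (simp add: base_point_def)
    then show "frechet_derivative (L \<circ> chart_inv (xc c)) (at (?z s) within ?S) ?v =
        deriv_xi G A a b \<epsilon> j L (fst m, s)"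
      unfolding deriv_xi_eq[OF pts(2,1)[OF s] smooth_function_chart_differentiable[OF smooth_L pts(2,1)[OF s]]]
        chart_derivative_def pts(3)[OF s] ext_chart_image_self[OF cA] by simp
  qed
qed

lemma holonomic_imp_legendre:
  assumes nonsing: "nonsingular_form TA dTheta"
    and hol: "\<And>I C. vortex_line TA Theta I C \<Longrightarrow> holonomic A I C"
    and m: "m \<in> points TA"
  shows "p j m = deriv_xi G A a b \<epsilon> j L m"
proof -
  let ?f = "\<lambda>s. p j (fst m, s) - deriv_xi G A a b \<epsilon> j L (fst m, s)"
  \<comment> \<open>Since a < b, interior times are dense in the interval, end points
    included.\<close>
  have cl: "closure {a<..<b} = {a..b}" using a_less_b by simp
  have "?f (time_coord m) = 0"
  proof (rule continuous_constant_on_closure[of "{a<..<b}" ?f])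
    show "continuous_on (closure {a<..<b}) ?f"
      unfolding cl by (intro continuous_on_diff continuous_on_time_slice m)
    show "time_coord m \<in> closure {a<..<b}"
      unfolding cl using m by (simp add: mem_points_ext)
    fix s assume s: "s \<in> {a<..<b}"
    have "(fst m, s) \<in> points TA" "time_coord (fst m, s) \<in> {a<..<b}"
      using m s by (simp_all add: mem_points_ext base_point_def fibre_vector_def time_coord_def)
    from holonomic_imp_legendre_interior[OF nonsing hol this]
    show "?f s = 0" by simp
  qed
  then show ?thesis by (simp add: time_coord_def)
qed

text \<open>\<eta> vanishes on the null velocity; if ds vanished as well, the velocity would be 0,
  contrary to the regular parametrization of a vortex line.\<close>

lemma legendre_imp_holonomic:
  assumes leg: "\<And>i m. m \<in> points TA \<Longrightarrow> p i m = deriv_xi G A a b \<epsilon> i L m"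
    and reg: "\<And>m. m \<in> points TA \<Longrightarrow>
      invertible (\<chi> i j. deriv_xi G A a b \<epsilon> i (deriv_xi G A a b \<epsilon> j L) m)"
    and vl: "vortex_line TA Theta I C"
  shows "holonomic A I C"
proof (rule holonomicI)
  show curve: "smooth_curve TA I C" using vl by (simp add: vortex_line_def)
  fix t assume t: "t \<in> I"
  have m: "C t \<in> points TA" using curve t unfolding smooth_curve_iff by blast
  have V: "velocity TA I C t \<in> null_space TA dTheta (C t)" "velocity TA I C t \<noteq> 0"
    using vl t unfolding vortex_line_def by blast+
  show "eta i (C t) (velocity TA I C t) = 0" for i
    by (rule null_vector_eta[OF leg reg m V(1)])
  show "ds (C t) (velocity TA I C t) \<noteq> 0"
    using null_vector_0[OF leg reg m V(1)] V(2) by blast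
qed

end

theorem proposition2:
  fixes G :: "('q, 'x) monoid_scheme"
    and A :: "('q, real ^ 'n) chart set"
    and \<epsilon> :: "'n::finite \<Rightarrow> ('q, real ^ 'n) tvec"
    and a b :: real
    and L :: "('q, real ^ 'n) ext_point \<Rightarrow> real"
    and p :: "'n \<Rightarrow> ('q, real ^ 'n) ext_point \<Rightarrow> real"
  assumes "lie_group G A"
    and "a < b"
    and "tangent_basis A \<one>\<^bsub>G\<^esub> \<epsilon>"
    and "smooth_function (ext_model a b) (ext_tangent_atlas A a b) L"
    and "\<And>m. m \<in> tangent_bundle A \<times> {a..b} \<Longrightarrow>
           invertible (\<chi> i j. deriv_xi G A a b \<epsilon> i (deriv_xi G A a b \<epsilon> j L) m)"
    and "\<And>i. smooth_function (ext_model a b) (ext_tangent_atlas A a b) (p i)"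
  shows "(nonsingular_form (ext_tangent_atlas A a b)
            (ext_deriv (ext_tangent_atlas A a b) (lagrange_form G A a b \<epsilon> L p)) \<and>
          (\<forall>I C. vortex_line (ext_tangent_atlas A a b) (lagrange_form G A a b \<epsilon> L p) I C
             \<longrightarrow> holonomic A I C))
     \<longleftrightarrow> (\<forall>i. \<forall>m \<in> tangent_bundle A \<times> {a..b}. p i m = deriv_xi G A a b \<epsilon> i L m)"
proof -
  interpret lie_group G A by (rule assms(1))
  interpret lagrangian G A \<epsilon> a b L p
    by unfold_locales (rule assms)+
  show ?thesis
    using holonomic_imp_legendre nonsingular_legendre legendre_imp_holonomic assms(5)
    unfolding points_ext_tangent_atlas[symmetric] by blast
qed

end
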